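(* Let $K\subset\mathbb{C}^n$ be compact and let $U\subset\mathbb{C}^n$ be open with $U\cap K=\varnothing$. For every plurisubharmonic function $\varphi$ on $\overline{U}$ and every $p\in U\cap\mathscr{R}\text{-hull}(K)$ we have $$\varphi(p)\le\max_{\partial U\cap\mathscr{R}\text{-hull}(K)}\varphi.$$
   Context: $\mathscr{R}\text{-hull}(K)$ denotes the rationally convex hull of $K$, the compact set $$\mathscr{R}\text{-hull}(K)=\{z\in\mathbb{C}^n : |R(z)|\le\max_K|R| \text{ for all rational functions } R\in\mathbb{C}(z_1,\dots,z_n) \text{ that are regular on } K\}.$$ A plurisubharmonic function on a non-open subset means a plurisubharmonic function on some (unspecified) open neighbourhood of that subset. Plurisubharmonic functions are upper semicontinuous and not assumed continuous. *)

theory Defs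
  imports "HOL-Analysis.Analysis"
begin

(* Elements of C[z_1,...,z_n], represented by their evaluation functions on C^n
   (faithful because C is infinite). *)
inductive cpolynomial :: "(complex ^ 'n \<Rightarrow> complex) \<Rightarrow> bool" where
  const: "cpolynomial (\<lambda>z. c)"
| coord: "cpolynomial (\<lambda>z. z $ i)"
| add: "cpolynomial P \<Longrightarrow> cpolynomial Q \<Longrightarrow> cpolynomial (\<lambda>z. P z + Q z)"
| mult: "cpolynomial P \<Longrightarrow> cpolynomial Q \<Longrightarrow> cpolynomial (\<lambda>z. P z * Q z)"

(* The modulus |P/Q| of a quotient of polynomials, with the value \<infinity> on the zero set of Q
   (HOL's convention x / 0 = 0 would be wrong here). *)
definition rat_abs ::
    "(complex ^ 'n \<Rightarrow> complex) \<Rightarrow> (complex ^ 'n \<Rightarrow> complex) \<Rightarrow> complex ^ 'n \<Rightarrow> ereal" where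
  "rat_abs P Q z = (if Q z = 0 then \<infinity> else ereal (cmod (P z / Q z)))"

(* A rational function regular on K is a quotient P/Q of polynomials with Q zero-free on K.
   P/Q need not be in lowest terms, so Q z = 0 does not force P/Q to have a singularity at z;
   but then 1/Q is regular on K and does have a pole at z, so the hull is not affected.
   For compact nonempty K the supremum is the maximum of |P/Q| over K; for empty K it is
   -\<infinity>, so that the hull of the empty set is empty. *)
definition rational_hull :: "(complex ^ 'n) set \<Rightarrow> (complex ^ 'n) set" where
  "rational_hull K =
     {z. \<forall>P Q. cpolynomial P \<longrightarrow> cpolynomial Q \<longrightarrow> (\<forall>w\<in>K. Q w \<noteq> 0) \<longrightarrow>
            rat_abs P Q z \<le> (SUP w\<in>K. rat_abs P Q w)}"

(* The mean value of u over the circle t \<mapsto> a + exp(it) b, as integral of the positive part minus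
   integral of the negative part (e2ennreal sends negative numbers to 0). If u is bounded above
   on the circle the first integral is finite, and the mean is a number in [-\<infinity>,\<infinity>). *)
definition circle_mean :: "(complex ^ 'n \<Rightarrow> ereal) \<Rightarrow> complex ^ 'n \<Rightarrow> complex ^ 'n \<Rightarrow> ereal" where
  "circle_mean u a b =
     (enn2ereal (\<integral>\<^sup>+t\<in>{0..2*pi}. e2ennreal (u (a + cis t *s b)) \<partial>lborel)
      - enn2ereal (\<integral>\<^sup>+t\<in>{0..2*pi}. e2ennreal (- u (a + cis t *s b)) \<partial>lborel)) / ereal (2 * pi)"

(* Plurisubharmonic functions take values in [-\<infinity>,\<infinity>); being identically -\<infinity> is allowed.
   For open V, openness of all sublevel sets is upper semicontinuity on V. *)
definition psh_on_open :: "(complex ^ 'n) set \<Rightarrow> (complex ^ 'n \<Rightarrow> ereal) \<Rightarrow> bool" where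
  "psh_on_open V u \<longleftrightarrow>
     open V \<and>
     (\<forall>z\<in>V. u z < \<infinity>) \<and>
     (\<forall>c. open {z \<in> V. u z < c}) \<and>
     (\<forall>a b. (\<forall>\<zeta>. cmod \<zeta> \<le> 1 \<longrightarrow> a + \<zeta> *s b \<in> V) \<longrightarrow> u a \<le> circle_mean u a b)"

definition plurisubharmonic_on :: "(complex ^ 'n) set \<Rightarrow> (complex ^ 'n \<Rightarrow> ereal) \<Rightarrow> bool" where
  "plurisubharmonic_on S u \<longleftrightarrow> (\<exists>V. S \<subseteq> V \<and> psh_on_open V u)"

end

(* Suppose phi(p) > max phi over the part of the boundary of U in the hull H of K. Truncating phi
   from below, mollifying it and adding a small multiple of |z - p|^2, one finds a point of H in U
   where the sum is maximal on H; its Levi polynomial there gives a polynomial f which peaks at that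
   point locally on H. So it suffices to exclude local peak points of H off K (a special case of
   Rossi's local maximum principle). First, an isolated point of the rationally convex set
   {z in H. f z = 1} can be separated from the rest by a rational function R. Next, S = R' f, with R'
   a sharpened R, satisfies |S| < 1 on {z in H. |f z - 1| = t}, so by Gelfand theory the powers of S
   become small in the algebra of Laurent polynomials in lambda modulo f - 1 - lambda. Splitting such
   a representation of S^m into nonnegative and negative powers of f - 1 yields a rational function
   close to S^m where |f - 1| <= t and close to 0 where |f - 1| >= t. It is close to 1 at the peak
   point and bounded by 5/8 on K, a contradiction. *)
theory Submission
  imports Defs "HOL-Library.Function_Algebras"
begin

text \<open>The strict peak controls \<open>f\<close> only near \<open>p\<close>; the hull may meet
  the set where \<open>f\<close> is close to 1 again far away. This is why a separating function
  \<open>R\<close> must come before the cut-off. The separation itself uses the same cut-off, by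
  induction over the coordinates. Passing from local to global data would usually take a Cousin
  problem near the hull. Here the two halves of a Laurent expansion play that role. The half with
  nonnegative powers is rational and regular on \<open>K\<close>, hence so is its difference from
  \<open>S ^ m\<close>, although as the half with negative powers it seems to have poles. Small
  Laurent coefficients come from a spectral radius argument on incomplete algebras: approximate
  inverses replace inverses and quotient seminorms replace maximal ideals, so neither completions
  nor vector-valued holomorphic functions appear. On the analytic side a second-order Taylor
  expansion with cubic error suffices, hence a kernel with Lipschitz second derivatives; the
  quadratic term absorbs the error.\<close>

section \<open>Joint spectra in commutative seminormed algebras\<close>

lemma cis_root_of_unity: "0 < n \<Longrightarrow> cis (2 * pi * real k / real n) ^ n = 1"
  using cis_multiple_2pi[of "real k"] by (simp add: Complex.DeMoivre)

lemma sum_roots_of_unity_power: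
  fixes n j :: nat
  assumes "j < n"
  shows "(\<Sum>k<n. (cis (2 * pi * real k / real n)) ^ j) = (if j = 0 then of_nat n else 0)"
proof (cases "j = 0")
  case False
  define w where "w = cis (2 * pi * real j / real n)"
  have "inj_on (\<lambda>k. cis (2 * pi * real k / real n)) {..<n}"
    using Complex.bij_betw_roots_unity[of n] assms by (auto simp: bij_betw_def)
  from inj_onD[OF this, of j 0] have w1: "w \<noteq> 1"
    using False assms by (auto simp: w_def)
  have wn: "w ^ n = 1" using assms by (simp add: w_def cis_root_of_unity)
  have "(\<Sum>k<n. (cis (2 * pi * real k / real n)) ^ j) = (\<Sum>k<n. w ^ k)"
    by (intro sum.cong) (auto simp: w_def Complex.DeMoivre algebra_simps)
  also have "\<dots> = 0" using w1 wn by (simp add: sum_gp_strict)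
  finally show ?thesis using False by simp
qed simp

text \<open>Partial Neumann sums: they make the error of an approximate inverse arbitrarily small
  once \<open>d\<close> has norm below 1.\<close>

lemma one_diff_geometric:
  fixes d :: "'a::comm_ring_1"
  assumes "y * b = 1 - d"
  shows "1 - y * (b * (\<Sum>j<n. d ^ j)) = d ^ n"
proof -
  have "y * (b * (\<Sum>j<n. d ^ j)) = 1 - d ^ n"
    using assms one_diff_power_eq[of d n] by (metis mult.assoc)
  then show ?thesis by simp
qed

text \<open>The carrier \<open>A\<close> singles out a subring of a ring of arbitrary functions.
  Completeness is not assumed and \<open>\<nu>\<close> may vanish on nonzero elements, so quotients
  are formed by shrinking \<open>\<nu>\<close> while the elements stay the same. Submultiplicativity
  leaves only \<open>\<nu> 1 = 0\<close> or \<open>1 \<le> \<nu> 1\<close>; \<open>one_le\<close>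
  picks the nontrivial case.\<close>

locale salg =
  fixes A :: "'r::comm_ring_1 set" and c :: "complex \<Rightarrow> 'r" and \<nu> :: "'r \<Rightarrow> real"
  assumes c_one: "c 1 = 1"
    and c_add: "c (v + w) = c v + c w"
    and c_mult: "c (v * w) = c v * c w"
    and c_in: "c w \<in> A"
    and add_in: "x \<in> A \<Longrightarrow> y \<in> A \<Longrightarrow> x + y \<in> A"
    and mult_in: "x \<in> A \<Longrightarrow> y \<in> A \<Longrightarrow> x * y \<in> A"
    and nonneg: "x \<in> A \<Longrightarrow> 0 \<le> \<nu> x"
    and tri: "x \<in> A \<Longrightarrow> y \<in> A \<Longrightarrow> \<nu> (x + y) \<le> \<nu> x + \<nu> y"
    and subm: "x \<in> A \<Longrightarrow> y \<in> A \<Longrightarrow> \<nu> (x * y) \<le> \<nu> x * \<nu> y"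
    and scal: "x \<in> A \<Longrightarrow> \<nu> (c w * x) \<le> cmod w * \<nu> x"
    and one_le: "1 \<le> \<nu> 1"
begin

lemma c_zero: "c 0 = 0"
  using c_add[of 0 0] by simp

lemma c_uminus: "c (- w) = - c w"
  using c_add[of w "- w"] c_zero by (simp add: eq_neg_iff_add_eq_0 add.commute)

lemma c_diff: "c (v - w) = c v - c w"
  using c_add[of v "- w"] c_uminus by simp

lemma c_power: "c (w ^ n) = c w ^ n"
  by (induction n) (simp_all add: c_one c_mult)

lemma c_sum: "c (\<Sum>i\<in>I. f i) = (\<Sum>i\<in>I. c (f i))"
  by (induction I rule: infinite_finite_induct) (simp_all add: c_zero c_add)

lemma one_in: "1 \<in> A"
  using c_in[of 1] c_one by simp

lemma zero_in: "0 \<in> A"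
  using c_in[of 0] c_zero by simp

lemma uminus_in: "x \<in> A \<Longrightarrow> - x \<in> A"
  using mult_in[OF c_in[of "-1"], of x] by (simp add: c_uminus c_one)

lemma diff_in: "x \<in> A \<Longrightarrow> y \<in> A \<Longrightarrow> x - y \<in> A"
  using add_in[of x "- y"] uminus_in by simp

lemma power_in: "x \<in> A \<Longrightarrow> x ^ n \<in> A"
  by (induction n) (simp_all add: one_in mult_in)

lemma sum_in: "(\<And>i. i \<in> I \<Longrightarrow> f i \<in> A) \<Longrightarrow> (\<Sum>i\<in>I. f i) \<in> A"
  by (induction I rule: infinite_finite_induct) (simp_all add: zero_in add_in)

lemmas ins = c_in one_in zero_in uminus_in diff_in power_in sum_in add_in mult_in

lemma nu_zero: "\<nu> 0 = 0"
  using scal[OF zero_in, of 0] nonneg[OF zero_in] by (simp add: c_zero)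

lemma nu_uminus_le: "x \<in> A \<Longrightarrow> \<nu> (- x) \<le> \<nu> x"
  using scal[of x "-1"] by (simp add: c_uminus c_one)

lemma nu_uminus: "x \<in> A \<Longrightarrow> \<nu> (- x) = \<nu> x"
  using nu_uminus_le[of x] nu_uminus_le[of "- x"] uminus_in by force

lemma nu_diff: "x \<in> A \<Longrightarrow> y \<in> A \<Longrightarrow> \<nu> (x - y) \<le> \<nu> x + \<nu> y"
  using tri[of x "- y"] nu_uminus[of y] uminus_in by simp

lemma nu_scal: "x \<in> A \<Longrightarrow> \<nu> (c w * x) = cmod w * \<nu> x"
proof (cases "w = 0")
  case False
  assume x: "x \<in> A"
  have "\<nu> x = \<nu> (c (1 / w) * (c w * x))"
    using False by (simp flip: c_mult mult.assoc add: c_one)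
  also have "\<dots> \<le> cmod (1 / w) * \<nu> (c w * x)"
    using x by (intro scal ins)
  finally have "cmod w * \<nu> x \<le> \<nu> (c w * x)"
    using False by (simp add: norm_divide field_simps)
  with scal[OF x, of w] show ?thesis by simp
qed (simp add: c_zero nu_zero)

lemma nu_sum: "(\<And>i. i \<in> I \<Longrightarrow> f i \<in> A) \<Longrightarrow> \<nu> (\<Sum>i\<in>I. f i) \<le> (\<Sum>i\<in>I. \<nu> (f i))"
proof (induction I rule: infinite_finite_induct)
  case (insert i I)
  have "\<nu> (f i + (\<Sum>i\<in>I. f i)) \<le> \<nu> (f i) + \<nu> (\<Sum>i\<in>I. f i)"
    using insert.prems by (intro tri sum_in) auto
  also have "\<nu> (\<Sum>i\<in>I. f i) \<le> (\<Sum>i\<in>I. \<nu> (f i))"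
    using insert by auto
  finally show ?case using insert by simp
qed (simp_all add: nu_zero)

lemma nu_power: "x \<in> A \<Longrightarrow> \<nu> (x ^ Suc n) \<le> \<nu> x ^ Suc n"
proof (induction n)
  case (Suc n)
  have "\<nu> (x ^ Suc (Suc n)) \<le> \<nu> x * \<nu> (x ^ Suc n)"
    using subm[OF Suc.prems power_in[OF Suc.prems], of "Suc n"] by simp
  also have "\<dots> \<le> \<nu> x * \<nu> x ^ Suc n"
    using Suc nonneg by (intro mult_left_mono) auto
  finally show ?case by simp
qed simp

text \<open>The quotient seminorm modulo the ideal generated by \<open>y\<close>. The hypothesis
  \<open>bad\<close> keeps this ideal at distance at least 1 from \<open>1\<close>, so the quotient
  is not trivial.\<close>

lemma quotient_salg:
  assumes y: "y \<in> A" and bad: "\<And>b. b \<in> A \<Longrightarrow> 1 \<le> \<nu> (1 - y * b)"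
  obtains \<nu>' where "salg A c \<nu>'" "\<And>x. x \<in> A \<Longrightarrow> \<nu>' x \<le> \<nu> x" "\<nu>' y = 0"
proof
  define N where "N = (\<lambda>x. INF b\<in>A. \<nu> (x - y * b))"
  have bdd: "bdd_below ((\<lambda>b. \<nu> (x - y * b)) ` A)" if "x \<in> A" for x
    using that y by (intro bdd_belowI2[of _ 0] nonneg ins)
  have A_ne: "A \<noteq> {}" using one_in by blast
  have lower: "N x \<le> \<nu> (x - y * b)" if "x \<in> A" "b \<in> A" for x b
    unfolding N_def using bdd[OF that(1)] that(2) by (rule cINF_lower)
  have approx: "\<exists>b\<in>A. \<nu> (x - y * b) < N x + e" if "x \<in> A" "e > 0" for x e
    using cINF_less_iff[OF A_ne bdd[OF that(1)], of "N x + e"] that(2) unfolding N_def by auto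
  have N_nonneg: "0 \<le> N x" if "x \<in> A" for x
    unfolding N_def using A_ne that y by (intro cINF_greatest nonneg ins) auto
  show "salg A c N"
  proof unfold_locales
    fix x z w
    assume x: "x \<in> A"
    show "0 \<le> N x" by (rule N_nonneg[OF x])
    show "N (c w * x) \<le> cmod w * N x"
    proof (rule field_le_epsilon)
      fix e :: real assume e: "e > 0"
      define d where "d = e / (cmod w + 1)"
      have d: "d > 0" "cmod w * d \<le> e" using e unfolding d_def
        by (auto simp: divide_simps add_nonneg_pos mult_left_mono)
      obtain b where b: "b \<in> A" "\<nu> (x - y * b) < N x + d" using approx[OF x d(1)] by blast
      have "N (c w * x) \<le> \<nu> (c w * x - y * (c w * b))" using x b y by (intro lower ins)
      also have "c w * x - y * (c w * b) = c w * (x - y * b)" by (simp add: algebra_simps)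
      also have "\<nu> \<dots> \<le> cmod w * \<nu> (x - y * b)" using x y b by (intro scal ins)
      also have "\<dots> \<le> cmod w * (N x + d)" using b by (intro mult_left_mono) auto
      also have "\<dots> \<le> cmod w * N x + e" using d by (simp add: algebra_simps)
      finally show "N (c w * x) \<le> cmod w * N x + e" .
    qed
    assume z: "z \<in> A"
    show "N (x + z) \<le> N x + N z"
    proof (rule field_le_epsilon)
      fix e :: real assume e: "e > 0"
      obtain b where b: "b \<in> A" "\<nu> (x - y * b) < N x + e/2" using approx[OF x, of "e/2"] e by auto
      obtain d where d: "d \<in> A" "\<nu> (z - y * d) < N z + e/2" using approx[OF z, of "e/2"] e by auto
      have "N (x + z) \<le> \<nu> (x + z - y * (b + d))" using x z b d by (intro lower ins)
      also have "x + z - y * (b + d) = (x - y * b) + (z - y * d)" by (simp add: algebra_simps)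
      also have "\<nu> \<dots> \<le> \<nu> (x - y * b) + \<nu> (z - y * d)" using x y z b d by (intro tri ins)
      finally show "N (x + z) \<le> N x + N z + e" using b d by simp
    qed
    show "N (x * z) \<le> N x * N z"
    proof (rule field_le_epsilon)
      fix e :: real assume e: "e > 0"
      define s where "s = min 1 (e / (N x + N z + 1))"
      have Nx: "0 \<le> N x" "0 \<le> N z" using N_nonneg x z by auto
      then have s: "0 < s" "s \<le> 1" "s \<le> e / (N x + N z + 1)" using e by (auto simp: s_def)
      then have s': "s * (N x + N z + 1) \<le> e" using Nx by (simp add: pos_le_divide_eq)
      obtain b where b: "b \<in> A" "\<nu> (x - y * b) < N x + s" using approx[OF x s(1)] by auto
      obtain d where d: "d \<in> A" "\<nu> (z - y * d) < N z + s" using approx[OF z s(1)] by auto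
      \<comment> \<open>The multiple of \<open>y\<close> is chosen so that the difference factors as
        \<open>(x - y * b) * (z - y * d)\<close>.\<close>
      have "N (x * z) \<le> \<nu> (x * z - y * (b * z + x * d - b * d * y))"
        using x y z b d by (intro lower ins)
      also have "x * z - y * (b * z + x * d - b * d * y) = (x - y * b) * (z - y * d)"
        by (simp add: algebra_simps)
      also have "\<nu> \<dots> \<le> \<nu> (x - y * b) * \<nu> (z - y * d)" using x y z b d by (intro subm ins)
      also have "\<dots> \<le> (N x + s) * (N z + s)"
        using x y z b d Nx s by (intro mult_mono nonneg ins) auto
      also have "\<dots> = N x * N z + s * (N x + N z + s)" by (simp add: algebra_simps)
      also have "s * (N x + N z + s) \<le> s * (N x + N z + 1)"
        using s by (intro mult_left_mono) auto
      finally show "N (x * z) \<le> N x * N z + e" using s' by simp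
    qed
  next
    show "1 \<le> N 1" unfolding N_def using A_ne bad by (intro cINF_greatest) auto
  qed (fact c_one c_add c_mult c_in add_in mult_in)+
  show "N x \<le> \<nu> x" if "x \<in> A" for x
    using lower[OF that zero_in] by simp
  show "N y = 0"
    using lower[OF y one_in] N_nonneg[OF y] nu_zero by simp
qed

text \<open>Stands in for an inverse of norm at most \<open>M\<close> in the completion:
  \<open>M\<close> does not depend on the error \<open>e\<close>.\<close>

definition approx_inv :: "real \<Rightarrow> 'r \<Rightarrow> bool" where
  "approx_inv M y \<longleftrightarrow> (\<forall>e>0. \<exists>b\<in>A. \<nu> b \<le> M \<and> \<nu> (1 - y * b) \<le> e)"

text \<open>The Neumann series with ratio \<open>1 - y * b\<close> has bounded partial sums: the
  term \<open>1\<close> contributes \<open>\<nu> 1\<close>, which may exceed 1, and the other terms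
  add up to at most 1.\<close>

lemma neumann:
  assumes y: "y \<in> A" and b: "b \<in> A" and e: "\<nu> (1 - y * b) \<le> 1/2"
  shows "approx_inv (\<nu> b * (\<nu> 1 + 1)) y"
  unfolding approx_inv_def
proof (intro allI impI)
  fix \<epsilon> :: real assume "\<epsilon> > 0"
  define d where "d = 1 - y * b"
  have d: "d \<in> A" "\<nu> d \<le> 1/2" "0 \<le> \<nu> d" using y b e by (auto simp: d_def intro!: ins nonneg)
  have dk: "\<nu> (d ^ Suc k) \<le> (1/2) ^ Suc k" for k
    using nu_power[OF d(1), of k] power_mono[OF d(2,3), of "Suc k"] by linarith
  have sumk: "\<nu> (\<Sum>j<Suc k. d ^ j) \<le> \<nu> 1 + (1 - (1/2) ^ k)" for k
  proof (induction k)
    case (Suc k)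
    have "\<nu> (\<Sum>j<Suc (Suc k). d ^ j) \<le> \<nu> (\<Sum>j<Suc k. d ^ j) + \<nu> (d ^ Suc k)"
      using tri[of "\<Sum>j<Suc k. d ^ j" "d ^ Suc k"] d by (simp add: ins)
    then show ?case using Suc dk[of k] by simp
  qed simp
  obtain k where k: "(1/2::real) ^ k < \<epsilon>"
    using real_arch_pow_inv[OF \<open>\<epsilon> > 0\<close>, of "1/2"] by auto
  let ?b = "b * (\<Sum>j<Suc k. d ^ j)"
  have half: "0 < (1/2::real) ^ k" by simp
  have "\<nu> (\<Sum>j<Suc k. d ^ j) \<le> \<nu> 1 + 1"
    using sumk[of k] zero_le_power[of "1/2::real" k] by linarith
  then have "\<nu> b * \<nu> (\<Sum>j<Suc k. d ^ j) \<le> \<nu> b * (\<nu> 1 + 1)"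
    using b by (intro mult_left_mono nonneg)
  moreover have "\<nu> ?b \<le> \<nu> b * \<nu> (\<Sum>j<Suc k. d ^ j)" using b d by (intro subm ins)
  ultimately have 1: "\<nu> ?b \<le> \<nu> b * (\<nu> 1 + 1)" by linarith
  have "1 - y * ?b = d ^ Suc k"
    by (rule one_diff_geometric) (simp add: d_def)
  moreover have "(1/2::real) ^ Suc k = (1/2) ^ k / 2" by simp
  ultimately have "\<nu> (1 - y * ?b) = \<nu> (d ^ Suc k)" "(1/2::real) ^ Suc k = (1/2) ^ k / 2"
    by simp_all
  then have "\<nu> (1 - y * ?b) \<le> \<epsilon>"
    using dk[of k] k half by linarith
  with 1 show "\<exists>b'\<in>A. \<nu> b' \<le> \<nu> b * (\<nu> 1 + 1) \<and> \<nu> (1 - y * b') \<le> \<epsilon>"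
    using b d by (intro bexI[of _ ?b]) (auto intro!: ins simp del: sum.lessThan_Suc)
qed

lemma approx_inv_mono: "approx_inv M y \<Longrightarrow> M \<le> M' \<Longrightarrow> approx_inv M' y"
  unfolding approx_inv_def by (meson order_trans)

text \<open>With \<open>u = 1 / w\<close> the region \<open>1 \<le> cmod w\<close> becomes the
  punctured closed disc, and \<open>u = 0\<close> is harmless. Approximate invertibility is an open
  condition with locally uniform bounds, so compactness of the disc yields one
  \<open>M\<close>.\<close>

lemma approx_inv_uniform:
  assumes x: "x \<in> A"
    and inv: "\<And>w. 1 \<le> cmod w \<Longrightarrow> \<exists>b\<in>A. \<nu> (1 - (x - c w) * b) < 1"
  obtains M where "0 < M" "\<And>u. cmod u \<le> 1 \<Longrightarrow> approx_inv M (1 - c u * x)"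
proof -
  have quarter: "\<exists>b\<in>A. \<nu> (1 - (1 - c u * x) * b) < 1/4" if u: "cmod u \<le> 1" for u
  proof -
    have "\<exists>b\<in>A. \<nu> (1 - (1 - c u * x) * b) < 1"
    proof (cases "u = 0")
      case True
      then show ?thesis by (intro bexI[of _ 1]) (simp_all add: c_zero nu_zero one_in)
    next
      case False
      then have "1 \<le> cmod (1 / u)" using u by (simp add: norm_divide)
      from inv[OF this] obtain b where b: "b \<in> A" "\<nu> (1 - (x - c (1 / u)) * b) < 1" by blast
      have "c u * c (1 / u) = 1" using False by (simp flip: c_mult add: c_one)
      then have "x * b = c u * c (1 / u) * (x * b)" by simp
      then have "(1 - c u * x) * (- c (1 / u) * b) = (x - c (1 / u)) * b"
        by (simp add: algebra_simps)
      then show ?thesis using b by (intro bexI[of _ "- c (1 / u) * b"]) (auto intro!: ins)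
    qed
    then obtain b where b: "b \<in> A" "\<nu> (1 - (1 - c u * x) * b) < 1" by blast
    define d where "d = 1 - (1 - c u * x) * b"
    have d: "d \<in> A" "\<nu> d < 1" "0 \<le> \<nu> d"
      using b x by (auto simp: d_def intro!: ins nonneg)
    obtain k where k: "\<nu> d ^ k < 1/4" using real_arch_pow_inv[of "1/4" "\<nu> d"] d by auto
    have "\<nu> d ^ Suc k \<le> \<nu> d ^ k" using d by (intro power_decreasing) auto
    then have "\<nu> (d ^ Suc k) < 1/4" using nu_power[OF d(1), of k] k by linarith
    moreover have "1 - (1 - c u * x) * (b * (\<Sum>j<Suc k. d ^ j)) = d ^ Suc k"
      by (rule one_diff_geometric) (simp add: d_def)
    ultimately show ?thesis using b d
      by (intro bexI[of _ "b * (\<Sum>j<Suc k. d ^ j)"]) (auto intro!: ins simp del: sum.lessThan_Suc)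
  qed
  then obtain b where b: "\<And>u. u \<in> cball 0 1 \<Longrightarrow> b u \<in> A \<and> \<nu> (1 - (1 - c u * x) * b u) < 1/4"
    by (metis mem_cball_0)
  \<comment> \<open>The radius makes \<open>\<nu> (c (v - u) * (x * b u)) \<le> 1/4\<close>.
    Together with the error below 1/4 at the centre this meets the threshold 1/2 of
    \<open>neumann\<close>.\<close>
  define B where "B u = ball u (1 / (4 * (\<nu> (x * b u) + 1)))" for u
  have cover: "cball 0 1 \<subseteq> (\<Union>u\<in>cball 0 1. B u)"
  proof
    fix u :: complex assume u: "u \<in> cball 0 1"
    have "0 \<le> \<nu> (x * b u)" using b[OF u] x by (intro nonneg ins) auto
    then show "u \<in> (\<Union>u\<in>cball 0 1. B u)" using u by (auto simp: B_def intro!: bexI[of _ u])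
  qed
  obtain D where D: "D \<subseteq> cball 0 1" "finite D" "cball 0 1 \<subseteq> (\<Union>u\<in>D. B u)"
    using compactE_image[OF compact_cball _ cover] by (metis B_def open_ball)
  define M where "M = (\<Sum>u\<in>D. \<nu> (b u) * (\<nu> 1 + 1)) + 1"
  have t0: "0 \<le> \<nu> (b u) * (\<nu> 1 + 1)" if "u \<in> D" for u
    using b[of u] D that one_le by (intro mult_nonneg_nonneg nonneg) auto
  show thesis
  proof
    show "0 < M" unfolding M_def using t0 by (intro add_nonneg_pos sum_nonneg) auto
    fix v :: complex assume "cmod v \<le> 1"
    then obtain u where u: "u \<in> D" "v \<in> B u" using D by force
    have bu: "b u \<in> A" "\<nu> (1 - (1 - c u * x) * b u) < 1/4" using b u D by blast+
    have nx: "0 \<le> \<nu> (x * b u)" using bu x by (intro nonneg ins) auto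
    have "cmod (v - u) * \<nu> (x * b u) \<le> 1 / (4 * (\<nu> (x * b u) + 1)) * \<nu> (x * b u)"
      using u nx by (intro mult_right_mono) (auto simp: B_def dist_norm norm_minus_commute)
    also have "\<dots> \<le> 1/4" using nx by (simp add: divide_simps)
    finally have 1: "\<nu> (c (v - u) * (x * b u)) \<le> 1/4"
      using nu_scal[of "x * b u" "v - u"] bu x by (simp add: ins)
    have "1 - (1 - c v * x) * b u = (1 - (1 - c u * x) * b u) + c (v - u) * (x * b u)"
      by (simp add: c_diff algebra_simps)
    also have "\<nu> \<dots> \<le> \<nu> (1 - (1 - c u * x) * b u) + \<nu> (c (v - u) * (x * b u))"
      using bu x by (intro tri ins)
    finally have "\<nu> (1 - (1 - c v * x) * b u) \<le> 1/2" using 1 bu by simp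
    then have "approx_inv (\<nu> (b u) * (\<nu> 1 + 1)) (1 - c v * x)"
      using bu x by (intro neumann ins)
    then show "approx_inv M (1 - c v * x)"
    proof (rule approx_inv_mono)
      have "\<nu> (b u) * (\<nu> 1 + 1) \<le> (\<Sum>u\<in>D. \<nu> (b u) * (\<nu> 1 + 1))"
        using u D t0 by (intro member_le_sum) auto
      then show "\<nu> (b u) * (\<nu> 1 + 1) \<le> M" by (simp add: M_def)
    qed
  qed
qed

text \<open>Rickart's device: averaging approximate inverses of \<open>1 - \<omega>\<^sup>k r x\<close> over the \<open>n\<close>-th roots of unity
  gives an approximate inverse of \<open>1 - (r x)\<^sup>n\<close> with a bound that does not depend on \<open>n\<close>.\<close>

lemma approx_inv_roots:
  assumes x: "x \<in> A" and M: "0 < M" "\<And>u. cmod u \<le> 1 \<Longrightarrow> approx_inv M (1 - c u * x)"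
    and n: "0 < n" and r: "r1 \<in> {0..1}" "r2 \<in> {0..1::real}" and e: "0 < e"
  obtains B1 B2 where "B1 \<in> A" "B2 \<in> A" "\<nu> B1 \<le> M"
    "\<nu> (1 - (1 - (c r1 * x) ^ n) * B1) \<le> e"
    "\<nu> (1 - (1 - (c r2 * x) ^ n) * B2) \<le> e"
    "\<nu> (B1 - B2) \<le> M\<^sup>2 * \<nu> x * \<bar>r1 - r2\<bar> + e"
proof -
  define L where "L = (\<Sum>j<n. \<nu> (x ^ j))"
  have L: "0 \<le> L" unfolding L_def using x by (intro sum_nonneg nonneg ins)
  \<comment> \<open>Small enough for both error terms below: \<open>L * d\<close> in
    \<open>B_inv\<close>, and \<open>2 * M * d\<close> in the comparison of the two
    averages.\<close>
  define d where "d = e / (L + 2 * M + 1)"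
  have d: "0 < d" using L M e by (simp add: d_def)
  have dL: "L * d \<le> e" "2 * M * d \<le> e"
    using L M e by (simp_all add: d_def divide_simps)
  define \<omega> where "\<omega> k = cis (2 * pi * real k / real n)" for k
  have \<omega>n: "\<omega> k ^ n = 1" for k
    using n by (simp add: \<omega>_def cis_root_of_unity)
  have norm_\<omega>: "cmod (\<omega> k * complex_of_real r) \<le> 1" if "r \<in> {0..1}" for k r
    using that by (simp add: norm_mult \<omega>_def)
  have "\<exists>b\<in>A. \<nu> b \<le> M \<and> \<nu> (1 - (1 - c (\<omega> k * complex_of_real r) * x) * b) \<le> d"
    if "r \<in> {0..1}" for k r
    using M(2)[OF norm_\<omega>[OF that, of k]] d unfolding approx_inv_def by blast
  then obtain b where b: "\<And>r k. r \<in> {0..1} \<Longrightarrow> b r k \<in> A" "\<And>r k. r \<in> {0..1} \<Longrightarrow> \<nu> (b r k) \<le> M"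
      "\<And>r k. r \<in> {0..1} \<Longrightarrow> \<nu> (1 - (1 - c (\<omega> k * complex_of_real r) * x) * b r k) \<le> d"
    by metis
  define B where "B r = c (1 / of_nat n) * (\<Sum>k<n. b r k)" for r
  have avg: "\<nu> (c (1 / of_nat n) * (\<Sum>k<n. y k)) \<le> C"
    if "\<And>k. y k \<in> A" "\<And>k. \<nu> (y k) \<le> C" for y C
  proof -
    have "\<nu> (c (1 / of_nat n) * (\<Sum>k<n. y k)) \<le> (1 / n) * \<nu> (\<Sum>k<n. y k)"
      using scal[of "\<Sum>k<n. y k" "1 / of_nat n"] that by (simp add: ins norm_divide)
    also have "\<nu> (\<Sum>k<n. y k) \<le> (\<Sum>k<n. \<nu> (y k))" using that by (intro nu_sum)
    also have "\<dots> \<le> (\<Sum>k<n. C)" using that by (intro sum_mono)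
    finally show ?thesis using n by (simp add: divide_right_mono)
  qed
  have B_in: "B r \<in> A" if "r \<in> {0..1}" for r using b that by (auto simp: B_def intro!: ins)
  have B_inv: "\<nu> (1 - (1 - (c r * x) ^ n) * B r) \<le> e" if r: "r \<in> {0..1}" for r :: real
  proof -
    define v where "v k = \<omega> k * complex_of_real r" for k
    \<comment> \<open>The cofactor of \<open>1 - c (v k) * x\<close> in
      \<open>1 - (c r * x) ^ n\<close>. By orthogonality of the roots of unity the average of the
      \<open>P k\<close> is 1.\<close>
    define P where "P k = (\<Sum>j<n. (c (v k) * x) ^ j)" for k
    have P_in: "P k \<in> A" for k unfolding P_def using x by (intro ins)
    have nuP: "\<nu> (P k) \<le> L" for k
    proof -
      have "\<nu> (P k) \<le> (\<Sum>j<n. \<nu> ((c (v k) * x) ^ j))"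
        unfolding P_def using x by (intro nu_sum ins)
      also have "\<dots> \<le> L" unfolding L_def
      proof (intro sum_mono)
        fix j
        have "\<nu> ((c (v k) * x) ^ j) = cmod (v k) ^ j * \<nu> (x ^ j)"
          using nu_scal[of "x ^ j" "v k ^ j"] x
          by (simp add: power_mult_distrib c_power ins norm_power)
        also have "\<dots> \<le> 1 * \<nu> (x ^ j)"
          using norm_\<omega>[OF r] x by (intro mult_right_mono power_le_one nonneg ins) (auto simp: v_def)
        finally show "\<nu> ((c (v k) * x) ^ j) \<le> \<nu> (x ^ j)" by simp
      qed
      finally show ?thesis .
    qed
    have "(\<Sum>k<n. P k) = (\<Sum>j<n. \<Sum>k<n. (c (v k) * x) ^ j)"
      unfolding P_def by (rule sum.swap)
    also have "\<dots> = (\<Sum>j<n. c (\<Sum>k<n. \<omega> k ^ j) * c (of_real r ^ j) * x ^ j)"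
      by (intro sum.cong) (auto simp: v_def power_mult_distrib c_power c_mult c_sum sum_distrib_left mult_ac)
    also have "\<dots> = (\<Sum>j<n. if j = 0 then c (of_nat n) else 0)"
      by (intro sum.cong) (auto simp: \<omega>_def sum_roots_of_unity_power c_zero c_one)
    also have "\<dots> = c (of_nat n)" using n by (simp add: sum.delta)
    finally have "c (1 / of_nat n) * (\<Sum>k<n. P k) = 1"
      using n by (simp flip: c_mult add: c_one)
    moreover have "(1 - (c r * x) ^ n) * b r k = P k * ((1 - c (v k) * x) * b r k)" for k
    proof -
      have "(c r * x) ^ n = (c (v k) * x) ^ n"
        by (simp add: power_mult_distrib v_def \<omega>n flip: c_power)
      then have "1 - (c r * x) ^ n = (1 - c (v k) * x) * P k"
        unfolding P_def by (simp add: one_diff_power_eq)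
      then show ?thesis by (simp add: mult_ac)
    qed
    ultimately have "1 - (1 - (c r * x) ^ n) * B r
        = c (1 / of_nat n) * (\<Sum>k<n. P k * (1 - (1 - c (v k) * x) * b r k))"
    proof -
      assume P1: "c (1 / of_nat n) * (\<Sum>k<n. P k) = 1"
        and fac: "\<And>k. (1 - (c r * x) ^ n) * b r k = P k * ((1 - c (v k) * x) * b r k)"
      have "(1 - (c r * x) ^ n) * (\<Sum>k<n. b r k) = (\<Sum>k<n. P k * ((1 - c (v k) * x) * b r k))"
        unfolding sum_distrib_left fac ..
      then have "(1 - (c r * x) ^ n) * B r
          = c (1 / of_nat n) * (\<Sum>k<n. P k * ((1 - c (v k) * x) * b r k))"
        unfolding B_def by (simp only: mult.left_commute)
      moreover have "(\<Sum>k<n. P k * (1 - (1 - c (v k) * x) * b r k))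
          = (\<Sum>k<n. P k) - (\<Sum>k<n. P k * ((1 - c (v k) * x) * b r k))"
        unfolding sum_subtractf[symmetric] by (simp only: right_diff_distrib mult_1_right)
      ultimately show ?thesis using P1 by (simp only: right_diff_distrib)
    qed
    also have "\<nu> \<dots> \<le> L * d"
    proof (rule avg)
      fix k
      let ?d = "1 - (1 - c (v k) * x) * b r k"
      have d_in: "?d \<in> A" using x b r by (intro ins) auto
      show "P k * ?d \<in> A" using P_in d_in by (rule mult_in)
      have "\<nu> (P k * ?d) \<le> \<nu> (P k) * \<nu> ?d" by (intro subm P_in d_in)
      also have "\<dots> \<le> L * d"
        using nuP b(3)[OF r, of k] L d_in by (intro mult_mono nonneg) (auto simp: v_def)
      finally show "\<nu> (P k * ?d) \<le> L * d" .
    qed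
    finally show ?thesis using dL by simp
  qed
  have B_M: "\<nu> (B r1) \<le> M" unfolding B_def using b r by (intro avg)
  have "B r1 - B r2 = c (1 / of_nat n) * (\<Sum>k<n. b r1 k - b r2 k)"
    by (simp add: B_def sum_subtractf right_diff_distrib)
  also have "\<nu> \<dots> \<le> M\<^sup>2 * \<nu> x * \<bar>r1 - r2\<bar> + e"
  proof (rule avg)
    fix k
    have bi: "b r1 k \<in> A" "b r2 k \<in> A" using b r by auto
    then show "b r1 k - b r2 k \<in> A" by (intro ins)
    define y1 y2 where "y1 = 1 - c (\<omega> k * complex_of_real r1) * x"
      and "y2 = 1 - c (\<omega> k * complex_of_real r2) * x"
    have yi: "y1 \<in> A" "y2 \<in> A" using x by (auto simp: y1_def y2_def intro!: ins)
    have ydiff: "y2 - y1 = c (\<omega> k * complex_of_real (r1 - r2)) * x"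
      by (simp add: y1_def y2_def c_diff algebra_simps)
    have "\<nu> (y2 - y1) = \<bar>r1 - r2\<bar> * \<nu> x"
      unfolding ydiff using nu_scal[OF x] by (simp add: norm_mult \<omega>_def flip: of_real_diff)
    moreover have "\<nu> (b r1 k * b r2 k) \<le> M * M"
      using subm[OF bi] mult_mono[OF b(2)[OF r(1)] b(2)[OF r(2)], of k k] M nonneg[OF bi(2)] by linarith
    ultimately have "\<nu> (b r1 k * b r2 k) * \<nu> (y2 - y1) \<le> M * M * (\<bar>r1 - r2\<bar> * \<nu> x)"
      using nonneg[OF x] by (intro mult_mono) auto
    then have 1: "\<nu> (b r1 k * b r2 k * (y2 - y1)) \<le> M\<^sup>2 * \<nu> x * \<bar>r1 - r2\<bar>"
      using subm[of "b r1 k * b r2 k" "y2 - y1"] bi yi by (simp add: ins power2_eq_square mult_ac)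
    have dd: "1 - y1 * b r1 k \<in> A" "1 - y2 * b r2 k \<in> A" using bi yi by (auto intro!: ins)
    have "\<nu> (b r1 k) * \<nu> (1 - y2 * b r2 k) \<le> M * d"
      using b r M dd by (intro mult_mono nonneg) (auto simp: y2_def)
    then have 2: "\<nu> (b r1 k * (1 - y2 * b r2 k)) \<le> M * d"
      using subm[OF bi(1) dd(2)] by linarith
    have "\<nu> (b r2 k) * \<nu> (1 - y1 * b r1 k) \<le> M * d"
      using b r M dd by (intro mult_mono nonneg) (auto simp: y1_def)
    then have 3: "\<nu> (b r2 k * (1 - y1 * b r1 k)) \<le> M * d"
      using subm[OF bi(2) dd(1)] by linarith
    \<comment> \<open>The resolvent identity; the terms in the second line measure how far
      \<open>b r1 k\<close> and \<open>b r2 k\<close> are from true inverses.\<close>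
    have "b r1 k - b r2 k = b r1 k * b r2 k * (y2 - y1)
        + (b r1 k * (1 - y2 * b r2 k) - b r2 k * (1 - y1 * b r1 k))"
      by (simp add: algebra_simps)
    also have "\<nu> \<dots> \<le> \<nu> (b r1 k * b r2 k * (y2 - y1))
        + (\<nu> (b r1 k * (1 - y2 * b r2 k)) + \<nu> (b r2 k * (1 - y1 * b r1 k)))"
      using bi yi by (intro order_trans[OF tri] add_left_mono nu_diff ins)
    finally show "\<nu> (b r1 k - b r2 k) \<le> M\<^sup>2 * \<nu> x * \<bar>r1 - r2\<bar> + e"
      using 1 2 3 dL by linarith
  qed
  finally have "\<nu> (B r1 - B r2) \<le> M\<^sup>2 * \<nu> x * \<bar>r1 - r2\<bar> + e" .
  then show thesis using that B_in B_inv B_M r by blast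
qed

section \<open>Growth of powers\<close>

lemma nu_scal_power: "x \<in> A \<Longrightarrow> 0 \<le> r \<Longrightarrow> \<nu> ((c (complex_of_real r) * x) ^ n) = r ^ n * \<nu> (x ^ n)"
  using nu_scal[of "x ^ n" "complex_of_real r ^ n"] power_in[of x n]
  by (simp add: power_mult_distrib c_power norm_power)

text \<open>Decay at \<open>r1\<close> makes \<open>B1\<close> close to 1. The bound on
  \<open>B1 - B2\<close> is independent of \<open>n\<close>, so \<open>B2\<close> is close to 1 as
  well, and an approximate inverse close to 1 bounds the element \<open>1 - (c r2 * x) ^ n\<close>
  that it inverts.\<close>

lemma powers_bounded_step:
  assumes x: "x \<in> A" and M: "0 < M" "\<And>u. cmod u \<le> 1 \<Longrightarrow> approx_inv M (1 - c u * x)"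
    and r: "r1 \<in> {0..1}" "r2 \<in> {0..1::real}" and close: "M\<^sup>2 * \<nu> x * \<bar>r1 - r2\<bar> \<le> 1/8"
    and lim: "(\<lambda>n. r1 ^ n * \<nu> (x ^ n)) \<longlonglongrightarrow> 0"
  shows "\<forall>\<^sub>F n in sequentially. r2 ^ n * \<nu> (x ^ n) \<le> 3 * \<nu> 1 + 1"
proof -
  have "\<forall>\<^sub>F n in sequentially. r1 ^ n * \<nu> (x ^ n) < 1 / (16 * M)"
    using lim M by (intro order_tendstoD) auto
  with eventually_gt_at_top[of 0] show ?thesis
  proof eventually_elim
    case (elim n)
    define z1 z2 where "z1 = (c r1 * x) ^ n" and "z2 = (c r2 * x) ^ n"
    have z: "z1 \<in> A" "z2 \<in> A" using x by (auto simp: z1_def z2_def intro!: ins)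
    have nz1: "\<nu> z1 \<le> 1 / (16 * M)" using elim x r by (simp add: z1_def nu_scal_power)
    obtain B1 B2 where B: "B1 \<in> A" "B2 \<in> A" "\<nu> B1 \<le> M"
      "\<nu> (1 - (1 - z1) * B1) \<le> 1/16" "\<nu> (1 - (1 - z2) * B2) \<le> 1/16"
      "\<nu> (B1 - B2) \<le> M\<^sup>2 * \<nu> x * \<bar>r1 - r2\<bar> + 1/16"
      using approx_inv_roots[OF x M, where n = n and ?r1.0 = r1 and ?r2.0 = r2 and e = "1/16"]
        elim(1) r unfolding z1_def z2_def by auto
    have "\<nu> (z1 * B1) \<le> \<nu> z1 * \<nu> B1" using z B by (intro subm)
    also have "\<dots> \<le> 1 / (16 * M) * M" using nz1 B z M by (intro mult_mono nonneg) auto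
    finally have zB: "\<nu> (z1 * B1) \<le> 1/16" using M by simp
    have "1 - B2 = (1 - (1 - z1) * B1 - z1 * B1) + (B1 - B2)" by (simp add: algebra_simps)
    also have "\<nu> \<dots> \<le> (\<nu> (1 - (1 - z1) * B1) + \<nu> (z1 * B1)) + \<nu> (B1 - B2)"
      using z B by (intro order_trans[OF tri] add_right_mono nu_diff ins)
    \<comment> \<open>The errors add up to 1/16 + 1/16 + (1/8 + 1/16), which is below 1/2.\<close>
    finally have d: "\<nu> (1 - B2) \<le> 1/2" using zB B close by linarith
    define y where "y = 1 - z2"
    have y: "y \<in> A" using z by (auto simp: y_def intro!: ins)
    \<comment> \<open>The last term is at most half of \<open>\<nu> y\<close> and is absorbed on the
      left.\<close>
    have "y = 1 - (1 - y * B2) + y * (1 - B2)" by (simp add: algebra_simps)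
    also have "\<nu> \<dots> \<le> (\<nu> 1 + \<nu> (1 - y * B2)) + \<nu> (y * (1 - B2))"
      using y B by (intro order_trans[OF tri] add_right_mono nu_diff ins)
    finally have 1: "\<nu> y \<le> \<nu> 1 + 1/16 + \<nu> (y * (1 - B2))" using B by (simp add: y_def)
    have "\<nu> (y * (1 - B2)) \<le> \<nu> y * \<nu> (1 - B2)" using y B by (intro subm ins)
    also have "\<dots> \<le> \<nu> y * (1/2)" using d y by (intro mult_left_mono nonneg)
    finally have 2: "\<nu> y \<le> 2 * \<nu> 1 + 1/8" using 1 by simp
    have "\<nu> z2 \<le> \<nu> 1 + \<nu> y" using nu_diff[OF one_in y] by (simp add: y_def)
    then have "\<nu> z2 \<le> 3 * \<nu> 1 + 1" using 2 by linarith
    then show ?case using x r by (simp add: z2_def nu_scal_power)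
  qed
qed

text \<open>Half of the spectral radius formula. The radius climbs from 0 towards 1 in steps of a
  fixed size \<open>\<kappa>\<close> dictated by \<open>powers_bounded_step\<close>; boundedness at
  one radius gives decay at every smaller one.\<close>

lemma powers_tendsto_zero:
  assumes x: "x \<in> A"
    and inv: "\<And>w. 1 \<le> cmod w \<Longrightarrow> \<exists>b\<in>A. \<nu> (1 - (x - c w) * b) < 1"
    and r: "0 \<le> r" "r < 1"
  shows "(\<lambda>n. r ^ n * \<nu> (x ^ n)) \<longlonglongrightarrow> 0"
proof -
  obtain M where M: "0 < M" "\<And>u. cmod u \<le> 1 \<Longrightarrow> approx_inv M (1 - c u * x)"
    using approx_inv_uniform[OF x inv] by blast
  define \<kappa> where "\<kappa> = 1 / (8 * (M\<^sup>2 * \<nu> x + 1))"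
  have nx: "0 \<le> M\<^sup>2 * \<nu> x" using nonneg[OF x] by simp
  then have \<kappa>: "0 < \<kappa>" "M\<^sup>2 * \<nu> x * \<kappa> \<le> 1/8" by (simp_all add: \<kappa>_def divide_simps)
  have "(\<lambda>n. r ^ n * \<nu> (x ^ n)) \<longlonglongrightarrow> 0" if "0 \<le> r" "r < 1" "r < real j * \<kappa>" for j r
    using that
  proof (induction j arbitrary: r)
    case (Suc j)
    \<comment> \<open>Strictly above \<open>r\<close>, so that boundedness at \<open>r2\<close>
      becomes decay at \<open>r\<close>; below 1 and below the next multiple of
      \<open>\<kappa>\<close>, so that \<open>r2 - \<kappa>\<close> falls under the induction
      hypothesis.\<close>
    define r2 where "r2 = (r + min 1 (real (Suc j) * \<kappa>)) / 2"
    have r2: "r < r2" "r2 < 1" "r2 < real (Suc j) * \<kappa>" using Suc.prems by (auto simp: r2_def)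
    \<comment> \<open>Clipped at 0, where all powers with positive exponent vanish.\<close>
    define r1 where "r1 = max 0 (r2 - \<kappa>)"
    have lim1: "(\<lambda>n. r1 ^ n * \<nu> (x ^ n)) \<longlonglongrightarrow> 0"
    proof (cases "r1 = 0")
      case True
      have "\<forall>\<^sub>F n in sequentially. r1 ^ n * \<nu> (x ^ n) = 0"
        using eventually_gt_at_top[of 0] by eventually_elim (simp add: True)
      then show ?thesis by (rule tendsto_eventually)
    next
      case False
      then have "r1 = r2 - \<kappa>" "0 \<le> r1" by (auto simp: r1_def max_def split: if_splits)
      then show ?thesis using r2 \<kappa> by (intro Suc.IH) (auto simp: algebra_simps)
    qed
    have "\<bar>r1 - r2\<bar> \<le> \<kappa>" using r2 Suc.prems \<kappa> by (auto simp: r1_def max_def)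
    then have "M\<^sup>2 * \<nu> x * \<bar>r1 - r2\<bar> \<le> M\<^sup>2 * \<nu> x * \<kappa>" using nx by (intro mult_left_mono)
    then have bdd: "\<forall>\<^sub>F n in sequentially. r2 ^ n * \<nu> (x ^ n) \<le> 3 * \<nu> 1 + 1"
      using r2 Suc.prems \<kappa> lim1 by (intro powers_bounded_step[OF x M, of r1]) (auto simp: r1_def)
    have lim0: "(\<lambda>n. (3 * \<nu> 1 + 1) * (r / r2) ^ n) \<longlonglongrightarrow> 0"
      using r2 Suc.prems by (intro tendsto_mult_right_zero LIMSEQ_realpow_zero) auto
    show ?case
    proof (rule tendsto_sandwich[OF _ _ tendsto_const lim0])
      show "\<forall>\<^sub>F n in sequentially. 0 \<le> r ^ n * \<nu> (x ^ n)"
        using Suc.prems x by (intro always_eventually allI mult_nonneg_nonneg nonneg ins) auto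
      show "\<forall>\<^sub>F n in sequentially. r ^ n * \<nu> (x ^ n) \<le> (3 * \<nu> 1 + 1) * (r / r2) ^ n"
        using bdd
      proof eventually_elim
        case (elim n)
        have "r ^ n * \<nu> (x ^ n) = (r / r2) ^ n * (r2 ^ n * \<nu> (x ^ n))"
          using r2 Suc.prems by (simp add: power_divide)
        also have "\<dots> \<le> (r / r2) ^ n * (3 * \<nu> 1 + 1)"
          using r2 Suc.prems by (intro mult_left_mono elim) auto
        finally show ?case by (simp add: mult.commute)
      qed
    qed
  qed simp
  moreover obtain j where "r < real j * \<kappa>"
    using reals_Archimedean3[OF \<kappa>(1)] by blast
  ultimately show ?thesis using r by blast
qed

text \<open>If neither \<open>x\<close> nor \<open>x - 5\<close> had a spectral value, their powers would grow no faster than \<open>2\<^sup>n\<close>,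
  which is incompatible with \<open>5\<^sup>n = (x - (x - 5))\<^sup>n\<close>.\<close>

lemma exists_spectral_value:
  assumes x: "x \<in> A"
  obtains w where "\<And>b. b \<in> A \<Longrightarrow> 1 \<le> \<nu> (1 - (x - c w) * b)"
proof (rule ccontr)
  assume "\<not> thesis"
  then have inv: "\<exists>b\<in>A. \<nu> (1 - (x - c w) * b) < 1" for w
    using that by (meson not_less)
  \<comment> \<open>Rate 2 for the powers of \<open>x\<close> and of \<open>y\<close> gives rate 4
    in the binomial expansion of \<open>(x + - y) ^ n\<close>, because the binomial coefficients add
    up to \<open>2 ^ n\<close>. Hence a shift larger than 4.\<close>
  define y where "y = x - c 5"
  have y: "y \<in> A" using x by (auto simp: y_def intro!: ins)
  have inv': "\<exists>b\<in>A. \<nu> (1 - (y - c w) * b) < 1" for w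
    using inv[of "w + 5"] by (simp add: y_def c_add algebra_simps)
  have "(\<lambda>n. (1/2) ^ n * \<nu> (x ^ n)) \<longlonglongrightarrow> 0" "(\<lambda>n. (1/2) ^ n * \<nu> (y ^ n)) \<longlonglongrightarrow> 0"
    using inv inv' by (auto intro!: powers_tendsto_zero x y)
  then have "Bseq (\<lambda>n. (1/2) ^ n * \<nu> (x ^ n))" "Bseq (\<lambda>n. (1/2) ^ n * \<nu> (y ^ n))"
    by (auto intro: convergent_imp_Bseq convergentI)
  then obtain C D where CD: "\<And>n. norm ((1/2) ^ n * \<nu> (x ^ n)) \<le> C" "\<And>n. norm ((1/2) ^ n * \<nu> (y ^ n)) \<le> D"
    unfolding Bseq_def by auto
  have C: "\<nu> (x ^ n) \<le> C * 2 ^ n" for n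
    using CD(1)[of n] nonneg[OF power_in[OF x], of n] by (simp add: abs_mult power_divide divide_simps)
  have D: "\<nu> ((- y) ^ n) \<le> D * 2 ^ n" for n
  proof -
    have "\<nu> ((- y) ^ n) = \<nu> (y ^ n)"
      using y by (cases "even n") (auto simp: nu_uminus ins)
    then show ?thesis
      using CD(2)[of n] nonneg[OF power_in[OF y], of n] by (simp add: abs_mult power_divide divide_simps)
  qed
  have C0: "0 \<le> C" "0 \<le> D" using CD[of 0] by auto
  have "5 ^ n \<le> C * D * 4 ^ n" for n
  proof -
    have "c (5 ^ n) = (x + - y) ^ n" by (simp add: y_def c_power)
    also have "\<dots> = (\<Sum>k\<le>n. of_nat (n choose k) * x ^ k * (- y) ^ (n - k))"
      by (rule binomial_ring)
    also have "\<dots> = (\<Sum>k\<le>n. c (of_nat (n choose k)) * (x ^ k * (- y) ^ (n - k)))"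
    proof (intro sum.cong refl)
      fix k
      have "c (of_nat m) = of_nat m" for m by (induction m) (simp_all add: c_zero c_add c_one)
      then show "of_nat (n choose k) * x ^ k * (- y) ^ (n - k)
          = c (of_nat (n choose k)) * (x ^ k * (- y) ^ (n - k))" by (simp add: mult.assoc)
    qed
    finally have "\<nu> (c (5 ^ n)) \<le> (\<Sum>k\<le>n. \<nu> (c (of_nat (n choose k)) * (x ^ k * (- y) ^ (n - k))))"
      using x y by (auto intro!: nu_sum ins)
    also have "\<dots> \<le> (\<Sum>k\<le>n. real (n choose k) * (C * D * 2 ^ n))"
    proof (intro sum_mono)
      fix k assume k: "k \<in> {..n}"
      have "\<nu> (c (of_nat (n choose k)) * (x ^ k * (- y) ^ (n - k)))
          = real (n choose k) * \<nu> (x ^ k * (- y) ^ (n - k))"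
        using x y by (subst nu_scal) (auto intro!: ins)
      also have "\<nu> (x ^ k * (- y) ^ (n - k)) \<le> \<nu> (x ^ k) * \<nu> ((- y) ^ (n - k))"
        using x y by (intro subm ins)
      also have "\<dots> \<le> (C * 2 ^ k) * (D * 2 ^ (n - k))"
        using C D C0 x y by (intro mult_mono nonneg ins) auto
      also have "\<dots> = C * D * 2 ^ n" using k by (simp flip: power_add)
      finally show "\<nu> (c (of_nat (n choose k)) * (x ^ k * (- y) ^ (n - k)))
          \<le> real (n choose k) * (C * D * 2 ^ n)" by (simp add: mult_left_mono)
    qed
    also have "\<dots> = C * D * 2 ^ n * real (\<Sum>k\<le>n. n choose k)"
      by (simp add: sum_distrib_left mult_ac)
    also have "\<dots> = C * D * 2 ^ n * 2 ^ n" by (simp add: choose_row_sum)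
    finally have "\<nu> (c (5 ^ n)) \<le> C * D * (2 ^ n * 2 ^ n)" by (simp add: mult.assoc)
    moreover have "(2::real) ^ n * 2 ^ n = 4 ^ n" by (simp flip: power_mult_distrib)
    ultimately have "\<nu> (c (5 ^ n)) \<le> C * D * 4 ^ n" by simp
    moreover have "5 ^ n * 1 \<le> \<nu> (c (5 ^ n))"
      using nu_scal[OF one_in, of "5 ^ n"] one_le by (simp add: norm_power)
    ultimately show ?thesis by simp
  qed
  then have "(5/4) ^ n \<le> C * D" for n by (simp add: power_divide divide_simps)
  moreover obtain n where "C * D < (5/4) ^ n" using real_arch_pow[of "5/4" "C * D"] by auto
  ultimately show False by (meson not_less)
qed

text \<open>Characters without maximal ideals: for each \<open>X i\<close> the seminorm is replaced
  by the quotient modulo \<open>X i - c w\<close>, with \<open>w\<close> a spectral value for the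
  current seminorm. Earlier relations survive since the seminorms only decrease.\<close>

lemma exists_joint_spectral_value:
  assumes "finite I" "\<And>i. i \<in> I \<Longrightarrow> X i \<in> A"
  shows "\<exists>\<nu>' a. salg A c \<nu>' \<and> (\<forall>x\<in>A. \<nu>' x \<le> \<nu> x) \<and> (\<forall>i\<in>I. \<nu>' (X i - c (a i)) = 0)"
  using assms
proof (induction I rule: finite_induct)
  case empty
  then show ?case using salg_axioms by auto
next
  case (insert i I)
  have "\<exists>\<nu>1 a. salg A c \<nu>1 \<and> (\<forall>x\<in>A. \<nu>1 x \<le> \<nu> x) \<and> (\<forall>i\<in>I. \<nu>1 (X i - c (a i)) = 0)"
    using insert by simp
  then obtain \<nu>1 a where 1: "salg A c \<nu>1" "\<And>x. x \<in> A \<Longrightarrow> \<nu>1 x \<le> \<nu> x"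
      "\<And>j. j \<in> I \<Longrightarrow> \<nu>1 (X j - c (a j)) = 0"
    by metis
  have Xi: "X i \<in> A" using insert by simp
  obtain w where w: "\<And>b. b \<in> A \<Longrightarrow> 1 \<le> \<nu>1 (1 - (X i - c w) * b)"
    using salg.exists_spectral_value[OF 1(1) Xi] by blast
  obtain \<nu>2 where 2: "salg A c \<nu>2" "\<And>x. x \<in> A \<Longrightarrow> \<nu>2 x \<le> \<nu>1 x" "\<nu>2 (X i - c w) = 0"
    using salg.quotient_salg[OF 1(1) _ w] Xi by (metis diff_in c_in)
  have "\<nu>2 (X j - c (a j)) = 0" if "j \<in> I" for j
  proof -
    have "X j - c (a j) \<in> A" using insert that by (auto intro!: ins)
    then show ?thesis using 1(3)[OF that] 2(2) salg.nonneg[OF 2(1)] by force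
  qed
  moreover have "\<nu>2 x \<le> \<nu> x" if "x \<in> A" for x
    using 1(2)[OF that] 2(2)[OF that] by linarith
  ultimately show ?case using 2 insert.hyps
    by (intro exI[of _ \<nu>2] exI[of _ "a(i := w)"]) auto
qed

end

section \<open>Rational hulls\<close>

lemma cpolynomial_continuous_on: "cpolynomial P \<Longrightarrow> continuous_on S P"
  by (induction rule: cpolynomial.induct) (auto intro!: continuous_intros)

lemma cpolynomial_uminus: "cpolynomial P \<Longrightarrow> cpolynomial (\<lambda>z. - P z)"
  using cpolynomial.mult[OF cpolynomial.const[of "-1"]] by simp

lemma cpolynomial_diff: "cpolynomial P \<Longrightarrow> cpolynomial Q \<Longrightarrow> cpolynomial (\<lambda>z. P z - Q z)"
  using cpolynomial.add[OF _ cpolynomial_uminus, of P Q] by simp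

lemma cpolynomial_sum: "(\<And>i. i \<in> I \<Longrightarrow> cpolynomial (P i)) \<Longrightarrow> cpolynomial (\<lambda>z. \<Sum>i\<in>I. P i z)"
  by (induction I rule: infinite_finite_induct) (auto intro: cpolynomial.intros)

text \<open>Cross-multiplication avoids poles and suprema in \<open>ereal\<close>; compactness makes
  the supremum an attained maximum. A negative \<open>M\<close> satisfies the premise only for empty
  \<open>K\<close>, whose hull thereby comes out empty on both sides.\<close>

lemma mem_rational_hull_iff:
  assumes K: "compact K"
  shows "z \<in> rational_hull K \<longleftrightarrow>
    (\<forall>P Q M. cpolynomial P \<longrightarrow> cpolynomial Q \<longrightarrow> (\<forall>w\<in>K. Q w \<noteq> 0) \<longrightarrow>
       (\<forall>w\<in>K. cmod (P w) \<le> M * cmod (Q w)) \<longrightarrow> cmod (P z) \<le> M * cmod (Q z))"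
    (is "_ \<longleftrightarrow> ?R")
proof
  assume z: "z \<in> rational_hull K"
  show ?R
  proof (intro allI impI)
    fix P Q M
    assume PQ: "cpolynomial P" "cpolynomial Q" "\<forall>w\<in>K. Q w \<noteq> 0"
      and M: "\<forall>w\<in>K. cmod (P w) \<le> M * cmod (Q w)"
    have "rat_abs P Q z \<le> (SUP w\<in>K. rat_abs P Q w)"
      using z PQ unfolding rational_hull_def by blast
    also have "\<dots> \<le> ereal M"
      using PQ M by (intro SUP_least) (auto simp: rat_abs_def norm_divide divide_le_eq)
    finally show "cmod (P z) \<le> M * cmod (Q z)"
      by (auto simp: rat_abs_def norm_divide divide_le_eq split: if_splits)
  qed
next
  assume R: ?R
  have "K \<noteq> {}"
    using R[rule_format, of "\<lambda>_. 1" "\<lambda>_. 1" "-1"] by (auto intro: cpolynomial.const)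
  have bound: "\<exists>w0\<in>K. \<forall>w\<in>K. cmod (P w / Q w) \<le> cmod (P w0 / Q w0)"
    if "cpolynomial P" "cpolynomial Q" "\<forall>w\<in>K. Q w \<noteq> 0" for P Q
  proof (rule continuous_attains_sup[OF K \<open>K \<noteq> {}\<close>])
    show "continuous_on K (\<lambda>w. cmod (P w / Q w))"
      using that(3) by (intro continuous_intros cpolynomial_continuous_on that(1,2))
  qed
  have bound': "\<exists>w0\<in>K. cmod (P z) \<le> cmod (P w0 / Q w0) * cmod (Q z)"
    if h: "cpolynomial P" "cpolynomial Q" "\<forall>w\<in>K. Q w \<noteq> 0" for P Q
  proof -
    obtain w0 where w0: "w0 \<in> K" "\<forall>w\<in>K. cmod (P w / Q w) \<le> cmod (P w0 / Q w0)"
      using bound[OF h] by blast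
    have "\<forall>w\<in>K. cmod (P w) \<le> cmod (P w0 / Q w0) * cmod (Q w)"
    proof
      fix w assume w: "w \<in> K"
      then have "cmod (P w) / cmod (Q w) \<le> cmod (P w0 / Q w0)"
        using w0 by (simp only: norm_divide)
      then show "cmod (P w) \<le> cmod (P w0 / Q w0) * cmod (Q w)"
        using w h(3) by (metis pos_divide_le_eq zero_less_norm_iff)
    qed
    then show ?thesis using R h w0(1) by blast
  qed
  show "z \<in> rational_hull K" unfolding rational_hull_def
  proof (intro CollectI allI impI)
    fix P Q :: "complex ^ 'a \<Rightarrow> complex"
    assume PQ: "cpolynomial P" "cpolynomial Q" "\<forall>w\<in>K. Q w \<noteq> 0"
    \<comment> \<open>Numerator 1 gives a bound for \<open>1 / Q\<close> on \<open>K\<close>; a zero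
      of \<open>Q\<close> at \<open>z\<close> would turn it into \<open>1 \<le> 0\<close>.\<close>
    have Qz: "Q z \<noteq> 0"
      using bound'[OF cpolynomial.const[of 1] PQ(2,3)] by auto
    obtain w0 where w0: "w0 \<in> K" "cmod (P z) \<le> cmod (P w0 / Q w0) * cmod (Q z)"
      using bound'[OF PQ] by blast
    then have "cmod (P z) / cmod (Q z) \<le> cmod (P w0 / Q w0)"
      using Qz by (metis pos_divide_le_eq zero_less_norm_iff)
    then have "rat_abs P Q z \<le> rat_abs P Q w0"
      using Qz w0(1) PQ by (simp add: rat_abs_def norm_divide)
    also have "\<dots> \<le> (SUP w\<in>K. rat_abs P Q w)" using w0(1) by (intro SUP_upper)
    finally show "rat_abs P Q z \<le> (SUP w\<in>K. rat_abs P Q w)" .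
  qed
qed

lemma rational_hull_bound:
  assumes "compact K" "z \<in> rational_hull K" "cpolynomial P" "cpolynomial Q" "\<forall>w\<in>K. Q w \<noteq> 0"
    and "\<forall>w\<in>K. cmod (P w) \<le> M * cmod (Q w)"
  shows "cmod (P z) \<le> M * cmod (Q z)"
  using assms(2-) unfolding mem_rational_hull_iff[OF assms(1)] by blast

lemma rational_hull_superset: "K \<subseteq> rational_hull K"
  unfolding rational_hull_def by (auto intro: SUP_upper)

lemma rational_hull_nonzero:
  assumes "z \<in> rational_hull K" "cpolynomial Q" "\<forall>w\<in>K. Q w \<noteq> 0" "compact K"
  shows "Q z \<noteq> 0"
proof
  assume "Q z = 0"
  have "bounded ((\<lambda>w. 1 / Q w) ` K)"
    using assms by (intro compact_imp_bounded compact_continuous_image continuous_intros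
        cpolynomial_continuous_on) auto
  then obtain M where M: "\<forall>w\<in>K. cmod (1 / Q w) \<le> M" unfolding bounded_iff by auto
  have "cmod 1 \<le> M * cmod (Q z)"
  proof (rule rational_hull_bound[OF assms(4,1) cpolynomial.const assms(2,3)])
    show "\<forall>w\<in>K. cmod 1 \<le> M * cmod (Q w)"
    proof
      fix w assume w: "w \<in> K"
      then have "1 / cmod (Q w) \<le> M" using M by (simp add: norm_divide)
      then show "cmod 1 \<le> M * cmod (Q w)"
        using w assms(3) by (simp add: pos_divide_le_eq)
    qed
  qed
  then show False using \<open>Q z = 0\<close> by simp
qed

lemma compact_rational_hull:
  fixes K :: "(complex ^ 'n) set"
  assumes K: "compact K"
  shows "compact (rational_hull K)"
proof -
  have "rational_hull K = (\<Inter>(P, Q, M)\<in>{(P, Q, M). cpolynomial P \<and> cpolynomial Q \<and> (\<forall>w\<in>K. Q w \<noteq> 0) \<and>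
      (\<forall>w\<in>K. cmod (P w) \<le> M * cmod (Q w))}. {z. cmod (P z) \<le> M * cmod (Q z)})"
    by (rule set_eqI) (simp add: mem_rational_hull_iff[OF K], blast)
  also have "closed \<dots>"
    by (auto intro!: closed_INT closed_Collect_le continuous_intros cpolynomial_continuous_on)
  finally have "closed (rational_hull K)" .
  moreover have "bounded (rational_hull K)"
  proof -
    obtain M where M: "\<And>w. w \<in> K \<Longrightarrow> norm w \<le> M"
      using compact_imp_bounded[OF K] unfolding bounded_iff by blast
    have "norm z \<le> real CARD('n) * M" if z: "z \<in> rational_hull K" for z
    proof -
      have "cmod (z $ i) \<le> M * cmod 1" for i
      proof (rule rational_hull_bound[OF K z])
        show "\<forall>w\<in>K. cmod (w $ i) \<le> M * cmod 1"
          using M Finite_Cartesian_Product.norm_nth_le order_trans by fastforce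
      qed (auto intro: cpolynomial.intros)
      then have "(\<Sum>i\<in>UNIV. cmod (z $ i)) \<le> (\<Sum>i\<in>(UNIV::'n set). M)" by (intro sum_mono) auto
      then show ?thesis using L2_set_le_sum[of UNIV "\<lambda>i. cmod (z $ i)"] by (simp add: norm_vec_def)
    qed
    then show ?thesis unfolding bounded_iff by blast
  qed
  ultimately show ?thesis by (simp add: compact_eq_bounded_closed)
qed

text \<open>Since \<open>x / 0 = 0\<close>, quotients of polynomials form a ring of functions only after
  restriction to the hull, where admissible denominators have no zeros.\<close>

definition rat_fun :: "(complex ^ 'n) set \<Rightarrow> (complex ^ 'n \<Rightarrow> complex) \<Rightarrow> bool" where
  "rat_fun K g \<longleftrightarrow> (\<exists>P Q. cpolynomial P \<and> cpolynomial Q \<and> (\<forall>w\<in>K. Q w \<noteq> 0) \<and>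
     (\<forall>z\<in>rational_hull K. g z = P z / Q z))"

lemma rat_fun_divide:
  "cpolynomial P \<Longrightarrow> cpolynomial Q \<Longrightarrow> (\<forall>w\<in>K. Q w \<noteq> 0) \<Longrightarrow> rat_fun K (\<lambda>z. P z / Q z)"
  unfolding rat_fun_def by blast

lemma rat_fun_cpolynomial: "cpolynomial P \<Longrightarrow> rat_fun K P"
  using rat_fun_divide[OF _ cpolynomial.const[of 1], of P K] by simp

lemma rat_fun_cong:
  "rat_fun K g \<Longrightarrow> (\<And>z. z \<in> rational_hull K \<Longrightarrow> g z = h z) \<Longrightarrow> rat_fun K h"
  unfolding rat_fun_def by metis

lemma rat_fun_add:
  assumes K: "compact K" and "rat_fun K g" "rat_fun K h"
  shows "rat_fun K (\<lambda>z. g z + h z)"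
proof -
  obtain P Q where g: "cpolynomial P" "cpolynomial Q" "\<forall>w\<in>K. Q w \<noteq> 0" "\<forall>z\<in>rational_hull K. g z = P z / Q z"
    using assms(2) unfolding rat_fun_def by blast
  obtain R S where h: "cpolynomial R" "cpolynomial S" "\<forall>w\<in>K. S w \<noteq> 0" "\<forall>z\<in>rational_hull K. h z = R z / S z"
    using assms(3) unfolding rat_fun_def by blast
  have "rat_fun K (\<lambda>z. (P z * S z + R z * Q z) / (Q z * S z))"
    using g h by (intro rat_fun_divide cpolynomial.intros) auto
  then show ?thesis
    by (rule rat_fun_cong)
      (use g h rational_hull_nonzero[OF _ _ _ K] in \<open>simp add: add_frac_eq\<close>)
qed

lemma rat_fun_mult:
  assumes "rat_fun K g" "rat_fun K h"
  shows "rat_fun K (\<lambda>z. g z * h z)"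
proof -
  obtain P Q where g: "cpolynomial P" "cpolynomial Q" "\<forall>w\<in>K. Q w \<noteq> 0" "\<forall>z\<in>rational_hull K. g z = P z / Q z"
    using assms(1) unfolding rat_fun_def by blast
  obtain R S where h: "cpolynomial R" "cpolynomial S" "\<forall>w\<in>K. S w \<noteq> 0" "\<forall>z\<in>rational_hull K. h z = R z / S z"
    using assms(2) unfolding rat_fun_def by blast
  have "rat_fun K (\<lambda>z. (P z * R z) / (Q z * S z))"
    using g h by (intro rat_fun_divide cpolynomial.intros) auto
  then show ?thesis by (rule rat_fun_cong) (use g h in simp)
qed

lemma rat_fun_const: "rat_fun K (\<lambda>_. c)"
  by (intro rat_fun_cpolynomial cpolynomial.intros)

lemma rat_fun_power: "rat_fun K g \<Longrightarrow> rat_fun K (\<lambda>z. g z ^ n)"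
  by (induction n) (auto intro: rat_fun_mult rat_fun_const)

lemma rat_fun_diff:
  assumes "compact K" "rat_fun K g" "rat_fun K h"
  shows "rat_fun K (\<lambda>z. g z - h z)"
  using rat_fun_add[OF assms(1,2) rat_fun_mult[OF rat_fun_const assms(3)], of "-1"] by simp

lemma rat_fun_continuous_on:
  assumes "compact K" "rat_fun K g"
  shows "continuous_on (rational_hull K) g"
proof -
  obtain P Q where g: "cpolynomial P" "cpolynomial Q" "\<forall>w\<in>K. Q w \<noteq> 0" "\<forall>z\<in>rational_hull K. g z = P z / Q z"
    using assms(2) unfolding rat_fun_def by blast
  have "continuous_on (rational_hull K) (\<lambda>z. P z / Q z)"
    using g rational_hull_nonzero[OF _ _ _ assms(1)]
    by (intro continuous_intros cpolynomial_continuous_on) auto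
  then show ?thesis using g by (simp cong: continuous_on_cong)
qed

lemma rat_fun_bound:
  assumes "compact K" "rat_fun K g" "z \<in> rational_hull K" "\<forall>w\<in>K. cmod (g w) \<le> M"
  shows "cmod (g z) \<le> M"
proof -
  obtain P Q where g: "cpolynomial P" "cpolynomial Q" "\<forall>w\<in>K. Q w \<noteq> 0" "\<forall>z\<in>rational_hull K. g z = P z / Q z"
    using assms(2) unfolding rat_fun_def by blast
  have "\<forall>w\<in>K. cmod (P w) \<le> M * cmod (Q w)"
  proof
    fix w assume w: "w \<in> K"
    then have "cmod (P w / Q w) \<le> M" using g assms(4) rational_hull_superset by (metis subsetD)
    then show "cmod (P w) \<le> M * cmod (Q w)" using g w by (simp add: norm_divide divide_le_eq)
  qed
  then have "cmod (P z) \<le> M * cmod (Q z)"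
    by (rule rational_hull_bound[OF assms(1,3) g(1-3)])
  then show ?thesis
    using g assms rational_hull_nonzero[OF assms(3) g(2,3) assms(1)] by (simp add: norm_divide divide_le_eq)
qed

text \<open>Convexity with respect to the fixed algebra of quotients whose denominators are
  zero-free on \<open>K\<close>, rather than on \<open>Y\<close>. As this algebra does not change
  when \<open>Y\<close> shrinks, slices by polynomial equations are again convex.\<close>

definition rat_convex :: "(complex ^ 'n) set \<Rightarrow> (complex ^ 'n) set \<Rightarrow> bool" where
  "rat_convex K Y \<longleftrightarrow> compact Y \<and> Y \<subseteq> rational_hull K \<and>
     (\<forall>a. (\<forall>P Q M. cpolynomial P \<longrightarrow> cpolynomial Q \<longrightarrow> (\<forall>w\<in>K. Q w \<noteq> 0) \<longrightarrow>
        (\<forall>w\<in>Y. cmod (P w) \<le> M * cmod (Q w)) \<longrightarrow> cmod (P a) \<le> M * cmod (Q a)) \<longrightarrow> a \<in> Y)"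

lemma rat_convex_hull:
  assumes "compact K"
  shows "rat_convex K (rational_hull K)"
  unfolding rat_convex_def
proof (intro conjI allI impI)
  fix a
  assume a: "\<forall>P Q M. cpolynomial P \<longrightarrow> cpolynomial Q \<longrightarrow> (\<forall>w\<in>K. Q w \<noteq> 0) \<longrightarrow>
        (\<forall>w\<in>rational_hull K. cmod (P w) \<le> M * cmod (Q w)) \<longrightarrow> cmod (P a) \<le> M * cmod (Q a)"
  show "a \<in> rational_hull K"
    unfolding mem_rational_hull_iff[OF assms]
  proof (intro allI impI)
    fix P Q M
    assume PQ: "cpolynomial P" "cpolynomial Q" "\<forall>w\<in>K. Q w \<noteq> 0"
      and M: "\<forall>w\<in>K. cmod (P w) \<le> M * cmod (Q w)"
    have "\<forall>w\<in>rational_hull K. cmod (P w) \<le> M * cmod (Q w)"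
      using rational_hull_bound[OF assms _ PQ M] by blast
    then show "cmod (P a) \<le> M * cmod (Q a)"
      using a PQ by blast
  qed
qed (use assms compact_rational_hull in auto)

lemma rat_convex_zero_set:
  assumes "rat_convex K Y" "cpolynomial f"
  shows "rat_convex K {z \<in> Y. f z = 0}"
  unfolding rat_convex_def
proof (intro conjI allI impI)
  have "closed {z. f z = 0}"
    by (intro closed_Collect_eq continuous_intros cpolynomial_continuous_on assms)
  then have "compact (Y \<inter> {z. f z = 0})" using assms unfolding rat_convex_def by blast
  then show "compact {z \<in> Y. f z = 0}" by (simp add: Int_def)
  fix a
  assume a: "\<forall>P Q M. cpolynomial P \<longrightarrow> cpolynomial Q \<longrightarrow> (\<forall>w\<in>K. Q w \<noteq> 0) \<longrightarrow>
        (\<forall>w\<in>{z \<in> Y. f z = 0}. cmod (P w) \<le> M * cmod (Q w)) \<longrightarrow> cmod (P a) \<le> M * cmod (Q a)"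
  have "a \<in> Y" using assms(1) a unfolding rat_convex_def by auto
  \<comment> \<open>The bound \<open>M = 0\<close> tests membership in the zero set.\<close>
  moreover have "cmod (f a) \<le> 0 * cmod 1"
    using a[rule_format, of f "\<lambda>_. 1" 0] assms by (auto intro: cpolynomial.const)
  ultimately show "a \<in> {z \<in> Y. f z = 0}" by simp
qed (use assms in \<open>auto simp: rat_convex_def\<close>)

section \<open>Cutting off along level sets of a polynomial\<close>

lemma fun_power_apply [simp]: "(f ^ n) x = f x ^ n" for f :: "'a \<Rightarrow> 'b::comm_ring_1"
  by (induction n) (simp_all add: one_fun_def times_fun_def)

text \<open>For \<open>0 < t1 \<le> t2\<close>, the supremum of the \<open>k\<close>-th power of the
  modulus over the annulus, attained on the inner circle for negative \<open>k\<close> and on the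
  outer one otherwise.\<close>

definition annulus_weight :: "real \<Rightarrow> real \<Rightarrow> int \<Rightarrow> real" where
  "annulus_weight t1 t2 k = max (t1 powi k) (t2 powi k)"

lemma annulus_weight_nonneg: "0 < t1 \<Longrightarrow> 0 \<le> annulus_weight t1 t2 k"
  by (simp add: annulus_weight_def le_max_iff_disj)

lemma annulus_weight_add:
  assumes "0 < t1" "t1 \<le> t2"
  shows "annulus_weight t1 t2 (j + k) \<le> annulus_weight t1 t2 j * annulus_weight t1 t2 k"
proof -
  have "t powi (j + k) \<le> annulus_weight t1 t2 j * annulus_weight t1 t2 k" if "t = t1 \<or> t = t2" for t
  proof -
    have "0 < t" using that assms by auto
    then have "t powi (j + k) = t powi j * t powi k" by (intro power_int_add) auto
    also have "\<dots> \<le> annulus_weight t1 t2 j * annulus_weight t1 t2 k"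
      using that \<open>0 < t\<close> assms annulus_weight_nonneg
      by (intro mult_mono) (auto simp: annulus_weight_def)
    finally show ?thesis .
  qed
  then show ?thesis by (simp add: annulus_weight_def[of _ _ "j + k"])
qed

text \<open>\<open>laurent_bound K Y f t1 t2 F C\<close>: on \<open>{z \<in> Y. f z \<noteq> 0}\<close> the function \<open>F\<close> is a Laurent polynomial
  \<open>\<Sum>k. g\<^sub>k f\<^sup>k\<close> whose total coefficient norm on the annulus \<open>t1 \<le> \<bar>f\<bar> \<le> t2\<close> is at most \<open>C\<close>.
  It is the quotient by \<open>f - \<lambda>\<close> of the algebra of Laurent polynomials in \<open>\<lambda>\<close>.\<close>

inductive laurent_bound ::
  "(complex ^ 'n) set \<Rightarrow> (complex ^ 'n) set \<Rightarrow> (complex ^ 'n \<Rightarrow> complex) \<Rightarrow> real \<Rightarrow> real \<Rightarrow>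
    (complex ^ 'n \<Rightarrow> complex) \<Rightarrow> real \<Rightarrow> bool" for K Y f t1 t2 where
  monomial: "rat_fun K g \<Longrightarrow> 0 \<le> M \<Longrightarrow> \<forall>z\<in>Y. cmod (g z) \<le> M \<Longrightarrow>
    \<forall>z\<in>Y. f z \<noteq> 0 \<longrightarrow> F z = g z * f z powi k \<Longrightarrow>
    laurent_bound K Y f t1 t2 F (M * annulus_weight t1 t2 k)"
| add: "laurent_bound K Y f t1 t2 F C \<Longrightarrow> laurent_bound K Y f t1 t2 G D \<Longrightarrow>
    \<forall>z\<in>Y. f z \<noteq> 0 \<longrightarrow> H z = F z + G z \<Longrightarrow> laurent_bound K Y f t1 t2 H (C + D)"

text \<open>Both applications take \<open>t1 = t2\<close>: the annulus is then a level circle of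
  \<open>f\<close>, and only there must \<open>S\<close> be small.\<close>

locale annulus =
  fixes K Y :: "(complex ^ 'n) set" and f :: "complex ^ 'n \<Rightarrow> complex" and t1 t2 :: real
  assumes K: "compact K" and Y: "rat_convex K Y" and f: "cpolynomial f"
    and t: "0 < t1" "t1 \<le> t2"
begin

abbreviation lb where "lb \<equiv> laurent_bound K Y f t1 t2"

lemma Y_sub: "Y \<subseteq> rational_hull K" and compact_Y: "compact Y"
  using Y by (auto simp: rat_convex_def)

lemma lb_nonneg: "lb F C \<Longrightarrow> 0 \<le> C"
  by (induction rule: laurent_bound.induct) (auto simp: t annulus_weight_nonneg)

lemma lb_cong:
  assumes "lb F C" "\<And>z. z \<in> Y \<Longrightarrow> f z \<noteq> 0 \<Longrightarrow> G z = F z"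
  shows "lb G C"
  using assms(1)
proof cases
  case (monomial g M k)
  then show ?thesis using assms(2) laurent_bound.monomial[of K g M Y f G k t1 t2] by simp
next
  case (add F C G' D)
  then show ?thesis using assms(2) laurent_bound.add[of K Y f t1 t2 F C G' D G] by simp
qed

lemma lb_rat_fun:
  assumes "rat_fun K g" "0 \<le> M" "\<forall>z\<in>Y. cmod (g z) \<le> M"
  shows "lb g M"
  using laurent_bound.monomial[OF assms, of f g 0 t1 t2] by (simp add: annulus_weight_def)

lemma lb_add: "lb F C \<Longrightarrow> lb G D \<Longrightarrow> lb (F + G) (C + D)"
  by (rule laurent_bound.add) auto

lemma lb_monomial_mult:
  assumes g: "rat_fun K g" "0 \<le> M" "\<forall>z\<in>Y. cmod (g z) \<le> M"
    and F: "\<forall>z\<in>Y. f z \<noteq> 0 \<longrightarrow> F z = g z * f z powi k" and G: "lb G D"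
  shows "\<exists>E \<le> M * annulus_weight t1 t2 k * D. lb (F * G) E"
  using G
proof (induction rule: laurent_bound.induct)
  case (monomial h N G j)
  have "lb (F * G) (M * N * annulus_weight t1 t2 (k + j))"
  proof (rule laurent_bound.monomial)
    show "rat_fun K (\<lambda>z. g z * h z)" using g monomial by (intro rat_fun_mult)
    show "\<forall>z\<in>Y. cmod (g z * h z) \<le> M * N"
      using g monomial by (auto simp: norm_mult intro!: mult_mono)
    show "\<forall>z\<in>Y. f z \<noteq> 0 \<longrightarrow> (F * G) z = g z * h z * f z powi (k + j)"
      using F monomial by (auto simp: power_int_add)
  qed (use g monomial in auto)
  moreover have "M * N * annulus_weight t1 t2 (k + j)
      \<le> M * N * (annulus_weight t1 t2 k * annulus_weight t1 t2 j)"
    using g monomial by (intro mult_left_mono annulus_weight_add t) auto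
  ultimately show ?case by (intro exI conjI) (auto simp only: mult_ac)
next
  case (add G1 D1 G2 D2 G)
  then obtain E1 E2 where E: "E1 \<le> M * annulus_weight t1 t2 k * D1" "lb (F * G1) E1"
      "E2 \<le> M * annulus_weight t1 t2 k * D2" "lb (F * G2) E2" by blast
  have "lb (F * G) (E1 + E2)"
    by (rule laurent_bound.add[OF E(2,4)]) (use add in \<open>auto simp: algebra_simps\<close>)
  moreover have "E1 + E2 \<le> M * annulus_weight t1 t2 k * (D1 + D2)"
    using E by (simp add: algebra_simps)
  ultimately show ?case by blast
qed

text \<open>Some \<open>E \<le> C * D\<close> is all one gets from the induction, as the weights of
  monomials are only submultiplicative.\<close>

lemma lb_mult:
  assumes "lb F C" "lb G D"
  shows "\<exists>E \<le> C * D. lb (F * G) E"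
  using assms(1)
proof (induction rule: laurent_bound.induct)
  case (monomial g M F k)
  then show ?case using lb_monomial_mult[OF _ _ _ _ assms(2)] by blast
next
  case (add F1 C1 F2 C2 F)
  then obtain E1 E2 where E: "E1 \<le> C1 * D" "lb (F1 * G) E1" "E2 \<le> C2 * D" "lb (F2 * G) E2" by blast
  have "lb (F * G) (E1 + E2)"
    by (rule laurent_bound.add[OF E(2,4)]) (use add in \<open>auto simp: algebra_simps\<close>)
  moreover have "E1 + E2 \<le> (C1 + C2) * D" using E by (simp add: algebra_simps)
  ultimately show ?case by blast
qed

text \<open>\<open>T\<close> collects the terms with nonnegative powers of \<open>f\<close>.\<close>

lemma lb_splitting:
  assumes "lb F C"
  obtains T where "rat_fun K T" "\<And>z. z \<in> Y \<Longrightarrow> cmod (f z) \<le> t2 \<Longrightarrow> cmod (T z) \<le> C"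
    "\<And>z. z \<in> Y \<Longrightarrow> t1 \<le> cmod (f z) \<Longrightarrow> cmod (F z - T z) \<le> C"
proof -
  have "\<exists>T. rat_fun K T \<and> (\<forall>z\<in>Y. cmod (f z) \<le> t2 \<longrightarrow> cmod (T z) \<le> C) \<and>
      (\<forall>z\<in>Y. t1 \<le> cmod (f z) \<longrightarrow> cmod (F z - T z) \<le> C)"
    using assms
  proof (induction rule: laurent_bound.induct)
    case (monomial g M F k)
    show ?case
    proof (cases "0 \<le> k")
      case True
      then obtain n where k: "k = int n" by (metis nonneg_int_cases)
      have f': "rat_fun K f" by (intro rat_fun_cpolynomial f)
      have "cmod (g z * f z ^ n) \<le> M * annulus_weight t1 t2 k" if "z \<in> Y" "cmod (f z) \<le> t2" for z
      proof -
        have "cmod (g z) * cmod (f z) ^ n \<le> M * t2 ^ n"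
          using that monomial by (intro mult_mono power_mono) auto
        also have "\<dots> \<le> M * annulus_weight t1 t2 k"
          using monomial by (intro mult_left_mono) (auto simp: annulus_weight_def k)
        finally show ?thesis by (simp add: norm_mult norm_power)
      qed
      \<comment> \<open>Here \<open>t1 \<le> cmod (f z)\<close> excludes zeros of \<open>f\<close>,
        so the difference is exactly 0.\<close>
      moreover have "cmod (F z - g z * f z ^ n) \<le> M * annulus_weight t1 t2 k"
        if "z \<in> Y" "t1 \<le> cmod (f z)" for z
      proof -
        have "f z \<noteq> 0" using that t by auto
        then show ?thesis using that monomial annulus_weight_nonneg[OF t(1)] by (auto simp: k)
      qed
      ultimately show ?thesis using monomial f'
        by (intro exI[of _ "\<lambda>z. g z * f z ^ n"]) (auto intro!: rat_fun_mult rat_fun_power)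
    next
      case False
      then obtain n where k: "k = - int n" by (metis linear nonpos_int_cases)
      have "cmod (F z) \<le> M * annulus_weight t1 t2 k" if "z \<in> Y" "t1 \<le> cmod (f z)" for z
      proof -
        have fz: "f z \<noteq> 0" using that t by auto
        have "cmod (g z) * (inverse (cmod (f z))) ^ n \<le> M * (inverse t1) ^ n"
          using that monomial t fz by (intro mult_mono power_mono le_imp_inverse_le) auto
        also have "\<dots> \<le> M * annulus_weight t1 t2 k"
          using monomial
          by (intro mult_left_mono) (auto simp: annulus_weight_def k power_int_minus power_inverse)
        finally show ?thesis using that fz monomial
          by (simp add: norm_mult k power_int_minus norm_inverse norm_power power_inverse)
      qed
      then show ?thesis using monomial annulus_weight_nonneg[OF t(1)]
        by (intro exI[of _ "\<lambda>_. 0"]) (auto intro!: rat_fun_const)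
    qed
  next
    case (add F C G D H)
    then obtain T1 T2 where T: "rat_fun K T1" "rat_fun K T2"
      "\<And>z. z \<in> Y \<Longrightarrow> cmod (f z) \<le> t2 \<Longrightarrow> cmod (T1 z) \<le> C"
      "\<And>z. z \<in> Y \<Longrightarrow> t1 \<le> cmod (f z) \<Longrightarrow> cmod (F z - T1 z) \<le> C"
      "\<And>z. z \<in> Y \<Longrightarrow> cmod (f z) \<le> t2 \<Longrightarrow> cmod (T2 z) \<le> D"
      "\<And>z. z \<in> Y \<Longrightarrow> t1 \<le> cmod (f z) \<Longrightarrow> cmod (G z - T2 z) \<le> D"
      by blast
    have "cmod (H z - (T1 z + T2 z)) \<le> C + D" if "z \<in> Y" "t1 \<le> cmod (f z)" for z
    proof -
      have "f z \<noteq> 0" using that t by auto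
      then have "H z - (T1 z + T2 z) = (F z - T1 z) + (G z - T2 z)" using add that by simp
      then show ?thesis using T(4,6)[OF that] norm_triangle_mono by metis
    qed
    then show ?case using T
      by (intro exI[of _ "\<lambda>z. T1 z + T2 z"]) (auto intro!: rat_fun_add K norm_triangle_mono)
  qed
  then show thesis using that by blast
qed

definition LA where "LA = {F. \<exists>C. lb F C}"
text \<open>Representations are not unique, for \<open>f\<close> may also serve as a coefficient;
  the infimum over them is the quotient seminorm.\<close>

definition LN where "LN F = Inf {C. lb F C}"

lemma LN_lower: "lb F C \<Longrightarrow> LN F \<le> C"
  unfolding LN_def by (intro cInf_lower bdd_belowI[of _ 0]) (auto dest: lb_nonneg)

lemma LN_nonneg: "F \<in> LA \<Longrightarrow> 0 \<le> LN F"
  unfolding LN_def LA_def by (intro cInf_greatest) (auto dest: lb_nonneg)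

lemma LN_approx: "F \<in> LA \<Longrightarrow> LN F < e \<Longrightarrow> \<exists>C<e. lb F C"
  unfolding LN_def LA_def using cInf_lessD[of "{C. lb F C}" e] by auto

lemma LA_add: "F \<in> LA \<Longrightarrow> G \<in> LA \<Longrightarrow> F + G \<in> LA"
  unfolding LA_def using lb_add by blast

lemma LA_mult: "F \<in> LA \<Longrightarrow> G \<in> LA \<Longrightarrow> F * G \<in> LA"
  unfolding LA_def using lb_mult by blast

lemma LN_tri:
  assumes "F \<in> LA" "G \<in> LA"
  shows "LN (F + G) \<le> LN F + LN G"
proof (rule field_le_epsilon)
  fix e :: real assume "0 < e"
  then obtain C D where "C < LN F + e/2" "lb F C" "D < LN G + e/2" "lb G D"
    using LN_approx[OF assms(1), of "LN F + e/2"] LN_approx[OF assms(2), of "LN G + e/2"] by auto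
  then show "LN (F + G) \<le> LN F + LN G + e" using LN_lower[OF lb_add] by fastforce
qed

lemma LN_subm:
  assumes F: "F \<in> LA" and G: "G \<in> LA"
  shows "LN (F * G) \<le> LN F * LN G"
proof (rule field_le_epsilon)
  fix e :: real assume e: "0 < e"
  define s where "s = min 1 (e / (LN F + LN G + 1))"
  have nn: "0 \<le> LN F" "0 \<le> LN G" using F G LN_nonneg by auto
  then have s: "0 < s" "s \<le> 1" "s \<le> e / (LN F + LN G + 1)" using e by (auto simp: s_def)
  then have s': "s * (LN F + LN G + 1) \<le> e" using nn by (simp add: pos_le_divide_eq)
  obtain C where C: "C < LN F + s" "lb F C" using LN_approx[OF F, of "LN F + s"] s by auto
  obtain D where D: "D < LN G + s" "lb G D" using LN_approx[OF G, of "LN G + s"] s by auto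
  obtain E where E: "E \<le> C * D" "lb (F * G) E" using lb_mult[OF C(2) D(2)] by blast
  have "LN (F * G) \<le> C * D" using LN_lower[OF E(2)] E by simp
  also have "\<dots> \<le> (LN F + s) * (LN G + s)"
    using C D nn s lb_nonneg by (intro mult_mono) auto
  also have "\<dots> = LN F * LN G + s * (LN F + LN G + s)" by (simp add: algebra_simps)
  also have "s * (LN F + LN G + s) \<le> s * (LN F + LN G + 1)"
    using s by (intro mult_left_mono) auto
  finally show "LN (F * G) \<le> LN F * LN G + e" using s' by simp
qed

lemma lb_const: "lb (\<lambda>_. w) (cmod w)"
  by (rule lb_rat_fun) (auto intro: rat_fun_const)

lemma LN_const: "LN (\<lambda>_. w) \<le> cmod w" and LA_const: "(\<lambda>_. w) \<in> LA"
  using lb_const LN_lower by (auto simp: LA_def)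

lemma LA_rat_fun:
  assumes "rat_fun K g"
  shows "g \<in> LA"
proof -
  have "bounded (g ` Y)"
    using rat_fun_continuous_on[OF K assms] Y_sub compact_Y
    by (intro compact_imp_bounded compact_continuous_image) (auto intro: continuous_on_subset)
  then obtain M where "\<forall>z\<in>Y. cmod (g z) \<le> M" unfolding bounded_iff by auto
  then have "lb g (max 0 M)" by (intro lb_rat_fun assms) auto
  then show ?thesis by (auto simp: LA_def)
qed

lemma LN_eq_0: "\<lbrakk>\<And>z. z \<in> Y \<Longrightarrow> f z \<noteq> 0 \<Longrightarrow> F z = 0\<rbrakk> \<Longrightarrow> LN F = 0 \<and> F \<in> LA"
  using lb_cong[OF lb_const[of 0], of F] LN_lower[of F 0] LN_nonneg[of F] by (force simp: LA_def)

lemma salg_LN: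
  assumes "1 \<le> LN 1"
  shows "salg LA (\<lambda>w _. w) LN"
proof unfold_locales
  fix F w assume F: "F \<in> LA"
  have "LN ((\<lambda>_. w) * F) \<le> LN (\<lambda>_. w) * LN F" by (intro LN_subm LA_const F)
  also have "\<dots> \<le> cmod w * LN F" by (intro mult_right_mono LN_const LN_nonneg F)
  finally show "LN ((\<lambda>_. w) * F) \<le> cmod w * LN F" .
qed (auto simp: one_fun_def plus_fun_def times_fun_def LA_const LA_add LA_mult LN_nonneg LN_tri LN_subm
  intro: LA_add[unfolded plus_fun_def] LA_mult[unfolded times_fun_def] assms[unfolded one_fun_def]
    LN_tri[unfolded plus_fun_def] LN_subm[unfolded times_fun_def])

section \<open>Spectrum of the Laurent algebra\<close>

lemma LA_cpolynomial: "cpolynomial P \<Longrightarrow> P \<in> LA"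
  by (intro LA_rat_fun rat_fun_cpolynomial)

text \<open>Elements of seminorm 0 form an ideal \<open>Z\<close>, modulo which every polynomial
  equals its value at \<open>a\<close>. Through \<open>\<nu> F \<le> LN F\<close>, bounds on
  \<open>Y\<close> become bounds at \<open>a\<close>, which is what rational convexity asks for; the
  norms of \<open>f\<close> and \<open>1 / f\<close> place \<open>f a\<close> in the
  annulus.\<close>

lemma spectral_point:
  assumes \<nu>: "salg LA (\<lambda>w _. w) \<nu>" and le: "\<And>F. F \<in> LA \<Longrightarrow> \<nu> F \<le> LN F"
    and a: "\<And>i. \<nu> ((\<lambda>z. z $ i) - (\<lambda>_. a $ i)) = 0"
  shows "a \<in> Y" "t1 \<le> cmod (f a)" "cmod (f a) \<le> t2"
    and "rat_fun K g \<Longrightarrow> \<nu> (g - (\<lambda>_. g a)) = 0"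
proof -
  interpret N: salg LA "\<lambda>w _. w" \<nu> by (fact \<nu>)
  define Z where "Z = {F \<in> LA. \<nu> F = 0}"
  have Z_add: "F + G \<in> Z" if "F \<in> Z" "G \<in> Z" for F G
    using that N.tri[of F G] N.nonneg[of "F + G"] N.add_in by (auto simp: Z_def)
  have Z_mult: "F * G \<in> Z" if "F \<in> LA" "G \<in> Z" for F G
    using that N.subm[of F G] N.nonneg[of "F * G"] N.mult_in by (auto simp: Z_def)
  have Z_diff: "F - G \<in> Z" if "F \<in> Z" "G \<in> Z" for F G
    using that N.nu_diff[of F G] N.nonneg[of "F - G"] N.diff_in by (auto simp: Z_def)
  have Z_eq: "\<nu> F = \<nu> G" if "F - G \<in> Z" "F \<in> LA" "G \<in> LA" for F G
  proof -
    have "\<nu> F \<le> \<nu> G" using N.tri[of "F - G" G] that by (auto simp: Z_def)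
    moreover have "\<nu> G \<le> \<nu> F" using N.nu_diff[of F "F - G"] that by (auto simp: Z_def)
    ultimately show ?thesis by simp
  qed
  have Z_0: "F \<in> Z" if "\<And>z. z \<in> Y \<Longrightarrow> f z \<noteq> 0 \<Longrightarrow> F z = 0" for F
    using LN_eq_0[of F] that le[of F] N.nonneg[of F] by (fastforce simp: Z_def)
  have \<nu>_const: "\<nu> (\<lambda>_. w) = cmod w * \<nu> 1" for w
    using N.nu_scal[OF N.one_in, of w] by simp
  have poly: "P - (\<lambda>_. P a) \<in> Z" if "cpolynomial P" for P
    using that
  proof (induction rule: cpolynomial.induct)
    case (const w)
    show ?case by (rule Z_0) simp
  next
    case (coord i)
    then show ?case
      using a[of i] N.diff_in[OF LA_cpolynomial[OF cpolynomial.coord[of i]] LA_const]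
      unfolding Z_def by blast
  next
    case (add P Q)
    have "(\<lambda>z. P z + Q z) - (\<lambda>_. P a + Q a) = (P - (\<lambda>_. P a)) + (Q - (\<lambda>_. Q a))"
      by (auto simp: fun_eq_iff)
    then show ?case using Z_add[OF add.IH] by (simp only:)
  next
    case (mult P Q)
    have "(\<lambda>z. P z * Q z) - (\<lambda>_. P a * Q a) = Q * (P - (\<lambda>_. P a)) + (\<lambda>_. P a) * (Q - (\<lambda>_. Q a))"
      by (auto simp: fun_eq_iff algebra_simps)
    moreover have "Q * (P - (\<lambda>_. P a)) + (\<lambda>_. P a) * (Q - (\<lambda>_. Q a)) \<in> Z"
      using mult by (intro Z_add Z_mult LA_cpolynomial LA_const)
    ultimately show ?case by (simp only:)
  qed
  have \<nu>_poly: "\<nu> P = cmod (P a) * \<nu> 1" if "cpolynomial P" for P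
    using Z_eq[OF poly[OF that] LA_cpolynomial[OF that] LA_const] \<nu>_const by simp
  have \<nu>1: "1 \<le> \<nu> 1" by (fact N.one_le)
  \<comment> \<open>On an empty \<open>Y\<close> every function would have norm 0, contrary to
    \<open>1 \<le> \<nu> 1\<close>.\<close>
  have Y_ne: "Y \<noteq> {}"
    using LN_eq_0[of 1] le[OF N.one_in] \<nu>1 by force
  have quot: "g * Q - P \<in> Z" if "\<forall>z\<in>rational_hull K. g z = P z / Q z" "cpolynomial Q" "\<forall>w\<in>K. Q w \<noteq> 0" for g P Q
    using that rational_hull_nonzero[OF _ that(2,3) K] Y_sub by (intro Z_0) auto
  \<comment> \<open>The function \<open>1 / Q\<close> belongs to the algebra and inverts
    \<open>Q\<close> on \<open>Y\<close>, so \<open>Q\<close> cannot have seminorm 0.\<close>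
  have Qa: "Q a \<noteq> 0" if "cpolynomial Q" "\<forall>w\<in>K. Q w \<noteq> 0" for Q
  proof
    assume "Q a = 0"
    define h where "h = (\<lambda>z. 1 / Q z)"
    have h: "h \<in> LA" unfolding h_def
      using that by (intro LA_rat_fun rat_fun_divide cpolynomial.const)
    have "h * Q - (\<lambda>_. 1) \<in> Z" using that by (intro quot) (auto simp: h_def)
    then have "\<nu> 1 = \<nu> (h * Q)"
      using Z_eq[of "h * Q" 1] h LA_cpolynomial[OF that(1)] N.one_in N.mult_in
      by (simp add: one_fun_def)
    also have "\<dots> \<le> \<nu> h * \<nu> Q" using h LA_cpolynomial[OF that(1)] by (rule N.subm)
    finally show False using \<nu>_poly[OF that(1)] \<open>Q a = 0\<close> \<nu>1 by simp
  qed
  have "cmod (P a) \<le> M * cmod (Q a)"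
    if PQ: "cpolynomial P" "cpolynomial Q" "\<forall>w\<in>K. Q w \<noteq> 0"
      and M: "\<forall>w\<in>Y. cmod (P w) \<le> M * cmod (Q w)" for P Q M
  proof -
    define h where "h = (\<lambda>z. P z / Q z)"
    have h: "rat_fun K h" unfolding h_def using PQ by (intro rat_fun_divide)
    have Qnz: "Q w \<noteq> 0" if "w \<in> Y" for w using rational_hull_nonzero[OF _ PQ(2,3) K] Y_sub that by blast
    have hM: "cmod (h w) \<le> M" if "w \<in> Y" for w
      using M Qnz that by (simp add: h_def norm_divide pos_divide_le_eq)
    moreover obtain w where "w \<in> Y" using Y_ne by blast
    ultimately have "0 \<le> M" using norm_ge_zero order_trans by blast
    then have "\<nu> h \<le> M"
      using LN_lower[OF lb_rat_fun[OF h, of M]] hM le[OF LA_rat_fun[OF h]] by fastforce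
    have "cmod (P a) * \<nu> 1 = \<nu> (h * Q)"
      using Z_eq[OF quot[of h P Q]] PQ LA_cpolynomial LA_rat_fun[OF h] N.mult_in \<nu>_poly
      by (auto simp: h_def)
    also have "\<dots> \<le> \<nu> h * \<nu> Q" using LA_rat_fun[OF h] LA_cpolynomial[OF PQ(2)] by (rule N.subm)
    also have "\<dots> \<le> M * (cmod (Q a) * \<nu> 1)"
      using \<open>\<nu> h \<le> M\<close> \<nu>_poly[OF PQ(2)] \<nu>1 by (auto intro!: mult_right_mono)
    finally show ?thesis using \<nu>1 by (simp flip: mult.assoc)
  qed
  then show aY: "a \<in> Y" using Y unfolding rat_convex_def by blast
  \<comment> \<open>As a monomial with exponent 1 and coefficient 1, \<open>f\<close> has norm at
    most \<open>t2\<close>, however large it is on \<open>Y\<close>.\<close>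
  have "lb f (1 * annulus_weight t1 t2 1)"
    by (rule laurent_bound.monomial[of K "\<lambda>_. 1"]) (auto intro: rat_fun_const)
  then have "\<nu> f \<le> t2"
    using LN_lower[of f] le[OF LA_cpolynomial[OF f]] t by (fastforce simp: annulus_weight_def)
  moreover have "cmod (f a) * 1 \<le> cmod (f a) * \<nu> 1" using \<nu>1 by (intro mult_left_mono) auto
  ultimately show "cmod (f a) \<le> t2" using \<nu>_poly[OF f] by simp
  define F where "F = (\<lambda>z. f z powi -1)"
  have "lb F (1 * annulus_weight t1 t2 (-1))"
    by (rule laurent_bound.monomial[of K "\<lambda>_. 1"]) (auto intro: rat_fun_const simp: F_def)
  moreover have "annulus_weight t1 t2 (-1) = 1 / t1"
    using t by (auto simp: annulus_weight_def divide_simps max_def)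
  ultimately have F: "F \<in> LA" "LN F \<le> 1 / t1" using LN_lower by (auto simp: LA_def)
  \<comment> \<open>Values at zeros of \<open>f\<close> do not affect the norm, so the default value
    of \<open>F\<close> there does no harm.\<close>
  have "f * F - 1 \<in> Z" by (rule Z_0) (auto simp: F_def power_int_minus one_fun_def)
  then have "\<nu> 1 = \<nu> (f * F)"
    using Z_eq[of "f * F" 1] F LA_cpolynomial[OF f] N.one_in N.mult_in by simp
  also have "\<dots> \<le> \<nu> f * \<nu> F" using F LA_cpolynomial[OF f] by (intro N.subm)
  also have "\<dots> \<le> (cmod (f a) * \<nu> 1) * (1 / t1)"
    unfolding \<nu>_poly[OF f]
    using order_trans[OF le[OF F(1)] F(2)] \<nu>1 by (intro mult_left_mono mult_nonneg_nonneg) auto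
  finally show "t1 \<le> cmod (f a)" using \<nu>1 t by (simp add: divide_simps mult.commute)
  assume g: "rat_fun K g"
  obtain P Q where PQ: "cpolynomial P" "cpolynomial Q" "\<forall>w\<in>K. Q w \<noteq> 0" "\<forall>z\<in>rational_hull K. g z = P z / Q z"
    using g unfolding rat_fun_def by blast
  have ga: "g a = P a / Q a" using PQ aY Y_sub by blast
  have "(\<lambda>_. Q a) * (g - (\<lambda>_. g a)) = (g * Q - P) + (P - (\<lambda>_. P a)) - g * (Q - (\<lambda>_. Q a))"
    using Qa[OF PQ(2,3)] by (auto simp: fun_eq_iff algebra_simps ga)
  moreover have "(g * Q - P) + (P - (\<lambda>_. P a)) - g * (Q - (\<lambda>_. Q a)) \<in> Z"
    using PQ LA_rat_fun[OF g] by (intro Z_diff Z_add Z_mult quot poly)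
  ultimately have "(\<lambda>_. Q a) * (g - (\<lambda>_. g a)) \<in> Z" by (simp only:)
  then have "cmod (Q a) * \<nu> (g - (\<lambda>_. g a)) = 0"
    using N.nu_scal[of "g - (\<lambda>_. g a)" "Q a"] LA_rat_fun[OF g] LA_const N.diff_in by (simp add: Z_def)
  then show "\<nu> (g - (\<lambda>_. g a)) = 0" using Qa[OF PQ(2,3)] by simp
qed

text \<open>By \<open>spectral_point\<close> the spectral values of \<open>S\<close> are values at
  points of the annulus, so their moduli are bounded by some \<open>q < 1\<close>;
  \<open>powers_tendsto_zero\<close> does the rest.\<close>

lemma powers_small_on_annulus:
  assumes S: "rat_fun K S"
    and small: "\<And>z. z \<in> Y \<Longrightarrow> t1 \<le> cmod (f z) \<Longrightarrow> cmod (f z) \<le> t2 \<Longrightarrow> cmod (S z) < 1"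
    and e: "0 < e"
  obtains m where "0 < m" "LN (S ^ m) < e"
proof (cases "1 \<le> LN 1")
  case False
  have "1 \<in> LA" using LA_const[of 1] by (simp add: one_fun_def)
  \<comment> \<open>By submultiplicativity a norm of \<open>1\<close> below 1 must be 0; the algebra
    is then trivial and \<open>m = 1\<close> works.\<close>
  then have "LN 1 * (1 - LN 1) \<le> 0" "0 \<le> LN 1"
    using LN_subm[of 1 1] LN_nonneg[of 1] by (simp_all add: algebra_simps)
  then have "LN 1 = 0" using False by (simp add: mult_le_0_iff)
  then have "LN (S ^ 1) \<le> 0"
    using LN_subm[of S 1] LA_rat_fun[OF S] \<open>1 \<in> LA\<close> by simp
  then show thesis using e that[of 1] by simp
next
  case True
  define D where "D = {z \<in> Y. t1 \<le> cmod (f z) \<and> cmod (f z) \<le> t2}"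
  have fc: "continuous_on UNIV f" by (intro cpolynomial_continuous_on f)
  have "closed {z. t1 \<le> cmod (f z)}" "closed {z. cmod (f z) \<le> t2}"
    by (intro closed_Collect_le continuous_intros fc)+
  then have "compact (Y \<inter> ({z. t1 \<le> cmod (f z)} \<inter> {z. cmod (f z) \<le> t2}))"
    using compact_Y by blast
  then have D: "compact D" by (simp add: D_def Int_def)
  have "\<exists>q<1. 0 \<le> q \<and> (\<forall>z\<in>D. cmod (S z) \<le> q)"
  proof (cases "D = {}")
    case False
    have "continuous_on D (\<lambda>z. cmod (S z))"
      using rat_fun_continuous_on[OF K S] Y_sub
      by (intro continuous_intros) (auto intro: continuous_on_subset simp: D_def)
    from continuous_attains_sup[OF D False this] obtain z where "z \<in> D" "\<forall>y\<in>D. cmod (S y) \<le> cmod (S z)"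
      by blast
    then show ?thesis using small by (intro exI[of _ "cmod (S z)"]) (auto simp: D_def)
  qed (auto intro!: exI[of _ 0])
  then obtain q where q: "q < 1" "0 \<le> q" "\<And>z. z \<in> D \<Longrightarrow> cmod (S z) \<le> q" by blast
  define r where "r = (q + 1) / 2"
  have r: "q < r" "r < 1" "0 < r" using q by (auto simp: r_def)
  interpret N: salg LA "\<lambda>w _. w" LN by (rule salg_LN[OF True])
  \<comment> \<open>After division by \<open>r\<close>, where \<open>q < r < 1\<close>, the spectral
    values are still below 1 in modulus, and \<open>r ^ n * LN (x ^ n)\<close> is the norm of
    \<open>S ^ n\<close>.\<close>
  define x where "x = (\<lambda>_. complex_of_real (1 / r)) * S"
  have x_rat: "rat_fun K x" unfolding x_def times_fun_def by (intro rat_fun_mult rat_fun_const S)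
  have x: "x \<in> LA" by (rule LA_rat_fun[OF x_rat])
  have "\<exists>b\<in>LA. LN (1 - (x - (\<lambda>_. w)) * b) < 1" if w: "1 \<le> cmod w" for w
  proof (rule ccontr)
    assume "\<not> ?thesis"
    then have bad: "\<And>b. b \<in> LA \<Longrightarrow> 1 \<le> LN (1 - (x - (\<lambda>_. w)) * b)" by (meson not_less)
    have xw: "x - (\<lambda>_. w) \<in> LA" using x LA_const by (rule N.diff_in)
    \<comment> \<open>A quotient in which \<open>x - w\<close> vanishes still has a character, given
      by a point \<open>a\<close> of \<open>D\<close>. There \<open>x a = w\<close>, although
      \<open>cmod (x a) \<le> q / r < 1\<close>.\<close>
    obtain \<nu>1 where 1: "salg LA (\<lambda>w _. w) \<nu>1" "\<And>F. F \<in> LA \<Longrightarrow> \<nu>1 F \<le> LN F" "\<nu>1 (x - (\<lambda>_. w)) = 0"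
      using N.quotient_salg[OF xw bad] by blast
    obtain \<nu>2 b where 2: "salg LA (\<lambda>w _. w) \<nu>2" "\<And>F. F \<in> LA \<Longrightarrow> \<nu>2 F \<le> \<nu>1 F"
        "\<And>i. \<nu>2 ((\<lambda>z. z $ i) - (\<lambda>_. b i)) = 0"
      using salg.exists_joint_spectral_value[OF 1(1), of "UNIV :: 'n set" "\<lambda>i z. z $ i"]
        LA_cpolynomial[OF cpolynomial.coord] by auto
    define a where "a = (\<chi> i. b i)"
    have le: "\<nu>2 F \<le> LN F" if "F \<in> LA" for F using 1(2) 2(2) that by (meson order_trans)
    have a0: "\<nu>2 ((\<lambda>z. z $ i) - (\<lambda>_. a $ i)) = 0" for i using 2(3) by (simp add: a_def)
    note sp = spectral_point[OF 2(1) _ a0, OF le]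
    interpret N2: salg LA "\<lambda>w _. w" \<nu>2 by (fact 2(1))
    have "\<nu>2 (x - (\<lambda>_. w)) = 0"
      using 2(2)[OF xw] 1(3) N2.nonneg[OF xw] by simp
    moreover have "\<nu>2 (x - (\<lambda>_. x a)) = 0" using sp(4)[of x] x_rat by blast
    moreover have "(\<lambda>_. x a - w) = (x - (\<lambda>_. w)) - (x - (\<lambda>_. x a))" by (auto simp: fun_eq_iff)
    ultimately have "\<nu>2 (\<lambda>_. x a - w) \<le> 0"
      using N2.nu_diff[of "x - (\<lambda>_. w)" "x - (\<lambda>_. x a)"] x LA_const N.diff_in by simp
    moreover have "\<nu>2 (\<lambda>_. x a - w) = cmod (x a - w) * \<nu>2 1"
      using N2.nu_scal[OF N2.one_in, of "x a - w"] by simp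
    ultimately have "cmod (x a - w) * \<nu>2 1 \<le> 0" by simp
    then have "x a = w" using N2.one_le by (simp add: mult_le_0_iff)
    moreover have "cmod (S a) \<le> q" using sp(1-3) by (intro q(3)) (auto simp: D_def)
    ultimately have "cmod w * r \<le> q"
      using r by (auto simp: x_def norm_mult norm_divide divide_simps)
    moreover have "1 * r \<le> cmod w * r" using w r by (intro mult_right_mono) auto
    ultimately show False using r by linarith
  qed
  then have "(\<lambda>n. r ^ n * LN (x ^ n)) \<longlonglongrightarrow> 0"
    using r x by (intro N.powers_tendsto_zero) auto
  then have "\<forall>\<^sub>F n in sequentially. r ^ n * LN (x ^ n) < e" using e by (rule order_tendstoD)
  then obtain n0 where n0: "\<And>n. n0 \<le> n \<Longrightarrow> r ^ n * LN (x ^ n) < e"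
    unfolding eventually_sequentially by blast
  have "(\<lambda>_. complex_of_real r) * x = S" using r by (auto simp: x_def fun_eq_iff)
  then have "LN (S ^ Suc n0) < e"
    using N.nu_scal_power[OF x, of r "Suc n0"] n0[of "Suc n0"] r by simp
  then show thesis using that by blast
qed

text \<open>\<open>T\<close> is \<open>S ^ m\<close> minus the half with nonnegative powers. Where
  \<open>f\<close> has no zero it equals the half with negative powers, which is small for
  \<open>t1 \<le> cmod (f z)\<close>; yet as a difference of rational functions regular on
  \<open>K\<close> it has no poles at the zeros of \<open>f\<close>.\<close>

lemma exists_cut_off:
  assumes S: "rat_fun K S"
    and small: "\<And>z. z \<in> Y \<Longrightarrow> t1 \<le> cmod (f z) \<Longrightarrow> cmod (f z) \<le> t2 \<Longrightarrow> cmod (S z) < 1"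
    and e: "0 < e"
  obtains m T where "0 < m" "rat_fun K T"
    "\<And>z. z \<in> Y \<Longrightarrow> cmod (f z) \<le> t2 \<Longrightarrow> cmod (T z - S z ^ m) \<le> e"
    "\<And>z. z \<in> Y \<Longrightarrow> t1 \<le> cmod (f z) \<Longrightarrow> cmod (T z) \<le> e"
proof -
  obtain m where m: "0 < m" "LN (S ^ m) < e" using powers_small_on_annulus[OF S small e] by blast
  have Sm: "rat_fun K (S ^ m)" by (rule rat_fun_cong[OF rat_fun_power[OF S, of m]]) simp
  obtain C where C: "C < e" "lb (S ^ m) C" using LN_approx[OF LA_rat_fun[OF Sm] m(2)] by blast
  obtain T where T: "rat_fun K T" "\<And>z. z \<in> Y \<Longrightarrow> cmod (f z) \<le> t2 \<Longrightarrow> cmod (T z) \<le> C"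
    "\<And>z. z \<in> Y \<Longrightarrow> t1 \<le> cmod (f z) \<Longrightarrow> cmod ((S ^ m) z - T z) \<le> C"
    using lb_splitting[OF C(2)] by blast
  show thesis
  proof (rule that[OF m(1) rat_fun_diff[OF K Sm T(1)]])
    show "cmod ((S ^ m) z - T z - S z ^ m) \<le> e" if "z \<in> Y" "cmod (f z) \<le> t2" for z
      using T(2)[OF that] C by simp
    show "cmod ((S ^ m) z - T z) \<le> e" if "z \<in> Y" "t1 \<le> cmod (f z)" for z
      using T(3)[OF that] C by simp
  qed
qed

end

section \<open>Local peak points\<close>

lemma compact_superlevel_set:
  fixes g :: "'a::t2_space \<Rightarrow> complex"
  assumes "compact Y" "continuous_on Y g"
  shows "compact {z \<in> Y. c \<le> cmod (g z)}"
proof -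
  have "closed {z \<in> Y. c \<le> cmod (g z)}"
    using assms by (intro continuous_on_closed_Collect_le continuous_intros compact_imp_closed)
  with assms(1) have "compact (Y \<inter> {z \<in> Y. c \<le> cmod (g z)})" by (rule compact_Int_closed)
  moreover have "Y \<inter> {z \<in> Y. c \<le> cmod (g z)} = {z \<in> Y. c \<le> cmod (g z)}" by blast
  ultimately show ?thesis by simp
qed

lemma compact_nonzero_lower_bound:
  fixes h :: "'a::topological_space \<Rightarrow> complex"
  assumes "compact E" "continuous_on E h" "\<And>z. z \<in> E \<Longrightarrow> h z \<noteq> 0"
  obtains t where "0 < t" "t \<le> 1" "\<And>z. z \<in> E \<Longrightarrow> t < cmod (h z)"
proof (cases "E = {}")
  case False
  have "continuous_on E (\<lambda>z. cmod (h z))" using assms by (intro continuous_intros)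
  from continuous_attains_inf[OF assms(1) False this] obtain z where
    z: "z \<in> E" "\<And>y. y \<in> E \<Longrightarrow> cmod (h z) \<le> cmod (h y)" by blast
  have pos: "0 < cmod (h z)" using assms(3)[OF z(1)] by simp
  show thesis
  proof (rule that[of "min 1 (cmod (h z) / 2)"])
    show "min 1 (cmod (h z) / 2) < cmod (h y)" if "y \<in> E" for y
      using z(2)[OF that] pos by linarith
  qed (use pos in auto)
qed (auto intro: that[of 1])

text \<open>Iterate \<open>3 x\<^sup>2 - 2 x\<^sup>3\<close>, which has \<open>0\<close> and \<open>1\<close> as superattracting fixed points.\<close>

lemma rat_fun_sharpen:
  assumes K: "compact K" and R: "rat_fun K R" and d: "0 < d"
  obtains R' where "rat_fun K R'" "\<And>z. R z = 1 \<Longrightarrow> R' z = 1"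
    "\<And>z. cmod (R z - 1) \<le> 1/4 \<Longrightarrow> cmod (R' z - 1) \<le> d"
    "\<And>z. cmod (R z) \<le> 1/4 \<Longrightarrow> cmod (R' z) \<le> d"
proof -
  define q :: "complex \<Rightarrow> complex" where "q x = x\<^sup>2 * (3 - 2 * x)" for x
  \<comment> \<open>One factor \<open>cmod y\<close> is at most 1/4 and
    \<open>cmod (3 - 2 * y)\<close> at most 7/2, whence the rate 7/8.\<close>
  have contract: "cmod (y\<^sup>2 * (3 - 2 * y)) \<le> 7/8 * c" if "cmod y \<le> c" "c \<le> 1/4" for y c
  proof -
    have "0 \<le> c" using that norm_ge_zero order_trans by blast
    have "cmod (3 - 2 * y) \<le> 3 + 2 * cmod y" using norm_triangle_ineq4[of 3 "2 * y"] by (simp add: norm_mult)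
    then have "cmod (y\<^sup>2 * (3 - 2 * y)) \<le> (c * (1/4)) * (7/2)"
      unfolding norm_mult power2_eq_square using that \<open>0 \<le> c\<close> by (intro mult_mono) auto
    then show ?thesis by simp
  qed
  \<comment> \<open>The symmetry \<open>x \<mapsto> 1 - x\<close> reduces the behaviour at 1 to that
    at 0.\<close>
  have q1: "q x - 1 = - ((1 - x)\<^sup>2 * (3 - 2 * (1 - x)))" for x
    by (simp add: q_def power2_eq_square algebra_simps)
  have "\<exists>R'. rat_fun K R' \<and> (\<forall>z. R z = 1 \<longrightarrow> R' z = 1) \<and>
      (\<forall>z. cmod (R z - 1) \<le> 1/4 \<longrightarrow> cmod (R' z - 1) \<le> (7/8) ^ k / 4) \<and>
      (\<forall>z. cmod (R z) \<le> 1/4 \<longrightarrow> cmod (R' z) \<le> (7/8) ^ k / 4)" for k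
  proof (induction k)
    case 0
    then show ?case using R by auto
  next
    case (Suc k)
    then obtain R' where R': "rat_fun K R'" "\<And>z. R z = 1 \<Longrightarrow> R' z = 1"
      "\<And>z. cmod (R z - 1) \<le> 1/4 \<Longrightarrow> cmod (R' z - 1) \<le> (7/8) ^ k / 4"
      "\<And>z. cmod (R z) \<le> 1/4 \<Longrightarrow> cmod (R' z) \<le> (7/8) ^ k / 4" by blast
    have le: "(7/8::real) ^ k / 4 \<le> 1/4" by (simp add: power_le_one)
    have "rat_fun K (\<lambda>z. R' z ^ 2 * (3 + (-2) * R' z))"
      using R'(1) by (intro rat_fun_mult rat_fun_power rat_fun_add K rat_fun_const)
    then have "rat_fun K (\<lambda>z. q (R' z))" by (simp add: q_def)
    moreover have "cmod (q (R' z) - 1) \<le> (7/8) ^ Suc k / 4" if "cmod (R z - 1) \<le> 1/4" for z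
      using contract[OF _ le, of "1 - R' z"] R'(3)[OF that] by (simp add: q1 norm_minus_commute)
    moreover have "cmod (q (R' z)) \<le> (7/8) ^ Suc k / 4" if "cmod (R z) \<le> 1/4" for z
      using contract[OF _ le, of "R' z"] R'(4)[OF that] by (simp add: q_def)
    ultimately show ?case using R'(2) by (intro exI[of _ "\<lambda>z. q (R' z)"]) (auto simp: q_def)
  qed
  note sharp = this
  obtain k where "(7/8::real) ^ k < d" using real_arch_pow_inv[OF d, of "7/8"] by auto
  moreover have "(7/8::real) ^ k / 4 \<le> (7/8) ^ k" by simp
  ultimately have "(7/8::real) ^ k / 4 \<le> d" by linarith
  then have "x \<le> d" if "x \<le> (7/8) ^ k / 4" for x using that by linarith
  moreover obtain R' where "rat_fun K R'" "\<And>z. R z = 1 \<Longrightarrow> R' z = 1"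
      "\<And>z. cmod (R z - 1) \<le> 1/4 \<Longrightarrow> cmod (R' z - 1) \<le> (7/8) ^ k / 4"
      "\<And>z. cmod (R z) \<le> 1/4 \<Longrightarrow> cmod (R' z) \<le> (7/8) ^ k / 4"
    using sharp[of k] by auto
  ultimately show thesis using that[of R'] by simp
qed

text \<open>The coordinates are fixed one at a time: a function separating \<open>p\<close> from the rest of the slice
  \<open>z\<^sub>j = p\<^sub>j\<close> is turned by \<open>exists_cut_off\<close> into one that separates on all of \<open>Y\<close>.\<close>

lemma separate_isolated_point:
  fixes K Y :: "(complex ^ 'n) set"
  assumes K: "compact K" and Y: "rat_convex K Y" and p: "p \<in> Y" and r: "0 < r" "Y \<inter> ball p r = {p}"
  obtains R where "rat_fun K R" "R p = 1" "\<And>z. z \<in> Y \<Longrightarrow> z \<noteq> p \<Longrightarrow> cmod (R z) \<le> 1/8"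
proof -
  have "\<exists>R. rat_fun K R \<and> R p = 1 \<and> (\<forall>z\<in>Y. z \<noteq> p \<longrightarrow> cmod (R z) \<le> 1/8)"
    if "finite J" "\<forall>z\<in>Y. (\<forall>j\<in>J. z $ j = p $ j) \<longrightarrow> z = p" "rat_convex K Y" "p \<in> Y" "Y \<inter> ball p r = {p}"
    for J :: "'n set" and Y
    using that
  proof (induction J arbitrary: Y rule: finite_induct)
    case empty
    then have "\<And>z. z \<in> Y \<Longrightarrow> z = p" by blast
    then show ?case by (intro exI[of _ "\<lambda>_. 1"] conjI rat_fun_const refl) blast
  next
    case (insert j J)
    define f where "f z = z $ j - p $ j" for z :: "complex ^ 'n"
    have f: "cpolynomial f" unfolding f_def by (intro cpolynomial_diff cpolynomial.intros)
    have "\<exists>R. rat_fun K R \<and> R p = 1 \<and> (\<forall>z\<in>{z \<in> Y. f z = 0}. z \<noteq> p \<longrightarrow> cmod (R z) \<le> 1/8)"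
    proof (rule insert.IH)
      show "\<forall>z\<in>{z \<in> Y. f z = 0}. (\<forall>j\<in>J. z $ j = p $ j) \<longrightarrow> z = p"
        using insert.prems(1) by (simp add: f_def)
      show "{z \<in> Y. f z = 0} \<inter> ball p r = {p}"
        using insert.prems(4) by (auto simp: f_def)
      show "rat_convex K {z \<in> Y. f z = 0}" by (rule rat_convex_zero_set[OF insert.prems(2) f])
      show "p \<in> {z \<in> Y. f z = 0}" using insert.prems(3) by (simp add: f_def)
    qed
    then obtain R where R: "rat_fun K R" "R p = 1"
      "\<And>z. z \<in> Y \<Longrightarrow> f z = 0 \<Longrightarrow> z \<noteq> p \<Longrightarrow> cmod (R z) \<le> 1/8" by blast
    have Y: "compact Y" "Y \<subseteq> rational_hull K" using insert.prems(2) by (auto simp: rat_convex_def)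
    have Rc: "continuous_on Y R" using rat_fun_continuous_on[OF K R(1)] Y(2) by (rule continuous_on_subset)
    \<comment> \<open>The points where \<open>R\<close> fails to be small. Removing the ball removes
      only \<open>p\<close> from \<open>Y\<close>, so \<open>f\<close> has no zero on
      \<open>E\<close>.\<close>
    define E where "E = {z \<in> Y. 1/4 \<le> cmod (R z)} - ball p r"
    have "compact E" unfolding E_def by (intro compact_diff compact_superlevel_set Y Rc) auto
    have E0: "f z \<noteq> 0" if "z \<in> E" for z using R(3)[of z] that r by (cases "z = p") (auto simp: E_def)
    obtain t where t: "0 < t" "t \<le> 1" "\<And>z. z \<in> E \<Longrightarrow> t < cmod (f z)"
      using compact_nonzero_lower_bound[OF \<open>compact E\<close> cpolynomial_continuous_on[OF f] E0] by blast
    have small: "cmod (R z) < 1/4" if "z \<in> Y" "cmod (f z) \<le> t" "z \<noteq> p" for z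
    proof (rule ccontr)
      assume "\<not> ?thesis"
      moreover have "z \<notin> ball p r" using that(1,3) insert.prems(4) by (metis IntI singletonD)
      ultimately have "z \<in> E" using that(1) by (simp add: E_def)
      then have "t < cmod (f z)" by (rule t(3))
      then show False using that(2) by linarith
    qed
    interpret annulus K Y f t t
      by (intro annulus.intro K insert.prems(2) f t(1) order_refl)
    have S1: "cmod (R z) < 1" if "z \<in> Y" "t \<le> cmod (f z)" "cmod (f z) \<le> t" for z
      using small[OF that(1,3)] that t by (cases "z = p") (auto simp: f_def)
    have "(0::real) < 1/4" by simp
    then obtain m T where T: "0 < m" "rat_fun K T" "\<And>z. z \<in> Y \<Longrightarrow> cmod (f z) \<le> t \<Longrightarrow> cmod (T z - R z ^ m) \<le> 1/4"
        "\<And>z. z \<in> Y \<Longrightarrow> t \<le> cmod (f z) \<Longrightarrow> cmod (T z) \<le> 1/4"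
      using exists_cut_off[OF R(1) S1] by blast
    have Tp: "3/4 \<le> cmod (T p)"
      using T(3)[of p] t insert.prems R(2) norm_triangle_ineq2[of 1 "T p"]
      by (simp add: f_def norm_minus_commute)
    have Tz: "cmod (T z) \<le> 1/2" if "z \<in> Y" "z \<noteq> p" for z
    proof (cases "cmod (f z) \<le> t")
      case True
      have "cmod (R z) ^ m \<le> cmod (R z) ^ 1"
        using small[OF that(1) True that(2)] T(1) by (intro power_decreasing) auto
      then show ?thesis using T(3)[OF that(1) True] small[OF that(1) True that(2)]
          norm_triangle_ineq2[of "T z" "R z ^ m"] by (simp add: norm_power)
    next
      case False
      then show ?thesis using T(4)[OF that(1)] by simp
    qed
    show ?case
    proof (intro exI conjI ballI impI)
      \<comment> \<open>Off \<open>p\<close> the normalised function is at most (1/2) / (3/4) = 2/3,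
        and 6 is the least exponent for which a power of 2/3 drops below 1/8.\<close>
      show "rat_fun K (\<lambda>z. (T z * (1 / T p)) ^ 6)"
        by (intro rat_fun_power rat_fun_mult T rat_fun_const)
      show "(T p * (1 / T p)) ^ 6 = 1" using Tp by auto
      fix z assume z: "z \<in> Y" "z \<noteq> p"
      have "cmod (T z * (1 / T p)) \<le> (1/2) / (3/4)"
        unfolding norm_mult norm_divide using frac_le[OF _ Tz[OF z] _ Tp] by simp
      then have "cmod (T z * (1 / T p)) ^ 6 \<le> (2/3) ^ 6" by (intro power_mono) auto
      then show "cmod ((T z * (1 / T p)) ^ 6) \<le> 1/8" unfolding norm_power by (simp add: power_divide)
    qed
  qed
  from this[of UNIV Y, OF finite[of UNIV] _ Y p r(2)]
  have "\<exists>R. rat_fun K R \<and> R p = 1 \<and> (\<forall>z\<in>Y. z \<noteq> p \<longrightarrow> cmod (R z) \<le> 1/8)"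
    by (simp add: vec_eq_iff)
  then show thesis using that by blast
qed

text \<open>\<open>S\<close> must be below 1 on the whole level set
  \<open>cmod (f z - 1) = t\<close>. Near \<open>p\<close> this is due to the strict peak. Elsewhere
  only \<open>cmod (f z) \<le> 2\<close> is known, and the factor \<open>R'\<close>
  compensates.\<close>

theorem rational_hull_no_local_peak_point:
  fixes K :: "(complex ^ 'n) set"
  assumes K: "compact K" and p: "p \<in> rational_hull K" and r: "0 < r" "cball p r \<inter> K = {}"
    and f: "cpolynomial f" "f p = 1"
  shows "\<exists>z \<in> rational_hull K \<inter> cball p r. z \<noteq> p \<and> 1 \<le> cmod (f z)"
proof (rule ccontr)
  define H where "H = rational_hull K"
  assume contra: "\<not> ?thesis"
  have peak: "cmod (f z) < 1" if "z \<in> H" "z \<in> cball p r" "z \<noteq> p" for z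
  proof (rule ccontr)
    assume "\<not> cmod (f z) < 1"
    then have "z \<in> H \<inter> cball p r" "z \<noteq> p \<and> 1 \<le> cmod (f z)" using that by auto
    with contra show False unfolding H_def by blast
  qed
  have H: "compact H" "rat_convex K H" "p \<in> H"
    using compact_rational_hull[OF K] rat_convex_hull[OF K] p by (auto simp: H_def)
  define h where "h z = f z - 1" for z
  have h: "cpolynomial h" unfolding h_def using f by (intro cpolynomial_diff cpolynomial.const)
  define Y where "Y = {z \<in> H. h z = 0}"
  have "Y \<inter> ball p r = {p}"
  proof (intro equalityI subsetI)
    fix z assume "z \<in> Y \<inter> ball p r"
    then have "z \<in> H" "z \<in> cball p r" "f z = 1" by (auto simp: Y_def h_def)
    then show "z \<in> {p}" using peak[of z] by auto
  next
    fix z assume "z \<in> {p}"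
    then show "z \<in> Y \<inter> ball p r" using H(3) f(2) r(1) by (simp add: Y_def h_def)
  qed
  moreover have "rat_convex K Y" unfolding Y_def by (intro rat_convex_zero_set H h)
  moreover have "p \<in> Y" using H f by (simp add: Y_def h_def)
  ultimately obtain R where R: "rat_fun K R" "R p = 1" "\<And>z. z \<in> Y \<Longrightarrow> z \<noteq> p \<Longrightarrow> cmod (R z) \<le> 1/8"
    using separate_isolated_point[OF K _ _ r(1)] by blast
  have Rc: "continuous_on H R" unfolding H_def by (rule rat_fun_continuous_on[OF K R(1)])
  have "(0::real) < 1/4" by simp
  from Rc[unfolded continuous_on_iff, rule_format, OF H(3) this]
  obtain d where d: "0 < d" "\<And>z. z \<in> H \<Longrightarrow> dist z p < d \<Longrightarrow> dist (R z) (R p) < 1/4"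
    by blast
  define s where "s = min r (d / 2)"
  have s: "0 < s" "s \<le> r" "s < d" using r d by (auto simp: s_def)
  have near: "cmod (R z - 1) \<le> 1/4" if "z \<in> H" "z \<in> cball p s" for z
  proof -
    have "dist z p < d" using that s by (simp add: dist_commute)
    from d(2)[OF that(1) this] show ?thesis by (simp add: R(2) dist_norm)
  qed
  \<comment> \<open>Away from \<open>p\<close>, \<open>R\<close> is large only where
    \<open>f\<close> differs from 1. So for small \<open>t\<close> the points with
    \<open>cmod (h z) \<le> t\<close> outside \<open>ball p s\<close> have
    \<open>cmod (R z) < 1/4\<close>.\<close>
  define E where "E = {z \<in> H. 1/4 \<le> cmod (R z)} - ball p s"
  have "compact E" unfolding E_def by (intro compact_diff compact_superlevel_set H Rc) auto
  have E0: "h z \<noteq> 0" if "z \<in> E" for z using R(3)[of z] that s by (cases "z = p") (auto simp: E_def Y_def)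
  obtain t where t: "0 < t" "t \<le> 1" "\<And>z. z \<in> E \<Longrightarrow> t < cmod (h z)"
    using compact_nonzero_lower_bound[OF \<open>compact E\<close> cpolynomial_continuous_on[OF h] E0] by blast
  \<comment> \<open>The part of the level set near \<open>p\<close>. It omits \<open>p\<close>
    because \<open>h p = 0\<close>, so compactness bounds \<open>cmod (f z)\<close> on it by some
    \<open>a < 1\<close>.\<close>
  define N where "N = H \<inter> cball p s \<inter> {z. cmod (h z) = t}"
  have "compact N" unfolding N_def
    using H by (intro compact_Int_closed closed_Collect_eq continuous_intros cpolynomial_continuous_on h) auto
  have N1: "cmod (f z) < 1" if "z \<in> N" for z
  proof (rule peak)
    show "z \<in> H" "z \<in> cball p r" using that s(2) by (auto simp: N_def)
    show "z \<noteq> p" using that t(1) f(2) by (auto simp: N_def h_def)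
  qed
  obtain a where a: "a < 1" "\<And>z. z \<in> N \<Longrightarrow> cmod (f z) \<le> a"
  proof (cases "N = {}")
    case False
    have "continuous_on N (\<lambda>z. cmod (f z))" by (intro continuous_intros cpolynomial_continuous_on f)
    from continuous_attains_sup[OF \<open>compact N\<close> False this] show ?thesis using N1 that by blast
  next
    case True
    then show ?thesis using that[of 0] by simp
  qed
  \<comment> \<open>Chosen for \<open>(1 + \<delta>) * a \<le> a + \<delta> < 1\<close> near
    \<open>p\<close> and \<open>\<delta> * 2 \<le> 1/2\<close> away from it.\<close>
  define \<delta> where "\<delta> = min (1/4) ((1 - a) / 2)"
  have \<delta>: "0 < \<delta>" "\<delta> \<le> 1/4" "2 * \<delta> \<le> 1 - a"
    using a(1) min.cobounded2[of "1/4" "(1 - a) / 2"] by (simp_all add: \<delta>_def)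
  obtain R' where R': "rat_fun K R'" "\<And>z. R z = 1 \<Longrightarrow> R' z = 1"
    "\<And>z. cmod (R z - 1) \<le> 1/4 \<Longrightarrow> cmod (R' z - 1) \<le> \<delta>"
    "\<And>z. cmod (R z) \<le> 1/4 \<Longrightarrow> cmod (R' z) \<le> \<delta>"
    using rat_fun_sharpen[OF K R(1) \<delta>(1)] by blast
  define S where "S z = R' z * f z" for z
  have S: "rat_fun K S" unfolding S_def by (intro rat_fun_mult R'(1) rat_fun_cpolynomial f(1))
  have far: "cmod (S z) \<le> 1/2" if "z \<in> H" "cmod (h z) \<le> t" "z \<notin> ball p s" for z
  proof -
    have "z \<notin> E" using t(3)[of z] that(2) by auto
    then have "cmod (R z) \<le> 1/4" using that by (auto simp: E_def)
    moreover have "cmod (f z) \<le> 2"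
      using norm_triangle_ineq[of "h z" 1] that t by (simp add: h_def)
    ultimately have "cmod (R' z) * cmod (f z) \<le> (1/4) * 2"
      using R'(4)[of z] \<delta> by (intro mult_mono) auto
    then show ?thesis by (simp add: S_def norm_mult)
  qed
  interpret annulus K H h t t
    by (intro annulus.intro K H(2) h t(1) order_refl)
  have S1: "cmod (S z) < 1" if z: "z \<in> H" "t \<le> cmod (h z)" "cmod (h z) \<le> t" for z
  proof (cases "z \<in> ball p s")
    case True
    have "cmod (R' z - 1) \<le> \<delta>" using True z by (intro R'(3) near) auto
    then have "cmod (R' z) \<le> 1 + \<delta>" using norm_triangle_ineq[of "R' z - 1" 1] by simp
    moreover have "cmod (f z) \<le> a" using True z by (intro a) (auto simp: N_def)
    ultimately have "cmod (R' z) * cmod (f z) \<le> (1 + \<delta>) * a"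
      using \<delta> by (intro mult_mono) auto
    also have "\<dots> \<le> a + \<delta> * 1" using \<delta> a by (simp add: algebra_simps)
    also have "\<dots> < 1" using \<delta> a by linarith
    finally show ?thesis by (simp add: S_def norm_mult)
  next
    case False
    then show ?thesis using far[of z] z by simp
  qed
  \<comment> \<open>Error 1/8 leaves a gap: \<open>T\<close> is at least 7/8 in modulus at
    \<open>p\<close>, where \<open>S p = 1\<close>, but at most 1/2 + 1/8 on
    \<open>K\<close>.\<close>
  have "(0::real) < 1/8" by simp
  then obtain m T where T: "0 < m" "rat_fun K T" "\<And>z. z \<in> H \<Longrightarrow> cmod (h z) \<le> t \<Longrightarrow> cmod (T z - S z ^ m) \<le> 1/8"
      "\<And>z. z \<in> H \<Longrightarrow> t \<le> cmod (h z) \<Longrightarrow> cmod (T z) \<le> 1/8"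
    using exists_cut_off[OF S S1] by blast
  have "cmod (T p - 1) \<le> 1/8"
    using T(3)[OF H(3)] R'(2)[OF R(2)] \<open>f p = 1\<close> t(1) by (simp add: S_def h_def)
  then have "7/8 \<le> cmod (T p)" using norm_triangle_ineq2[of 1 "T p"] by (simp add: norm_minus_commute)
  moreover have "cmod (T p) \<le> 5/8"
  proof (rule rat_fun_bound[OF K T(2) p], rule ballI)
    fix z assume z: "z \<in> K"
    then have zH: "z \<in> H" using rational_hull_superset by (auto simp: H_def)
    show "cmod (T z) \<le> 5/8"
    proof (cases "cmod (h z) \<le> t")
      case True
      have "z \<notin> cball p r" using z r(2) by blast
      then have "z \<notin> ball p s" using s(2) by auto
      then have Sz: "cmod (S z) \<le> 1/2" using far[OF zH True] by simp
      then have "cmod (S z) ^ m \<le> cmod (S z) ^ 1" using T(1) by (intro power_decreasing) auto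
      then show ?thesis using T(3)[OF zH True] Sz norm_triangle_ineq2[of "T z" "S z ^ m"]
        by (simp add: norm_power)
    next
      case False
      then show ?thesis using T(4)[OF zH] by simp
    qed
  qed
  ultimately show False by simp
qed

section \<open>Mollification of functions with the submean value property\<close>

text \<open>The Hermitian product, linear in the first argument so that it is a polynomial in
  \<open>x\<close>.\<close>

definition cdot :: "complex ^ 'n \<Rightarrow> complex ^ 'n \<Rightarrow> complex" where
  "cdot x w = (\<Sum>j\<in>UNIV. x $ j * cnj (w $ j))"

lemma norm_vector_smult: "norm (c *s x) = cmod c * norm x" for x :: "complex ^ 'n"
  by (simp add: norm_vec_def norm_mult L2_set_right_distrib)

lemma cdot_smult: "cdot (c *s x) w = c * cdot x w"
  by (simp add: cdot_def sum_distrib_left mult.assoc)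

lemma Re_cdot: "Re (cdot x w) = inner w x"
  by (simp add: cdot_def inner_vec_def inner_complex_def mult.commute)

text \<open>Rotating \<open>x\<close> makes the product real and nonnegative; the real
  Cauchy-Schwarz inequality then applies.\<close>

lemma cmod_cdot_le: "cmod (cdot x w) \<le> norm x * norm w"
proof -
  obtain t where t: "cdot x w = rcis (cmod (cdot x w)) t" by (metis rcis_cmod_Arg)
  have "cmod (cdot x w) = Re (cis (- t) * cdot x w)"
  proof -
    have "cis (- t) * rcis r t = of_real r" for r
      by (simp add: rcis_def cis_mult mult.left_commute[of "cis (- t)"])
    then show ?thesis using t by (metis Re_complex_of_real)
  qed
  also have "\<dots> = inner w (cis (- t) *s x)" by (simp add: Re_cdot flip: cdot_smult)
  also have "\<dots> \<le> norm w * norm (cis (- t) *s x)" by (rule norm_cauchy_schwarz)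
  finally show ?thesis by (simp add: norm_vector_smult mult.commute)
qed

lemma norm_diff_squared: "(norm (w - x))\<^sup>2 = (norm w)\<^sup>2 - 2 * Re (cdot x w) + (norm x)\<^sup>2"
  for x w :: "complex ^ 'n"
  by (simp add: Re_cdot power2_norm_eq_inner inner_diff_left inner_diff_right inner_commute)

lemma continuous_on_vector_smult [continuous_intros]:
  fixes f :: "'a::topological_space \<Rightarrow> complex" and g :: "'a \<Rightarrow> complex ^ 'n"
  assumes "continuous_on S f" "continuous_on S g"
  shows "continuous_on S (\<lambda>x. f x *s g x)"
proof -
  have "(\<lambda>x. f x *s g x) = (\<lambda>x. \<chi> i. f x * g x $ i)" by (auto simp: vec_eq_iff)
  then show ?thesis
    by (simp only:) (intro continuous_on_vec_lambda continuous_intros assms)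
qed

text \<open>The cube of this bump has Lipschitz second derivatives and is explicit enough to be
  expanded by algebra, with no differentiation under the integral sign.\<close>

definition hat :: "complex ^ 'n \<Rightarrow> real" where
  "hat w = max 0 (1 - (norm w)\<^sup>2)"

lemma hat_bounds: "0 \<le> hat w" "hat w \<le> 1"
  by (auto simp: hat_def)

lemma hat_eq_0: "1 \<le> norm w \<Longrightarrow> hat w = 0"
  by (simp add: hat_def one_le_power)

text \<open>The second derivative of the cubed positive part is \<open>6 * max 0 s\<close>, which
  has Lipschitz constant 6; the remainder constant is 6 / 3! = 1.\<close>

lemma positive_part_cube_taylor:
  fixes s t :: real
  shows "\<bar>(max 0 (s + t)) ^ 3 - (max 0 s) ^ 3 - 3 * (max 0 s)\<^sup>2 * t - 3 * max 0 s * t\<^sup>2\<bar> \<le> \<bar>t\<bar> ^ 3"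
proof -
  consider "0 \<le> s" "0 \<le> s + t" | "0 \<le> s" "s + t < 0" | "s < 0" "s + t \<le> 0" | "s < 0" "0 < s + t"
    by linarith
  then show ?thesis
  proof cases
    case 1
    then have "(max 0 (s + t)) ^ 3 - (max 0 s) ^ 3 - 3 * (max 0 s)\<^sup>2 * t - 3 * max 0 s * t\<^sup>2 = t ^ 3"
      by (simp add: max_def power2_eq_square power3_eq_cube algebra_simps)
    then show ?thesis by (simp add: power_abs)
  next
    case 2
    then have "(max 0 (s + t)) ^ 3 - (max 0 s) ^ 3 - 3 * (max 0 s)\<^sup>2 * t - 3 * max 0 s * t\<^sup>2
        = (- (s + t)) ^ 3 - (- t) ^ 3"
      by (simp add: max_def power2_eq_square power3_eq_cube algebra_simps)
    moreover have "0 \<le> (- (s + t)) ^ 3" "(- (s + t)) ^ 3 \<le> (- t) ^ 3"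
      using 2 by (auto intro!: power_mono zero_le_power simp del: power_minus_odd)
    moreover have "\<bar>t\<bar> ^ 3 = (- t) ^ 3" using 2 by (simp add: abs_if del: power_minus_odd)
    ultimately show ?thesis by linarith
  next
    case 4
    then have "(s + t) ^ 3 \<le> t ^ 3" by (intro power_mono) auto
    then show ?thesis using 4 by (simp add: max_def abs_if)
  qed (auto simp: max_def)
qed

text \<open>The terms are sorted into the real part of a polynomial in \<open>x\<close> and Levi
  terms, which do not change when \<open>x\<close> is multiplied by a complex unit. The constant is
  152 = 125 + 27: 5 cubed from \<open>\<bar>t\<bar> \<le> 5 * n\<close>, and 3 * 9 from the terms of
  order above two in the square of \<open>t\<close>.\<close>

lemma hat_cube_taylor:
  assumes x: "norm x \<le> 1"
  shows "\<bar>hat (w - x) ^ 3 - (hat w ^ 3 + Re (6 * of_real ((hat w)\<^sup>2) * cdot x w + 6 * of_real (hat w) * (cdot x w)\<^sup>2)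
      + (6 * hat w * (cmod (cdot x w))\<^sup>2 - 3 * (hat w)\<^sup>2 * (norm x)\<^sup>2))\<bar>
    \<le> 152 * norm x ^ 3 * indicator (cball 0 2) w"
proof (cases "norm w \<le> 2")
  case False
  have "norm w - norm x \<le> norm (w - x)" by (rule norm_triangle_ineq2)
  then have "hat (w - x) = 0" using False x by (intro hat_eq_0) linarith
  moreover have "hat w = 0" using False by (intro hat_eq_0) linarith
  ultimately show ?thesis using False by simp
next
  case True
  define a n s t where "a = cdot x w" and "n = norm x" and "s = hat w" and "t = 2 * Re a - n\<^sup>2"
  have n: "0 \<le> n" "n \<le> 1" using x by (auto simp: n_def)
  have s: "0 \<le> s" "s \<le> 1" using hat_bounds by (auto simp: s_def)
  have "cmod a \<le> n * 2"
    using cmod_cdot_le[of x w] mult_left_mono[OF True, of "norm x"] by (simp add: a_def n_def)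
  then have a: "\<bar>Re a\<bar> \<le> 2 * n" using abs_Re_le_cmod[of a] by linarith
  have n2: "n\<^sup>2 \<le> n" "0 \<le> n\<^sup>2" using n by (auto simp: power2_eq_square mult_left_le)
  have "\<bar>t\<bar> \<le> 5 * n" unfolding t_def using a n n2 by linarith
  then have "\<bar>t\<bar> ^ 3 \<le> (5 * n) ^ 3" by (intro power_mono) auto
  then have t3: "\<bar>t\<bar> ^ 3 \<le> 125 * n ^ 3" by (simp add: power_mult_distrib)
  have hat_diff: "hat (w - x) = max 0 ((1 - (norm w)\<^sup>2) + t)"
    by (simp add: hat_def norm_diff_squared t_def a_def n_def)
  have T: "\<bar>hat (w - x) ^ 3 - s ^ 3 - 3 * s\<^sup>2 * t - 3 * s * t\<^sup>2\<bar> \<le> 125 * n ^ 3"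
    using positive_part_cube_taylor[of "1 - (norm w)\<^sup>2" t] t3
    unfolding hat_diff s_def hat_def[of w] by linarith
  \<comment> \<open>Splits the quadratic term into a holomorphic and a Levi part.\<close>
  have Rea: "2 * (Re a)\<^sup>2 = Re (a\<^sup>2) + (cmod a)\<^sup>2"
    using cmod_power2[of a] by (simp add: Re_power2)
  have "\<bar>n ^ 4 - 4 * Re a * n\<^sup>2\<bar> \<le> \<bar>n ^ 4\<bar> + \<bar>4 * Re a * n\<^sup>2\<bar>" by (rule abs_triangle_ineq4)
  also have "\<bar>n ^ 4\<bar> \<le> n ^ 3" using n by (simp add: power_decreasing)
  also have "\<bar>4 * Re a * n\<^sup>2\<bar> \<le> (4 * (2 * n)) * n\<^sup>2"
    unfolding abs_mult using a by (intro mult_mono) auto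
  finally have "\<bar>n ^ 4 - 4 * Re a * n\<^sup>2\<bar> \<le> 9 * n ^ 3" by (simp add: power2_eq_square power3_eq_cube)
  then have "3 * s * \<bar>n ^ 4 - 4 * Re a * n\<^sup>2\<bar> \<le> 3 * 1 * (9 * n ^ 3)"
    using s by (intro mult_mono) auto
  then have E: "\<bar>3 * s * (n ^ 4 - 4 * Re a * n\<^sup>2)\<bar> \<le> 27 * n ^ 3"
    using s by (simp add: abs_mult)
  have "3 * s\<^sup>2 * t + 3 * s * t\<^sup>2 = 6 * s\<^sup>2 * Re a - 3 * s\<^sup>2 * n\<^sup>2 + 6 * s * (2 * (Re a)\<^sup>2)
      + 3 * s * (n ^ 4 - 4 * Re a * n\<^sup>2)"
    by (simp add: t_def power2_eq_square algebra_simps power4_eq_xxxx)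
  then have eq: "hat (w - x) ^ 3 - (s ^ 3 + Re (6 * of_real (s\<^sup>2) * a + 6 * of_real s * a\<^sup>2)
      + (6 * s * (cmod a)\<^sup>2 - 3 * s\<^sup>2 * n\<^sup>2))
    = (hat (w - x) ^ 3 - s ^ 3 - 3 * s\<^sup>2 * t - 3 * s * t\<^sup>2) + 3 * s * (n ^ 4 - 4 * Re a * n\<^sup>2)"
    unfolding Rea by (simp add: algebra_simps)
  show ?thesis
    using T E True unfolding eq[unfolded s_def a_def n_def] by (simp add: s_def a_def n_def)
qed

section \<open>Integrals of bounded functions with compact support\<close>

lemma integrable_bounded_compact_support:
  fixes F :: "'a::euclidean_space \<Rightarrow> 'b::{banach,second_countable_topology}"
  assumes F: "F \<in> borel_measurable borel" and S: "compact S"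
    and b: "\<And>p. norm (F p) \<le> C * indicator S p"
  shows "integrable lborel F" "norm (\<integral>p. F p \<partial>lborel) \<le> C * measure lborel S"
proof -
  have S': "S \<in> sets lborel" "emeasure lborel S < \<infinity>"
    using S emeasure_compact_finite by (auto simp: borel_compact)
  then have i: "integrable lborel (\<lambda>p. C * indicator S p :: real)" by auto
  show int: "integrable lborel F"
    by (rule Bochner_Integration.integrable_bound[OF i]) (use F b in \<open>auto intro!: AE_I2 order_trans[OF b]\<close>)
  have "norm (\<integral>p. F p \<partial>lborel) \<le> (\<integral>p. norm (F p) \<partial>lborel)" by (rule integral_norm_bound)
  also have "\<dots> \<le> (\<integral>p. C * indicator S p \<partial>lborel)" using int i b by (intro integral_mono) auto
  finally show "norm (\<integral>p. F p \<partial>lborel) \<le> C * measure lborel S" by simp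
qed

lemma lborel_integral_translate:
  fixes F :: "'a::euclidean_space \<Rightarrow> 'b::{banach,second_countable_topology}"
  assumes "F \<in> borel_measurable borel"
  shows "(\<integral>w. F (c + w) \<partial>lborel) = (\<integral>w. F w \<partial>lborel)"
proof -
  have "(\<integral>w. F w \<partial>lborel) = (\<integral>w. F w \<partial>distr lborel borel ((+) c))" by (simp add: lborel_distr_plus)
  also have "\<dots> = (\<integral>w. F (c + w) \<partial>lborel)" using assms by (intro integral_distr) auto
  finally show ?thesis by simp
qed

text \<open>Removes the holomorphic terms of degree 1 and 2 when a Taylor expansion is averaged over
  a circle.\<close>

lemma integral_cis_multiple:
  assumes "k \<noteq> (0::int)"
  shows "(\<integral>s. indicator {0..2*pi} s * Re (cis (of_int k * s) * c) \<partial>lborel) = 0"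
proof -
  define F where "F s = Re (cis (of_int k * s) * c / (\<i> * of_int k))" for s
  have deriv: "(F has_real_derivative Re (cis (of_int k * s) * c)) (at s within A)" for s A
  proof -
    have "((\<lambda>s. cos (of_int k * s)) has_real_derivative - sin (of_int k * s) * of_int k) (at s within A)"
      "((\<lambda>s. sin (of_int k * s)) has_real_derivative cos (of_int k * s) * of_int k) (at s within A)"
      by (auto intro!: derivative_eq_intros)
    moreover have "F = (\<lambda>s. (Im c * cos (of_int k * s) + Re c * sin (of_int k * s)) / of_int k)"
      using assms by (auto simp: F_def fun_eq_iff Re_divide power2_eq_square divide_simps algebra_simps)
    ultimately show ?thesis using assms
      by (auto intro!: derivative_eq_intros simp: field_simps)
  qed
  have "((\<lambda>s. Re (cis (of_int k * s) * c)) has_integral (F (2*pi) - F 0)) {0..2*pi}"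
    using deriv by (intro fundamental_theorem_of_calculus)
      (auto simp: has_real_derivative_iff_has_vector_derivative)
  moreover have "F (2*pi) = F 0"
    using cis_multiple_2pi[of "of_int k"] by (simp add: F_def mult.commute)
  ultimately have "integral {0..2*pi} (\<lambda>s. Re (cis (of_int k * s) * c)) = 0" by (simp add: integral_unique)
  moreover have "set_integrable lborel {0..2*pi} (\<lambda>s. Re (cis (of_int k * s) * c))"
    by (intro borel_integrable_atLeastAtMost') (auto intro!: continuous_intros)
  ultimately show ?thesis
    using set_borel_integral_eq_integral(2) unfolding set_lebesgue_integral_def by fastforce
qed

lemma lborel_fubini:
  fixes F :: "'a::euclidean_space \<times> 'b::euclidean_space \<Rightarrow> 'c::{banach,second_countable_topology}"
  assumes "integrable lborel F"
  shows "(\<integral>p. F p \<partial>lborel) = (\<integral>x. \<integral>y. F (x, y) \<partial>lborel \<partial>lborel)"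
    and "(\<integral>p. F p \<partial>lborel) = (\<integral>y. \<integral>x. F (x, y) \<partial>lborel \<partial>lborel)"
    and "integrable lborel (\<lambda>x. \<integral>y. F (x, y) \<partial>lborel)"
    and "integrable lborel (\<lambda>y. \<integral>x. F (x, y) \<partial>lborel)"
proof -
  have F: "integrable (lborel \<Otimes>\<^sub>M lborel) F" using assms by (simp add: lborel_prod)
  show 1: "(\<integral>p. F p \<partial>lborel) = (\<integral>x. \<integral>y. F (x, y) \<partial>lborel \<partial>lborel)"
    using lborel_pair.integral_fst'[OF F] by (simp add: lborel_prod)
  have F': "integrable (lborel \<Otimes>\<^sub>M lborel) (case_prod (\<lambda>x y. F (x, y)))" using F by simp
  show "(\<integral>p. F p \<partial>lborel) = (\<integral>y. \<integral>x. F (x, y) \<partial>lborel \<partial>lborel)"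
    using lborel_pair.Fubini_integral[OF F'] 1 by simp
  show "integrable lborel (\<lambda>x. \<integral>y. F (x, y) \<partial>lborel)" by (rule lborel_pair.integrable_fst'[OF F])
  show "integrable lborel (\<lambda>y. \<integral>x. F (x, y) \<partial>lborel)" using lborel_pair.integrable_snd[OF F'] by simp
qed

lemma hat_power_bounds: "0 \<le> hat w ^ n" "hat w ^ n \<le> 1" "norm (hat w ^ n) \<le> 1"
  using hat_bounds[of w] by (auto simp: power_le_one)

text \<open>Averaging over rotations \<open>t\<close> as well as over \<open>w\<close> makes the submean value property carry over
  without appeal to rotation invariance of the Lebesgue measure.\<close>

locale mollifier =
  fixes g :: "complex ^ 'n \<Rightarrow> real" and B \<delta> :: real
  assumes meas: "g \<in> borel_measurable borel" and bdd: "\<And>z. \<bar>g z\<bar> \<le> B" and \<delta>: "0 < \<delta>"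
begin

text \<open>Radius 2 leaves room for the support of \<open>hat\<close>, the unit ball, to be
  translated by vectors of norm at most 1.\<close>

definition dom :: "(real \<times> (complex ^ 'n)) set" where "dom = {0..2*pi} \<times> cball 0 2"

definition angle :: "real \<Rightarrow> real" where "angle = indicator {0..2*pi}"

definition shifted :: "complex ^ 'n \<Rightarrow> real \<times> (complex ^ 'n) \<Rightarrow> real" where
  "shifted z p = g (z + (of_real \<delta> * cis (fst p)) *s snd p)"

text \<open>Not normalised: the total weight is \<open>mass\<close> below.\<close>

definition mollify :: "complex ^ 'n \<Rightarrow> real" where
  "mollify z = (\<integral>p. angle (fst p) * hat (snd p) ^ 3 * shifted z p \<partial>lborel)"

lemma B_nonneg: "0 \<le> B" using bdd[of 0] by simp

lemma compact_dom: "compact dom" unfolding dom_def by (intro compact_Times) auto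

lemma shifted_measurable [measurable]: "shifted z \<in> borel_measurable borel"
  unfolding shifted_def
  by (rule measurable_compose[OF borel_measurable_continuous_onI meas]) (intro continuous_intros)

lemma angle_measurable [measurable]: "(\<lambda>p. angle (fst p)) \<in> borel_measurable borel"
  unfolding angle_def by (rule measurable_compose[OF borel_measurable_continuous_onI]) (auto intro!: continuous_intros)

lemma hat_continuous [continuous_intros]:
  "continuous_on S f \<Longrightarrow> continuous_on S (\<lambda>x. hat (f x))"
  unfolding hat_def by (intro continuous_intros)

lemma angle_bounds: "0 \<le> angle t" "angle t \<le> 1"
  by (auto simp: angle_def indicator_def)

lemma integrable_kernel:
  fixes k :: "real \<times> (complex ^ 'n) \<Rightarrow> 'b::{real_normed_algebra_1,banach,second_countable_topology}"
  assumes k: "continuous_on UNIV k" and b: "\<And>p. p \<in> dom \<Longrightarrow> norm (k p) \<le> C"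
    and supp: "\<And>p. snd p \<notin> cball 0 2 \<Longrightarrow> k p = 0"
  shows "integrable lborel (\<lambda>p. of_real (angle (fst p) * shifted z p) * k p)"
    and "norm (\<integral>p. of_real (angle (fst p) * shifted z p) * k p \<partial>lborel) \<le> B * C * measure lborel dom"
proof -
  have [measurable]: "k \<in> borel_measurable borel" using k by (rule borel_measurable_continuous_onI)
  have m: "(\<lambda>p. of_real (angle (fst p) * shifted z p) * k p) \<in> borel_measurable borel" by measurable
  have bound: "norm (of_real (angle (fst p) * shifted z p) * k p) \<le> B * C * indicator dom p" for p
  proof (cases "p \<in> dom")
    case True
    then have "angle (fst p) = 1" by (auto simp: dom_def angle_def)
    then have "norm (of_real (angle (fst p) * shifted z p) * k p) \<le> \<bar>shifted z p\<bar> * norm (k p)"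
      using norm_mult_ineq[of "of_real (shifted z p)" "k p"] by simp
    also have "\<dots> \<le> B * C" using b[OF True] bdd B_nonneg by (intro mult_mono) (auto simp: shifted_def)
    finally show ?thesis using True by simp
  next
    case False
    then have "angle (fst p) = 0 \<or> k p = 0" using supp by (cases p) (auto simp: dom_def angle_def)
    then show ?thesis using False by auto
  qed
  note r = integrable_bounded_compact_support[OF m compact_dom bound]
  show "integrable lborel (\<lambda>p. of_real (angle (fst p) * shifted z p) * k p)"
    "norm (\<integral>p. of_real (angle (fst p) * shifted z p) * k p \<partial>lborel) \<le> B * C * measure lborel dom"
    using r by auto
qed

text \<open>As \<open>g\<close> is merely measurable, the increment \<open>y\<close> has to be moved
  onto the kernel. For fixed \<open>t\<close> this is a translation in \<open>w\<close>, by
  \<open>y\<close> rotated through \<open>- t\<close> and divided by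
  \<open>\<delta>\<close>.\<close>

lemma mollify_shift:
  assumes y: "norm y \<le> \<delta>"
  shows "mollify (z + y) =
    (\<integral>p. angle (fst p) * shifted z p * hat (snd p - (cis (- fst p) / of_real \<delta>) *s y) ^ 3 \<partial>lborel)"
proof -
  define x where "x t = (cis (- t) / of_real \<delta>) *s y" for t
  have x: "norm (x t) \<le> 1" for t
    using y \<delta> by (simp add: x_def norm_vector_smult norm_divide)
  define F where "F t w = angle t * shifted z (t, w) * hat (w - x t) ^ 3" for t w
  have intF: "integrable lborel (\<lambda>p. of_real (angle (fst p) * shifted z p) * (hat (snd p - x (fst p)) ^ 3))"
  proof (rule integrable_kernel)
    show "continuous_on UNIV (\<lambda>p. hat (snd p - x (fst p)) ^ 3)"
      using \<delta> unfolding x_def by (intro continuous_intros) auto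
    show "norm (hat (snd p - x (fst p)) ^ 3) \<le> 1" for p
      by (rule hat_power_bounds)
    show "hat (snd p - x (fst p)) ^ 3 = 0" if "snd p \<notin> cball 0 2" for p
      using that x[of "fst p"] norm_triangle_ineq2[of "snd p" "x (fst p)"] by (simp add: hat_eq_0)
  qed
  have intG: "integrable lborel (\<lambda>p. of_real (angle (fst p) * shifted (z + y) p) * (hat (snd p) ^ 3))"
  proof (rule integrable_kernel)
    show "continuous_on UNIV (\<lambda>p. hat (snd p) ^ 3)" by (intro continuous_intros)
    show "norm (hat (snd p) ^ 3) \<le> 1" for p by (rule hat_power_bounds)
    show "hat (snd p) ^ 3 = 0" if "snd p \<notin> cball 0 2" for p using that by (simp add: hat_eq_0)
  qed
  have F_meas: "F t \<in> borel_measurable borel" for t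
  proof -
    have "(\<lambda>w. shifted z (t, w)) \<in> borel_measurable borel"
      by (rule measurable_compose[OF borel_measurable_continuous_onI shifted_measurable])
        (intro continuous_intros)
    moreover have "(\<lambda>w. hat (w - x t) ^ 3) \<in> borel_measurable borel"
      by (intro borel_measurable_continuous_onI continuous_intros)
    ultimately show ?thesis unfolding F_def by simp
  qed
  have inner: "F t (x t + w) = angle t * hat w ^ 3 * shifted (z + y) (t, w)" for t w
  proof -
    have "(of_real \<delta> * cis t) *s x t = y"
      using \<delta> by (simp add: x_def vector_smult_assoc cis_mult)
    then have "(of_real \<delta> * cis t) *s (x t + w) = y + (of_real \<delta> * cis t) *s w"
      by (simp add: vector_add_ldistrib)
    then show ?thesis by (simp add: F_def shifted_def add.assoc)
  qed
  have "mollify (z + y) = (\<integral>p. of_real (angle (fst p) * shifted (z + y) p) * (hat (snd p) ^ 3) \<partial>lborel)"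
    unfolding mollify_def by (simp add: mult_ac)
  also have "\<dots> = (\<integral>t. \<integral>w. F t (x t + w) \<partial>lborel \<partial>lborel)"
    unfolding lborel_fubini(1)[OF intG] inner by (simp add: mult_ac)
  also have "\<dots> = (\<integral>t. \<integral>w. F t w \<partial>lborel \<partial>lborel)"
    using F_meas by (simp add: lborel_integral_translate)
  also have "\<dots> = (\<integral>p. of_real (angle (fst p) * shifted z p) * (hat (snd p - x (fst p)) ^ 3) \<partial>lborel)"
    unfolding lborel_fubini(1)[OF intF] by (simp add: F_def)
  finally show ?thesis by (simp add: x_def)
qed

text \<open>\<open>hat_cube_taylor\<close> integrated against \<open>g\<close>; \<open>h1\<close>
  and \<open>h2\<close> are polynomials because \<open>cdot\<close> is linear in \<open>y\<close>.
  The homogeneity of each term is recorded for later averaging over circles.\<close>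

lemma mollify_taylor:
  obtains h1 h2 Lev D where "cpolynomial h1" "cpolynomial h2"
    "\<And>c y. h1 (c *s y) = c * h1 y" "\<And>c y. h2 (c *s y) = c\<^sup>2 * h2 y"
    "\<And>c y. Lev (c *s y) = (cmod c)\<^sup>2 * Lev y" "0 \<le> D"
    "\<And>y. cmod (h1 y) \<le> D * norm y" "\<And>y. cmod (h2 y) \<le> D * (norm y)\<^sup>2" "\<And>y. \<bar>Lev y\<bar> \<le> D * (norm y)\<^sup>2"
    "\<And>y. norm y \<le> \<delta> \<Longrightarrow> \<bar>mollify (z + y) - (mollify z + Re (h1 y + h2 y) + Lev y)\<bar> \<le> D * norm y ^ 3"
proof -
  define q where "q p = cis (- fst p) / of_real \<delta>" for p :: "real \<times> (complex ^ 'n)"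
  have norm_q: "cmod (q p) = 1 / \<delta>" for p using \<delta> by (simp add: q_def norm_divide)
  have q_cont: "continuous_on UNIV q" unfolding q_def using \<delta> by (intro continuous_intros) auto
  define k1 where "k1 y p = 6 * of_real ((hat (snd p))\<^sup>2) * (q p * cdot y (snd p))" for y p
  define k2 where "k2 y p = 6 * of_real (hat (snd p)) * (q p * cdot y (snd p))\<^sup>2" for y p
  define k3 where "k3 y p = 6 * hat (snd p) * (cmod (q p * cdot y (snd p)))\<^sup>2
      - 3 * (hat (snd p))\<^sup>2 * (norm y / \<delta>)\<^sup>2" for y :: "complex ^ 'n" and p :: "real \<times> (complex ^ 'n)"
  define I where "I k = (\<integral>p. of_real (angle (fst p) * shifted z p) * k p \<partial>lborel)"
    for k :: "real \<times> (complex ^ 'n) \<Rightarrow> complex"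
  define J where "J k = (\<integral>p. of_real (angle (fst p) * shifted z p) * k p \<partial>lborel)"
    for k :: "real \<times> (complex ^ 'n) \<Rightarrow> real"
  have cdot_cont: "continuous_on UNIV (\<lambda>p :: real \<times> (complex ^ 'n). cdot y (snd p))" for y
    unfolding cdot_def by (intro continuous_intros)
  have supp0: "hat (snd p) = 0" if "snd p \<notin> cball 0 2" for p :: "real \<times> (complex ^ 'n)"
    using that by (intro hat_eq_0) simp
  have qc: "cmod (q p * cdot y (snd p)) \<le> 2 * (norm y / \<delta>)" if "p \<in> dom" for p y
  proof -
    have "cmod (cdot y (snd p)) \<le> norm y * 2"
      using cmod_cdot_le[of y "snd p"] that mult_left_mono[of "norm (snd p)" 2 "norm y"]
      by (auto simp: dom_def)
    then show ?thesis using \<delta> by (simp add: norm_mult norm_q divide_simps)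
  qed
  have hat2: "(hat w)\<^sup>2 \<le> 1" "0 \<le> (hat w)\<^sup>2" for w :: "complex ^ 'n"
    by (rule hat_power_bounds)+
  have k1: "continuous_on UNIV (k1 y)" "\<And>p. p \<in> dom \<Longrightarrow> norm (k1 y p) \<le> 12 * (norm y / \<delta>)"
    "\<And>p. snd p \<notin> cball 0 2 \<Longrightarrow> k1 y p = 0" for y
  proof -
    show "continuous_on UNIV (k1 y)" unfolding k1_def
      by (intro continuous_intros q_cont cdot_cont)
    fix p assume "p \<in> dom"
    then have "(6 * (hat (snd p))\<^sup>2) * cmod (q p * cdot y (snd p)) \<le> (6 * 1) * (2 * (norm y / \<delta>))"
      using hat2 \<delta> by (intro mult_mono qc) auto
    then show "norm (k1 y p) \<le> 12 * (norm y / \<delta>)" by (simp add: k1_def norm_mult norm_power)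
  qed (simp add: k1_def supp0)
  have qc2: "(cmod (q p * cdot y (snd p)))\<^sup>2 \<le> 4 * (norm y / \<delta>)\<^sup>2" if "p \<in> dom" for p y
    using power_mono[OF qc[OF that, of y], of 2] by (simp add: power_mult_distrib power_divide)
  have k2: "continuous_on UNIV (k2 y)" "\<And>p. p \<in> dom \<Longrightarrow> norm (k2 y p) \<le> 24 * (norm y / \<delta>)\<^sup>2"
    "\<And>p. snd p \<notin> cball 0 2 \<Longrightarrow> k2 y p = 0" for y
  proof -
    show "continuous_on UNIV (k2 y)" unfolding k2_def
      by (intro continuous_intros q_cont cdot_cont)
    fix p assume "p \<in> dom"
    then have "(6 * hat (snd p)) * (cmod (q p * cdot y (snd p)))\<^sup>2 \<le> (6 * 1) * (4 * (norm y / \<delta>)\<^sup>2)"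
      using hat_bounds[of "snd p"] by (intro mult_mono qc2) auto
    then show "norm (k2 y p) \<le> 24 * (norm y / \<delta>)\<^sup>2"
      using hat_bounds[of "snd p"] by (simp add: k2_def norm_mult norm_power)
  qed (simp add: k2_def supp0)
  have k3: "continuous_on UNIV (k3 y)" "\<And>p. p \<in> dom \<Longrightarrow> norm (k3 y p) \<le> 27 * (norm y / \<delta>)\<^sup>2"
    "\<And>p. snd p \<notin> cball 0 2 \<Longrightarrow> k3 y p = 0" for y
  proof -
    show "continuous_on UNIV (k3 y)" unfolding k3_def
      by (intro continuous_intros q_cont cdot_cont)
    fix p assume "p \<in> dom"
    then have "(6 * hat (snd p)) * (cmod (q p * cdot y (snd p)))\<^sup>2 \<le> (6 * 1) * (4 * (norm y / \<delta>)\<^sup>2)"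
      using hat_bounds[of "snd p"] by (intro mult_mono qc2) auto
    moreover have "0 \<le> 6 * hat (snd p) * (cmod (q p * cdot y (snd p)))\<^sup>2" using hat_bounds[of "snd p"] by simp
    moreover have "(3 * (hat (snd p))\<^sup>2) * (norm y / \<delta>)\<^sup>2 \<le> (3 * 1) * (norm y / \<delta>)\<^sup>2"
      using hat2 by (intro mult_right_mono mult_left_mono) auto
    moreover have "0 \<le> 3 * (hat (snd p))\<^sup>2 * (norm y / \<delta>)\<^sup>2" by simp
    ultimately show "norm (k3 y p) \<le> 27 * (norm y / \<delta>)\<^sup>2"
      unfolding k3_def real_norm_def by linarith
  qed (simp add: k3_def supp0)
  note i1 = integrable_kernel[OF k1, of z] and i2 = integrable_kernel[OF k2, of z]
    and i3 = integrable_kernel[OF k3, of z]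
  define e where "e j = (axis j 1 :: complex ^ 'n)" for j
  have cdot_e: "cdot y w = (\<Sum>j\<in>UNIV. y $ j * cdot (e j) w)" for y w
    by (simp add: cdot_def e_def axis_def if_distrib[of "\<lambda>u. u * _"] cong: if_cong)
  define a where "a j = I (k1 (e j))" for j
  define b where "b i j = I (\<lambda>p. 6 * of_real (hat (snd p)) * (q p * cdot (e i) (snd p)) * (q p * cdot (e j) (snd p)))" for i j
  have bi: "integrable lborel (\<lambda>p. of_real (angle (fst p) * shifted z p) *
     (6 * of_real (hat (snd p)) * (q p * cdot (e i) (snd p)) * (q p * cdot (e j) (snd p))))" for i j
  proof (rule integrable_kernel)
    show "continuous_on UNIV (\<lambda>p. 6 * of_real (hat (snd p)) * (q p * cdot (e i) (snd p)) * (q p * cdot (e j) (snd p)) :: complex)"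
      by (intro continuous_intros q_cont cdot_cont)
    fix p assume "p \<in> dom"
    then have "6 * hat (snd p) * cmod (q p * cdot (e i) (snd p)) * cmod (q p * cdot (e j) (snd p))
       \<le> 6 * 1 * (2 * (norm (e i) / \<delta>)) * (2 * (norm (e j) / \<delta>))"
      using hat_bounds[of "snd p"] \<delta> by (intro mult_mono qc mult_nonneg_nonneg) auto
    then show "norm (6 * of_real (hat (snd p)) * (q p * cdot (e i) (snd p)) * (q p * cdot (e j) (snd p)) :: complex)
       \<le> 6 * 1 * (2 * (norm (e i) / \<delta>)) * (2 * (norm (e j) / \<delta>))"
      using hat_bounds[of "snd p"] by (simp add: norm_mult)
  qed (simp add: supp0)
  have h1: "I (k1 y) = (\<Sum>j\<in>UNIV. a j * y $ j)" for y
  proof -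
    have "of_real (angle (fst p) * shifted z p) * k1 y p
        = (\<Sum>j\<in>UNIV. (of_real (angle (fst p) * shifted z p) * k1 (e j) p) * y $ j)" for p
      unfolding k1_def cdot_e[of y] by (simp add: sum_distrib_left mult_ac)
    then show ?thesis using i1 by (simp add: I_def a_def)
  qed
  have h2: "I (k2 y) = (\<Sum>i\<in>UNIV. \<Sum>j\<in>UNIV. b i j * (y $ i * y $ j))" for y
  proof -
    have "of_real (angle (fst p) * shifted z p) * k2 y p
        = (\<Sum>i\<in>UNIV. \<Sum>j\<in>UNIV. (of_real (angle (fst p) * shifted z p) *
           (6 * of_real (hat (snd p)) * (q p * cdot (e i) (snd p)) * (q p * cdot (e j) (snd p)))) * (y $ i * y $ j))" for p
      unfolding k2_def cdot_e[of y] power2_eq_square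
      by (simp add: sum_distrib_left sum_product mult_ac)
    then show ?thesis using bi by (simp add: I_def b_def)
  qed
  define m where "m = measure lborel dom"
  have m: "0 \<le> m" by (simp add: m_def)
  \<comment> \<open>12, 24 and 27 bound the linear, quadratic and Levi kernels on
    \<open>dom\<close>, and 152 bounds the remainder; 24 is covered by 27.\<close>
  define D where "D = B * m * (12 / \<delta> + 27 / \<delta>\<^sup>2 + 152 / \<delta> ^ 3)"
  have D': "B * m * (12 / \<delta>) \<le> D" "B * m * (27 / \<delta>\<^sup>2) \<le> D" "B * m * (24 / \<delta>\<^sup>2) \<le> D" "B * m * (152 / \<delta> ^ 3) \<le> D"
  proof -
    have "0 \<le> 12 / \<delta>" "0 \<le> 27 / \<delta>\<^sup>2" "0 \<le> 152 / \<delta> ^ 3" "24 / \<delta>\<^sup>2 \<le> 27 / \<delta>\<^sup>2"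
      using \<delta> by (auto simp: divide_right_mono)
    moreover have "0 \<le> B * m" using B_nonneg m by simp
    ultimately show "B * m * (12 / \<delta>) \<le> D" "B * m * (27 / \<delta>\<^sup>2) \<le> D"
      "B * m * (24 / \<delta>\<^sup>2) \<le> D" "B * m * (152 / \<delta> ^ 3) \<le> D"
      unfolding D_def by (intro mult_left_mono; linarith)+
  qed
  show thesis
  proof (rule that[of "\<lambda>y. I (k1 y)" "\<lambda>y. I (k2 y)" "\<lambda>y. J (k3 y)" D])
    show "cpolynomial (\<lambda>y. I (k1 y))" unfolding h1
      by (intro cpolynomial_sum cpolynomial.intros)
    show "cpolynomial (\<lambda>y. I (k2 y))" unfolding h2
      by (intro cpolynomial_sum cpolynomial.intros)
    show "I (k1 (c *s y)) = c * I (k1 y)" for c y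
      unfolding h1 by (simp add: sum_distrib_left mult_ac)
    show "I (k2 (c *s y)) = c\<^sup>2 * I (k2 y)" for c y
      unfolding h2 by (simp add: sum_distrib_left power2_eq_square mult_ac)
    show "J (k3 (c *s y)) = (cmod c)\<^sup>2 * J (k3 y)" for c y
    proof -
      have "k3 (c *s y) p = (cmod c)\<^sup>2 * k3 y p" for p
        by (simp add: k3_def cdot_smult norm_mult norm_vector_smult power_mult_distrib power_divide algebra_simps)
      then show ?thesis unfolding J_def
        by (simp add: mult.left_commute[of _ "(cmod c)\<^sup>2"])
    qed
    show "0 \<le> D" unfolding D_def using \<delta> B_nonneg m by simp
    have le: "B * (c * x) * m \<le> D * x" if "B * m * c \<le> D" "0 \<le> x" for c x
      using mult_right_mono[OF that] by (simp add: mult_ac)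
    show "cmod (I (k1 y)) \<le> D * norm y" for y
      using i1(2)[of y] le[OF D'(1), of "norm y"] unfolding I_def m_def[symmetric] by simp
    show "cmod (I (k2 y)) \<le> D * (norm y)\<^sup>2" for y
      using i2(2)[of y] le[OF D'(3), of "(norm y)\<^sup>2"] unfolding I_def m_def[symmetric] by (simp add: power_divide)
    show "\<bar>J (k3 y)\<bar> \<le> D * (norm y)\<^sup>2" for y
      using i3(2)[of y] le[OF D'(2), of "(norm y)\<^sup>2"] unfolding J_def m_def[symmetric] by (simp add: power_divide)
    fix y :: "complex ^ 'n" assume y: "norm y \<le> \<delta>"
    define x where "x p = q p *s y" for p
    have nx: "norm (x p) = norm y / \<delta>" for p by (simp add: x_def norm_vector_smult norm_q)
    have x1: "norm (x p) \<le> 1" for p using y \<delta> by (simp add: nx)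
    define R where "R p = hat (snd p - x p) ^ 3 - (hat (snd p) ^ 3 + Re (k1 y p + k2 y p) + k3 y p)" for p
    have Rb: "\<bar>R p\<bar> \<le> 152 * (norm y / \<delta>) ^ 3 * indicator (cball 0 2) (snd p)" for p
      using hat_cube_taylor[OF x1[of p], of "snd p"]
      by (simp add: R_def k1_def k2_def k3_def nx cdot_smult x_def[of p, symmetric])
        (simp add: x_def cdot_smult)
    have ih: "integrable lborel (\<lambda>p. of_real (angle (fst p) * shifted z p) * (hat (snd p) ^ 3))"
    proof (rule integrable_kernel)
      show "continuous_on UNIV (\<lambda>p :: real \<times> (complex ^ 'n). hat (snd p) ^ 3)" by (intro continuous_intros)
      show "norm (hat (snd p) ^ 3) \<le> 1" for p :: "real \<times> (complex ^ 'n)"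
        by (rule hat_power_bounds)
    qed (simp add: supp0)
    have Rcont: "continuous_on UNIV R" unfolding R_def x_def
      by (intro continuous_intros q_cont k1 k2 k3)
    have R1: "norm (R p) \<le> 152 * (norm y / \<delta>) ^ 3" if "p \<in> dom" for p
      using Rb[of p] that by (auto simp: dom_def)
    have R0: "R p = 0" if "snd p \<notin> cball 0 2" for p using Rb[of p] that by simp
    note iR = integrable_kernel[OF Rcont R1 R0, of z, folded m_def]
    have Re_I: "Re (I (k1 y) + I (k2 y)) = (\<integral>p. angle (fst p) * shifted z p * Re (k1 y p + k2 y p) \<partial>lborel)"
      and Re_int: "integrable lborel (\<lambda>p. angle (fst p) * shifted z p * Re (k1 y p + k2 y p))"
    proof -
      have "I (k1 y) + I (k2 y) = (\<integral>p. of_real (angle (fst p) * shifted z p) * (k1 y p + k2 y p) \<partial>lborel)"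
        unfolding I_def distrib_left using i1 i2 by simp
      moreover have int: "integrable lborel (\<lambda>p. of_real (angle (fst p) * shifted z p) * (k1 y p + k2 y p))"
        unfolding distrib_left using i1 i2 by simp
      ultimately show "Re (I (k1 y) + I (k2 y)) = (\<integral>p. angle (fst p) * shifted z p * Re (k1 y p + k2 y p) \<partial>lborel)"
        using integral_Re[OF int] by (simp flip: of_real_mult)
      show "integrable lborel (\<lambda>p. angle (fst p) * shifted z p * Re (k1 y p + k2 y p))"
        using integrable_Re[OF int] by (simp flip: of_real_mult)
    qed
    have "mollify (z + y) = (\<integral>p. angle (fst p) * shifted z p * hat (snd p) ^ 3
        + angle (fst p) * shifted z p * Re (k1 y p + k2 y p) + angle (fst p) * shifted z p * k3 y p
        + angle (fst p) * shifted z p * R p \<partial>lborel)"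
      unfolding mollify_shift[OF y] by (intro Bochner_Integration.integral_cong refl)
        (simp add: R_def x_def q_def algebra_simps)
    also have "\<dots> = mollify z + Re (I (k1 y) + I (k2 y)) + J (k3 y)
        + (\<integral>p. of_real (angle (fst p) * shifted z p) * R p \<partial>lborel)"
      unfolding Re_I J_def mollify_def using ih Re_int i3(1) iR(1)
      by (simp add: mult_ac)
    finally show "\<bar>mollify (z + y) - (mollify z + Re (I (k1 y) + I (k2 y)) + J (k3 y))\<bar> \<le> D * norm y ^ 3"
      using iR(2) le[OF D'(4), of "norm y ^ 3"] by (simp add: power_divide)
  qed
qed

lemma continuous_mollify: "continuous_on UNIV mollify"
proof -
  have "isCont mollify z" for z
  proof -
    obtain h1 h2 Lev D where T: "0 \<le> D"
      "\<And>y. cmod (h1 y) \<le> D * norm y" "\<And>y. cmod (h2 y) \<le> D * (norm y)\<^sup>2" "\<And>y. \<bar>Lev y\<bar> \<le> D * (norm y)\<^sup>2"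
      "\<And>y. norm y \<le> \<delta> \<Longrightarrow> \<bar>mollify (z + y) - (mollify z + Re (h1 y + h2 y) + Lev y)\<bar> \<le> D * norm y ^ 3"
      using mollify_taylor[of z] by metis
    define E where "E y = D * norm y + D * (norm y)\<^sup>2 + D * (norm y)\<^sup>2 + D * norm y ^ 3" for y :: "complex ^ 'n"
    have "(E \<longlongrightarrow> E 0) (at 0)" unfolding E_def by (intro tendsto_intros)
    then have E0: "(E \<longlongrightarrow> 0) (at 0)" by (simp add: E_def)
    have ev: "\<forall>\<^sub>F y in at 0. norm (mollify (z + y) - mollify z) \<le> E y"
      unfolding eventually_at
    proof (intro exI[of _ \<delta>] conjI ballI impI)
      fix y :: "complex ^ 'n" assume "y \<noteq> 0 \<and> dist y 0 < \<delta>"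
      then have "norm y \<le> \<delta>" by simp
      from T(5)[OF this] T(2-4)[of y] abs_Re_le_cmod[of "h1 y"] abs_Re_le_cmod[of "h2 y"]
      show "norm (mollify (z + y) - mollify z) \<le> E y"
        unfolding E_def real_norm_def plus_complex.sel by linarith
    qed (use \<delta> in auto)
    have "((\<lambda>y. mollify (z + y) - mollify z) \<longlongrightarrow> 0) (at 0)"
      by (rule Lim_null_comparison[OF ev E0])
    then have "((\<lambda>y. mollify (z + y)) \<longlongrightarrow> mollify z) (at 0)" by (simp add: LIM_zero_iff)
    then show ?thesis using isCont_iff by blast
  qed
  then show ?thesis by (simp add: continuous_at_imp_continuous_on)
qed

section \<open>Total weight and submean value inequalities\<close>

definition mass :: real where
  "mass = (\<integral>p. angle (fst p) * hat (snd p :: complex ^ 'n) ^ 3 \<partial>lborel)"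

lemma integrable_hat_kernel:
  "integrable lborel (\<lambda>p. angle (fst p) * hat (snd p :: complex ^ 'n) ^ 3)"
  "integrable lborel (\<lambda>p. angle (fst p) * hat (snd p) ^ 3 * shifted z p)"
proof -
  have m: "(\<lambda>p. hat (snd p :: complex ^ 'n) ^ 3) \<in> borel_measurable borel"
    by (intro borel_measurable_continuous_onI continuous_intros)
  have b: "norm (angle (fst p) * hat (snd p) ^ 3) \<le> 1 * indicator dom p" for p :: "real \<times> (complex ^ 'n)"
  proof (cases "p \<in> dom")
    case True
    then show ?thesis using hat_power_bounds[of "snd p" 3] by (auto simp: dom_def angle_def)
  next
    case False
    then have "angle (fst p) = 0 \<or> hat (snd p) = 0"
      by (cases p) (auto simp: dom_def angle_def intro!: hat_eq_0)
    then show ?thesis by (auto simp: indicator_def)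
  qed
  note m' = borel_measurable_times[OF angle_measurable m]
  show "integrable lborel (\<lambda>p. angle (fst p) * hat (snd p :: complex ^ 'n) ^ 3)"
    by (rule integrable_bounded_compact_support(1)[OF m' compact_dom b])
  have "norm (angle (fst p) * hat (snd p) ^ 3 * shifted z p) \<le> B * indicator dom p" for p
  proof -
    have "norm (angle (fst p) * hat (snd p) ^ 3) * \<bar>shifted z p\<bar> \<le> (1 * indicator dom p) * B"
      using b[of p] bdd B_nonneg by (intro mult_mono) (auto simp: shifted_def)
    then show ?thesis by (simp add: abs_mult mult.commute)
  qed
  then show "integrable lborel (\<lambda>p. angle (fst p) * hat (snd p) ^ 3 * shifted z p)"
    by (rule integrable_bounded_compact_support(1)[OF borel_measurable_times[OF m' shifted_measurable] compact_dom])
qed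

lemma integral_angle: "(\<integral>t. angle t \<partial>lborel) = 2 * pi" and integrable_angle: "integrable lborel angle"
  by (auto simp: angle_def)

lemma mass_pos: "0 < mass"
proof -
  have eq: "mass = (\<integral>w. 2 * pi * hat (w :: complex ^ 'n) ^ 3 \<partial>lborel)"
    unfolding mass_def lborel_fubini(2)[OF integrable_hat_kernel(1)]
    by (simp add: integral_angle mult.commute)
  have int: "integrable lborel (\<lambda>w. 2 * pi * hat (w :: complex ^ 'n) ^ 3)"
    using lborel_fubini(4)[OF integrable_hat_kernel(1)] by (simp add: integral_angle mult.commute)
  define b where "b = ball (0 :: complex ^ 'n) (1/2)"
  have b: "b \<in> sets lborel" "emeasure lborel b < \<infinity>"
    using emeasure_bounded_finite[OF bounded_ball] by (auto simp: b_def less_top)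
  have "0 < 2 * pi * (3/4) ^ 3 * measure lborel b" using content_ball_pos[of "1/2"] by (simp add: b_def)
  also have "\<dots> = (\<integral>w. 2 * pi * (3/4) ^ 3 * indicator b w \<partial>lborel)" using b by simp
  also have "\<dots> \<le> mass" unfolding eq
  proof (rule integral_mono)
    show "integrable lborel (\<lambda>w. 2 * pi * (3/4) ^ 3 * indicator b w :: real)" using b by auto
    show "2 * pi * (3/4) ^ 3 * indicator b w \<le> 2 * pi * hat w ^ 3" for w
    proof (cases "w \<in> b")
      case True
      then have "(norm w)\<^sup>2 \<le> (1/2)\<^sup>2" by (intro power_mono) (auto simp: b_def)
      then have "(3/4) ^ 3 \<le> hat w ^ 3" by (intro power_mono) (auto simp: hat_def power_divide)
      then show ?thesis using True by simp
    next
      case False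
      have "0 \<le> 2 * pi * hat w ^ 3" by (intro mult_nonneg_nonneg hat_power_bounds) auto
      then show ?thesis using False by simp
    qed
  qed (fact int)
  finally show ?thesis .
qed

lemma hat_support: "hat w \<noteq> 0 \<Longrightarrow> norm ((of_real \<delta> * cis t) *s w) \<le> \<delta>"
  using hat_eq_0[of w] \<delta> by (cases "1 \<le> norm w") (simp_all add: norm_vector_smult norm_mult mult_left_le)

lemma mollify_le:
  assumes "\<And>w. norm (w - z) \<le> \<delta> \<Longrightarrow> g w \<le> m"
  shows "mollify z \<le> mass * m"
proof -
  have "mollify z \<le> (\<integral>p. angle (fst p) * hat (snd p :: complex ^ 'n) ^ 3 * m \<partial>lborel)"
    unfolding mollify_def
  proof (rule integral_mono)
    show "angle (fst p) * hat (snd p) ^ 3 * shifted z p \<le> angle (fst p) * hat (snd p) ^ 3 * m" for p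
    proof (cases "hat (snd p) = 0")
      case False
      then have "shifted z p \<le> m"
        unfolding shifted_def using hat_support[of "snd p" "fst p"] by (intro assms) simp
      then show ?thesis using angle_bounds hat_power_bounds(1) by (intro mult_left_mono mult_nonneg_nonneg)
    qed simp
  qed (use integrable_hat_kernel in auto)
  then show ?thesis using integrable_hat_kernel by (simp add: mass_def)
qed

text \<open>For fixed \<open>w\<close> the variable \<open>t\<close> runs along the circle with
  radius vector \<open>of_real \<delta> *s w\<close>, to which the submean value property
  applies.\<close>

lemma mollify_ge:
  assumes sub: "\<And>b. norm b \<le> \<delta> \<Longrightarrow> 2 * pi * g z \<le> (\<integral>s. angle s * g (z + cis s *s b) \<partial>lborel)"
  shows "mass * g z \<le> mollify z"
proof -
  have i: "integrable lborel (\<lambda>p. angle (fst p) * hat (snd p :: complex ^ 'n) ^ 3 * g z)"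
    using integrable_hat_kernel by auto
  have "mass * g z = (\<integral>p. angle (fst p) * hat (snd p :: complex ^ 'n) ^ 3 * g z \<partial>lborel)"
    using integrable_hat_kernel by (simp add: mass_def)
  also have "\<dots> = (\<integral>w. \<integral>t. angle t * hat (w :: complex ^ 'n) ^ 3 * g z \<partial>lborel \<partial>lborel)"
    using lborel_fubini(2)[OF i] by simp
  also have "\<dots> \<le> (\<integral>w. \<integral>t. angle t * hat w ^ 3 * shifted z (t, w) \<partial>lborel \<partial>lborel)"
  proof (rule integral_mono)
    show "integrable lborel (\<lambda>w :: complex ^ 'n. \<integral>t. angle t * hat w ^ 3 * g z \<partial>lborel)"
      using lborel_fubini(4)[OF i] by simp
    show "integrable lborel (\<lambda>w. \<integral>t. angle t * hat w ^ 3 * shifted z (t, w) \<partial>lborel)"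
      using lborel_fubini(4)[OF integrable_hat_kernel(2)] by simp
    fix w :: "complex ^ 'n"
    show "(\<integral>t. angle t * hat w ^ 3 * g z \<partial>lborel) \<le> (\<integral>t. angle t * hat w ^ 3 * shifted z (t, w) \<partial>lborel)"
    proof (cases "hat w = 0")
      case False
      have "norm (of_real \<delta> *s w) \<le> \<delta>" using hat_support[OF False, of 0] by simp
      from sub[OF this] have 1: "2 * pi * g z \<le> (\<integral>t. angle t * shifted z (t, w) \<partial>lborel)"
        by (simp add: shifted_def vector_smult_assoc mult.commute)
      have "hat w ^ 3 * (2 * pi * g z) \<le> hat w ^ 3 * (\<integral>t. angle t * shifted z (t, w) \<partial>lborel)"
        using 1 hat_power_bounds by (intro mult_left_mono)
      also have "\<dots> = (\<integral>t. hat w ^ 3 * (angle t * shifted z (t, w)) \<partial>lborel)" by simp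
      finally show ?thesis using integrable_angle integral_angle
        by (simp add: mult_ac)
    qed simp
  qed
  also have "\<dots> = mollify z"
    unfolding mollify_def lborel_fubini(2)[OF integrable_hat_kernel(2)] by simp
  finally show ?thesis .
qed

text \<open>The two averages commute by Fubini, and the property of \<open>g\<close> is used at all
  points that the kernel reaches from \<open>z\<close>.\<close>

lemma mollify_submean:
  assumes sub: "\<And>w. norm (w - z) \<le> \<delta> \<Longrightarrow> 2 * pi * g w \<le> (\<integral>s. angle s * g (w + cis s *s b) \<partial>lborel)"
  shows "2 * pi * mollify z \<le> (\<integral>s. angle s * mollify (z + cis s *s b) \<partial>lborel)"
    and "integrable lborel (\<lambda>s. angle s * mollify (z + cis s *s b))"
proof -
  define F where "F q = angle (fst q) * (angle (fst (snd q)) * hat (snd (snd q)) ^ 3 * shifted (z + cis (fst q) *s b) (snd q))"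
    for q :: "real \<times> (real \<times> (complex ^ 'n))"
  have "compact ({0..2*pi} \<times> dom)" by (intro compact_Times compact_dom) auto
  moreover have "F \<in> borel_measurable borel"
  proof -
    have [measurable]: "(\<lambda>q :: real \<times> (real \<times> (complex ^ 'n)). shifted (z + cis (fst q) *s b) (snd q)) \<in> borel_measurable borel"
      unfolding shifted_def
      by (rule measurable_compose[OF borel_measurable_continuous_onI meas]) (intro continuous_intros)
    have [measurable]: "angle \<in> borel_measurable borel" by (simp add: angle_def)
    have [measurable]: "(\<lambda>q :: real \<times> (real \<times> (complex ^ 'n)). fst q) \<in> borel_measurable borel"
      "(\<lambda>q :: real \<times> (real \<times> (complex ^ 'n)). fst (snd q)) \<in> borel_measurable borel"
      "(\<lambda>q :: real \<times> (real \<times> (complex ^ 'n)). hat (snd (snd q)) ^ 3) \<in> borel_measurable borel"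
      by (intro borel_measurable_continuous_onI continuous_intros)+
    show ?thesis unfolding F_def by measurable
  qed
  moreover have "norm (F q) \<le> B * indicator ({0..2*pi} \<times> dom) q" for q
  proof (cases "q \<in> {0..2*pi} \<times> dom")
    case True
    then have "\<bar>F q\<bar> = hat (snd (snd q)) ^ 3 * \<bar>shifted (z + cis (fst q) *s b) (snd q)\<bar>"
      by (cases q) (auto simp: F_def dom_def angle_def abs_mult abs_of_nonneg[OF hat_power_bounds(1)])
    also have "\<dots> \<le> 1 * B" using bdd B_nonneg hat_power_bounds
      by (intro mult_mono) (auto simp: shifted_def)
    finally show ?thesis using True by simp
  next
    case False
    then have "angle (fst q) = 0 \<or> angle (fst (snd q)) = 0 \<or> hat (snd (snd q)) = 0"
      by (cases q) (auto simp: dom_def angle_def intro!: hat_eq_0)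
    then show ?thesis using False by (auto simp: F_def)
  qed
  ultimately have int: "integrable lborel F"
    using integrable_bounded_compact_support(1) by blast
  have inner: "(\<integral>p. F (s, p) \<partial>lborel) = angle s * mollify (z + cis s *s b)" for s
    by (simp add: F_def mollify_def)
  show "integrable lborel (\<lambda>s. angle s * mollify (z + cis s *s b))"
    using lborel_fubini(3)[OF int] by (simp add: inner)
  have "2 * pi * mollify z = (\<integral>p. 2 * pi * (angle (fst p) * hat (snd p) ^ 3 * shifted z p) \<partial>lborel)"
    by (simp add: mollify_def)
  also have "\<dots> \<le> (\<integral>p. \<integral>s. F (s, p) \<partial>lborel \<partial>lborel)"
  proof (rule integral_mono)
    show "integrable lborel (\<lambda>p. \<integral>s. F (s, p) \<partial>lborel)" by (rule lborel_fubini(4)[OF int])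
    fix p :: "real \<times> (complex ^ 'n)"
    show "2 * pi * (angle (fst p) * hat (snd p) ^ 3 * shifted z p) \<le> (\<integral>s. F (s, p) \<partial>lborel)"
    proof (cases "hat (snd p) = 0")
      case False
      define v where "v = z + (of_real \<delta> * cis (fst p)) *s snd p"
      have "2 * pi * g v \<le> (\<integral>s. angle s * g (v + cis s *s b) \<partial>lborel)"
        using hat_support[OF False, of "fst p"] by (intro sub) (simp add: v_def)
      then have "angle (fst p) * hat (snd p) ^ 3 * (2 * pi * g v)
          \<le> angle (fst p) * hat (snd p) ^ 3 * (\<integral>s. angle s * g (v + cis s *s b) \<partial>lborel)"
        using angle_bounds hat_power_bounds by (intro mult_left_mono mult_nonneg_nonneg)
      also have "\<dots> = (\<integral>s. angle (fst p) * hat (snd p) ^ 3 * (angle s * g (v + cis s *s b)) \<partial>lborel)"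
        by simp
      also have "\<dots> = (\<integral>s. F (s, p) \<partial>lborel)"
        by (intro Bochner_Integration.integral_cong refl) (simp add: F_def shifted_def v_def algebra_simps)
      finally show ?thesis by (simp add: shifted_def v_def mult_ac)
    qed (simp add: F_def)
  qed (use integrable_hat_kernel in auto)
  also have "\<dots> = (\<integral>s. angle s * mollify (z + cis s *s b) \<partial>lborel)"
    using lborel_fubini(1,2)[OF int] by (simp add: inner)
  finally show "2 * pi * mollify z \<le> (\<integral>s. angle s * mollify (z + cis s *s b) \<partial>lborel)" .
qed

text \<open>Averaging the Taylor expansion over a circle annihilates \<open>h1\<close> and
  \<open>h2\<close>, so the submean value property makes the Levi form nonnegative up to a cubic
  error, which its homogeneity of degree 2 removes. Dropping the Levi form leaves the real part of a
  polynomial as a minorant.\<close>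

lemma mollify_polynomial_minorant:
  assumes sub: "\<And>w b. norm (w - z) \<le> \<delta> \<Longrightarrow> norm b \<le> \<delta> \<Longrightarrow>
    2 * pi * g w \<le> (\<integral>s. angle s * g (w + cis s *s b) \<partial>lborel)"
  obtains h D where "cpolynomial h" "0 \<le> D" "\<And>y. norm y \<le> 1 \<Longrightarrow> cmod (h y) \<le> D * norm y"
    "\<And>y. norm y \<le> \<delta> \<Longrightarrow> mollify z + Re (h y) - D * norm y ^ 3 \<le> mollify (z + y)"
proof -
  obtain h1 h2 Lev D where T: "cpolynomial h1" "cpolynomial h2"
    "\<And>c y. h1 (c *s y) = c * h1 y" "\<And>c y. h2 (c *s y) = c\<^sup>2 * h2 y"
    "\<And>c y. Lev (c *s y) = (cmod c)\<^sup>2 * Lev y" "0 \<le> D"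
    "\<And>y. cmod (h1 y) \<le> D * norm y" "\<And>y. cmod (h2 y) \<le> D * (norm y)\<^sup>2"
    "\<And>y. norm y \<le> \<delta> \<Longrightarrow> \<bar>mollify (z + y) - (mollify z + Re (h1 y + h2 y) + Lev y)\<bar> \<le> D * norm y ^ 3"
    using mollify_taylor[of z] by metis
  have small: "- D * norm b ^ 3 \<le> Lev b" if b: "norm b \<le> \<delta>" for b
  proof -
    define M where "M = mollify z + Lev b + D * norm b ^ 3"
    define A where "A k c s = angle s * Re (cis (of_int k * s) * c)" for k c s
    have int: "integrable lborel (A k c)" for k c
      using borel_integrable_atLeastAtMost'[of 0 "2*pi" "\<lambda>s. Re (cis (of_int k * s) * c)"]
      unfolding set_integrable_def angle_def A_def
      by (simp add: continuous_intros)
    have zero: "(\<integral>s. A k c s \<partial>lborel) = 0" if "k \<noteq> 0" for k c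
      using integral_cis_multiple[OF that, of c] by (simp only: angle_def A_def)
    have le: "angle s * mollify (z + cis s *s b) \<le> angle s * M + A 1 (h1 b) s + A 2 (h2 b) s" for s
    proof -
      have h2: "h2 (cis s *s b) = cis (2 * s) * h2 b"
        using T(4)[of "cis s" b] Complex.DeMoivre[of s 2] by simp
      have "norm (cis s *s b) = norm b" by (simp add: norm_vector_smult)
      then have "mollify (z + cis s *s b) \<le> M + Re (cis s * h1 b) + Re (cis (2 * s) * h2 b)"
        using T(9)[of "cis s *s b"] b T(3)[of "cis s" b] T(5)[of "cis s" b] h2
        by (simp add: M_def del: times_complex.sel)
      from mult_left_mono[OF this angle_bounds(1)[of s]] show ?thesis
        by (simp add: distrib_left A_def)
    qed
    have "2 * pi * mollify z \<le> (\<integral>s. angle s * mollify (z + cis s *s b) \<partial>lborel)"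
      using mollify_submean(1)[OF sub[OF _ b]] .
    also have "\<dots> \<le> (\<integral>s. angle s * M + A 1 (h1 b) s + A 2 (h2 b) s \<partial>lborel)"
      using mollify_submean(2)[OF sub[OF _ b]] int integrable_angle by (intro integral_mono le) auto
    also have "\<dots> = 2 * pi * M"
      using int integrable_angle integral_angle zero by simp
    finally have "mollify z \<le> M" by simp
    then show ?thesis by (simp add: M_def)
  qed
  have Lev: "0 \<le> Lev y" for y
  proof (rule field_le_epsilon)
    fix e :: real assume e: "0 < e"
    \<comment> \<open>Scaling \<open>y\<close> by \<open>r\<close> brings it within reach of
      \<open>small\<close>; after division by \<open>r ^ 2\<close> the cubic error is
      \<open>D * r * norm y ^ 3\<close>, at most \<open>e\<close>.\<close>
    define r where "r = min (\<delta> / (norm y + 1)) (e / (D * norm y ^ 3 + 1))"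
    have pos: "0 < norm y + 1" "0 < D * norm y ^ 3 + 1" using T(6) by (auto intro: add_nonneg_pos)
    then have r: "0 < r" "r \<le> \<delta> / (norm y + 1)" "r \<le> e / (D * norm y ^ 3 + 1)"
      using e \<delta> by (auto simp: r_def)
    then have r': "r * (norm y + 1) \<le> \<delta>" "r * (D * norm y ^ 3 + 1) \<le> e"
      using pos by (simp_all add: pos_le_divide_eq)
    have "norm (of_real r *s y) \<le> \<delta>"
      using r' r(1) by (simp add: norm_vector_smult algebra_simps)
    from small[OF this] have "- (r\<^sup>2 * (D * r * norm y ^ 3)) \<le> r\<^sup>2 * Lev y"
      using r(1) T(5)[of "of_real r" y]
      by (simp add: norm_vector_smult power_mult_distrib power2_eq_square power3_eq_cube mult_ac)
    then have "r\<^sup>2 * (- (D * r * norm y ^ 3)) \<le> r\<^sup>2 * Lev y" by simp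
    then have "- (D * r * norm y ^ 3) \<le> Lev y"
      using r(1) by (simp only: mult_le_cancel_left_pos zero_less_power)
    then show "0 \<le> Lev y + e" using r' r(1) by (simp add: algebra_simps)
  qed
  show thesis
  proof (rule that[of "\<lambda>y. h1 y + h2 y" "2 * D"])
    show "cpolynomial (\<lambda>y. h1 y + h2 y)" by (intro cpolynomial.add T)
    show "0 \<le> 2 * D" using T by simp
    show "cmod (h1 y + h2 y) \<le> 2 * D * norm y" if "norm y \<le> 1" for y
    proof -
      have "D * (norm y)\<^sup>2 \<le> D * norm y"
        using that T(6) by (intro mult_left_mono) (auto simp: power2_eq_square mult_left_le)
      then show ?thesis using norm_triangle_ineq[of "h1 y" "h2 y"] T(7,8)[of y] by linarith
    qed
    show "mollify z + Re (h1 y + h2 y) - 2 * D * norm y ^ 3 \<le> mollify (z + y)" if "norm y \<le> \<delta>" for y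
    proof -
      have "0 \<le> D * norm y ^ 3" using T(6) by simp
      then show ?thesis using T(9)[OF that] Lev[of y] by linarith
    qed
  qed
qed

end

section \<open>The maximum principle\<close>

text \<open>If the supremum were not attained, the open sets where \<open>u z < u q\<close> with
  \<open>q \<in> D\<close> would cover \<open>D\<close>; a point \<open>q\<close> with the largest
  value \<open>u q\<close> in a finite subcover lies in none of its sets.\<close>

lemma usc_attains_sup:
  fixes u :: "'a::topological_space \<Rightarrow> 'b::linorder"
  assumes D: "compact D" "D \<noteq> {}" "D \<subseteq> V" and usc: "\<And>c. open {z \<in> V. u z < c}"
  shows "\<exists>q\<in>D. \<forall>z\<in>D. u z \<le> u q"
proof (rule ccontr)
  assume "\<not> ?thesis"
  then have "D \<subseteq> (\<Union>q\<in>D. {z \<in> V. u z < u q})" using D(3) by (force simp: not_le)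
  then obtain E where E: "E \<subseteq> D" "finite E" "D \<subseteq> (\<Union>q\<in>E. {z \<in> V. u z < u q})"
    using compactE_image[OF D(1), of D "\<lambda>q. {z \<in> V. u z < u q}"] usc by metis
  have "E \<noteq> {}" using E D(2) by auto
  then have "Max (u ` E) \<in> u ` E" using E(2) by (intro Max_in) auto
  then obtain q where q: "q \<in> E" "u q = Max (u ` E)" by auto
  then obtain q' where "q' \<in> E" "u q < u q'" using E by blast
  then show False using q E(2) by (metis Max_ge finite_imageI imageI leD)
qed

section \<open>Circle means and truncation from below\<close>

lemma enn2ereal_mono: "x \<le> y \<Longrightarrow> enn2ereal x \<le> enn2ereal y"
  by (simp add: less_eq_ennreal.rep_eq)

lemma circle_mean_mono:
  assumes "\<And>t. t \<in> {0..2*pi} \<Longrightarrow> u (a + cis t *s b) \<le> v (a + cis t *s b)"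
  shows "circle_mean u a b \<le> circle_mean v a b"
  unfolding circle_mean_def
proof (intro ereal_divide_right_mono ereal_minus_mono)
  show "enn2ereal (\<integral>\<^sup>+t\<in>{0..2*pi}. e2ennreal (u (a + cis t *s b)) \<partial>lborel)
      \<le> enn2ereal (\<integral>\<^sup>+t\<in>{0..2*pi}. e2ennreal (v (a + cis t *s b)) \<partial>lborel)"
    using assms by (intro enn2ereal_mono nn_integral_mono) (auto simp: indicator_def intro!: e2ennreal_mono)
  show "enn2ereal (\<integral>\<^sup>+t\<in>{0..2*pi}. e2ennreal (- v (a + cis t *s b)) \<partial>lborel)
      \<le> enn2ereal (\<integral>\<^sup>+t\<in>{0..2*pi}. e2ennreal (- u (a + cis t *s b)) \<partial>lborel)"
    using assms by (intro enn2ereal_mono nn_integral_mono) (auto simp: indicator_def intro!: e2ennreal_mono)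
qed simp

lemma integrable_circle:
  fixes g :: "complex ^ 'n \<Rightarrow> real"
  assumes "g \<in> borel_measurable borel" "\<And>z. \<bar>g z\<bar> \<le> B"
  shows "integrable lborel (\<lambda>t. indicator {0..2*pi} t * g (a + cis t *s b))"
proof (rule integrable_bounded_compact_support(1))
  have "(\<lambda>t. g (a + cis t *s b)) \<in> borel_measurable borel"
    by (rule measurable_compose[OF borel_measurable_continuous_onI assms(1)]) (intro continuous_intros)
  then show "(\<lambda>t. indicator {0..2*pi} t * g (a + cis t *s b)) \<in> borel_measurable borel" by simp
  show "norm (indicator {0..2*pi} t * g (a + cis t *s b)) \<le> B * indicator {0..2*pi} t" for t
    using assms(2) by (auto simp: indicator_def)
qed simp

lemma circle_mean_real:
  fixes g :: "complex ^ 'n \<Rightarrow> real"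
  assumes "g \<in> borel_measurable borel" "\<And>z. \<bar>g z\<bar> \<le> B"
  shows "circle_mean (\<lambda>z. ereal (g z)) a b =
    ereal ((\<integral>t. indicator {0..2*pi} t * g (a + cis t *s b) \<partial>lborel) / (2 * pi))"
proof -
  define F where "F t = indicator {0..2*pi} t * g (a + cis t *s b)" for t
  have F: "integrable lborel F" unfolding F_def by (rule integrable_circle[OF assms])
  have 1: "(\<integral>\<^sup>+t\<in>{0..2*pi}. e2ennreal (ereal (g (a + cis t *s b))) \<partial>lborel) = (\<integral>\<^sup>+t. ennreal (F t) \<partial>lborel)"
    by (intro nn_integral_cong) (auto simp: F_def indicator_def)
  have 2: "(\<integral>\<^sup>+t\<in>{0..2*pi}. e2ennreal (- ereal (g (a + cis t *s b))) \<partial>lborel) = (\<integral>\<^sup>+t. ennreal (- F t) \<partial>lborel)"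
    by (intro nn_integral_cong) (auto simp: F_def indicator_def)
  have fin: "(\<integral>\<^sup>+t. ennreal (F t) \<partial>lborel) \<noteq> \<infinity>" "(\<integral>\<^sup>+t. ennreal (- F t) \<partial>lborel) \<noteq> \<infinity>"
    using F unfolding real_integrable_def by auto
  have e: "enn2ereal x = ereal (enn2real x)" if "x \<noteq> \<infinity>" for x
    using that by (cases x) auto
  have "circle_mean (\<lambda>z. ereal (g z)) a b = ereal ((\<integral>t. F t \<partial>lborel) / (2 * pi))"
    unfolding circle_mean_def 1 2 real_lebesgue_integral_def[OF F] using fin by (simp add: e)
  then show ?thesis by (simp add: F_def)
qed

text \<open>Truncation yields the bounded real function that mollification requires. Its circle
  means dominate those of \<open>u\<close> as well as the constant \<open>c\<close>, hence the
  submean value property persists.\<close>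

lemma psh_on_open_truncation:
  fixes u :: "complex ^ 'n \<Rightarrow> ereal"
  assumes u: "psh_on_open V u" and C: "compact C" "C \<subseteq> V"
  obtains g B where "g \<in> borel_measurable borel" "\<And>z. \<bar>g z\<bar> \<le> B"
    "\<And>z. z \<in> C \<Longrightarrow> ereal (g z) = max (u z) (ereal c)"
    "\<And>a b. (\<And>\<zeta>. cmod \<zeta> \<le> 1 \<Longrightarrow> a + \<zeta> *s b \<in> C) \<Longrightarrow>
       2 * pi * g a \<le> (\<integral>t. indicator {0..2*pi} t * g (a + cis t *s b) \<partial>lborel)"
proof -
  have V: "open V" "\<And>z. z \<in> V \<Longrightarrow> u z < \<infinity>" "\<And>c. open {z \<in> V. u z < c}"
    "\<And>a b. (\<And>\<zeta>. cmod \<zeta> \<le> 1 \<Longrightarrow> a + \<zeta> *s b \<in> V) \<Longrightarrow> u a \<le> circle_mean u a b"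
    using u unfolding psh_on_open_def by blast+
  \<comment> \<open>On \<open>C\<close> the maximum is finite, since
    \<open>u z < \<infinity>\<close> on \<open>V\<close> and the truncation excludes
    \<open>-\<infinity>\<close>. The value 0 off \<open>C\<close> makes \<open>g\<close> a bounded
    Borel function on the whole space.\<close>
  define g where "g z = (if z \<in> C then real_of_ereal (max (u z) (ereal c)) else 0)" for z
  have g: "ereal (g z) = max (u z) (ereal c)" if "z \<in> C" for z
    using V(2)[of z] C that by (cases "u z") (auto simp: g_def max_def)
  have meas: "g \<in> borel_measurable borel"
    unfolding borel_measurable_iff_less
  proof
    fix t
    have "{z \<in> space borel. g z < t} = ({z \<in> V. max (u z) (ereal c) < ereal t} \<inter> C) \<union> (if 0 < t then - C else {})"
      using g C(2) by (auto simp: g_def[of "_"] simp flip: less_ereal.simps(1) split: if_splits)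
    also have "{z \<in> V. max (u z) (ereal c) < ereal t} = (if c < t then {z \<in> V. u z < ereal t} else {})" by auto
    also have "(\<dots> \<inter> C) \<union> (if 0 < t then - C else {}) \<in> sets borel"
    proof -
      have "C \<in> sets borel" "{z \<in> V. u z < ereal t} \<in> sets borel"
        using V(3) C(1) by (auto intro: borel_open borel_compact)
      then show ?thesis by (simp add: borel_comp)
    qed
    finally show "{z \<in> space borel. g z < t} \<in> sets borel" .
  qed
  have "\<exists>B. \<forall>z. \<bar>g z\<bar> \<le> B"
  proof (cases "C = {}")
    case False
    then obtain q where q: "q \<in> C" "\<And>z. z \<in> C \<Longrightarrow> u z \<le> u q"
      using usc_attains_sup[OF C(1) False C(2) V(3)] by blast
    have "\<bar>g z\<bar> \<le> max \<bar>g q\<bar> \<bar>c\<bar>" for z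
    proof (cases "z \<in> C")
      case True
      have "ereal (g z) \<le> ereal (g q)" unfolding g[OF True] g[OF q(1)] using q(2)[OF True] by (rule max.mono) simp
      moreover have "ereal c \<le> ereal (g z)" unfolding g[OF True] by simp
      ultimately show ?thesis by auto
    qed (simp add: g_def)
    then show ?thesis by blast
  qed (auto simp: g_def)
  then obtain B where B: "\<And>z. \<bar>g z\<bar> \<le> B" by blast
  have sub: "2 * pi * g a \<le> (\<integral>t. indicator {0..2*pi} t * g (a + cis t *s b) \<partial>lborel)"
    if disc: "\<And>\<zeta>. cmod \<zeta> \<le> 1 \<Longrightarrow> a + \<zeta> *s b \<in> C" for a b
  proof -
    define I where "I = (\<integral>t. indicator {0..2*pi} t * g (a + cis t *s b) \<partial>lborel)"
    have a: "a \<in> C" using disc[of 0] by simp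
    have circ: "a + cis t *s b \<in> C" for t using disc[of "cis t"] by simp
    have "u a \<le> circle_mean u a b" using disc C(2) by (intro V(4)) blast
    also have "\<dots> \<le> circle_mean (\<lambda>z. ereal (g z)) a b"
      using g[OF circ] by (intro circle_mean_mono) simp
    also have "\<dots> = ereal (I / (2 * pi))" unfolding I_def by (rule circle_mean_real[OF meas B])
    finally have 1: "u a \<le> ereal (I / (2 * pi))" .
    have c_le: "c \<le> g z" if "z \<in> C" for z
    proof -
      have "ereal c \<le> ereal (g z)" unfolding g[OF that] by simp
      then show ?thesis by simp
    qed
    have "c * (2 * pi) = (\<integral>t. indicator {0..2*pi} t * c \<partial>lborel)" by simp
    also have "\<dots> \<le> I" unfolding I_def
    proof (rule integral_mono)
      show "integrable lborel (\<lambda>t. indicator {0..2*pi} t * c :: real)" by auto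
      show "indicator {0..2*pi} t * c \<le> indicator {0..2*pi} t * g (a + cis t *s b)" for t
        using c_le[OF circ[of t]] by (auto simp: indicator_def)
    qed (rule integrable_circle[OF meas B])
    finally have "ereal c \<le> ereal (I / (2 * pi))" by (simp add: pos_le_divide_eq)
    with 1 have "ereal (g a) \<le> ereal (I / (2 * pi))" unfolding g[OF a] by simp
    then show ?thesis by (simp add: pos_le_divide_eq I_def mult.commute)
  qed
  show thesis by (rule that[OF meas B g sub])
qed

lemma cpolynomial_translate: "cpolynomial P \<Longrightarrow> cpolynomial (\<lambda>z. P (z - a))"
proof (induction rule: cpolynomial.induct)
  case (coord i)
  then show ?case using cpolynomial_diff[OF cpolynomial.coord cpolynomial.const] by simp
qed (auto intro: cpolynomial.intros)

lemma cpolynomial_cdot: "cpolynomial (\<lambda>y. cdot y w)"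
  unfolding cdot_def by (intro cpolynomial_sum cpolynomial.intros)

text \<open>The polynomial \<open>1 + \<kappa> * h\<close> peaks at the centre. Its squared modulus
  is \<open>1 + \<kappa> * (2 * Re (h y) + \<kappa> * (cmod (h y))\<^sup>2)\<close>, and by the
  linear bound on \<open>h\<close> the last term loses against \<open>Re (h y)\<close> for small
  \<open>\<kappa>\<close>.\<close>

lemma no_strict_local_maximum:
  fixes K :: "(complex ^ 'n) set"
  assumes K: "compact K" and z: "z \<in> rational_hull K" and r: "0 < r" "cball z r \<inter> K = {}"
    and h: "cpolynomial h" and E: "\<And>y. norm y \<le> r \<Longrightarrow> cmod (h y) \<le> E * norm y" and m: "0 < m"
    and le: "\<And>y. norm y \<le> r \<Longrightarrow> z + y \<in> rational_hull K \<Longrightarrow> Re (h y) \<le> - m * (norm y)\<^sup>2"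
  shows False
proof -
  \<comment> \<open>Ensures \<open>\<kappa> * E\<^sup>2 < m\<close>, also for
    \<open>E = 0\<close>.\<close>
  define \<kappa> where "\<kappa> = m / (E\<^sup>2 + 1)"
  have E1: "0 < E\<^sup>2 + 1" by (simp add: add_nonneg_pos)
  have \<kappa>: "0 < \<kappa>" "\<kappa> * (E\<^sup>2 + 1) = m" using m E1 by (auto simp: \<kappa>_def)
  then have \<kappa>E: "\<kappa> * E\<^sup>2 < m" by (simp add: algebra_simps)
  have h0: "h 0 = 0" using E[of 0] r by simp
  define f where "f x = 1 + of_real \<kappa> * h (x - z)" for x
  have f: "cpolynomial f" "f z = 1"
    unfolding f_def using h by (auto simp: h0 intro!: cpolynomial.intros cpolynomial_translate)
  obtain x where x: "x \<in> rational_hull K" "x \<in> cball z r" "x \<noteq> z" "1 \<le> cmod (f x)"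
    using rational_hull_no_local_peak_point[OF K z r f] by blast
  define y where "y = x - z"
  have y: "norm y \<le> r" "y \<noteq> 0" "z + y \<in> rational_hull K"
    using x by (auto simp: y_def dist_norm norm_minus_commute)
  have "(cmod (f x))\<^sup>2 = 1 + \<kappa> * (2 * Re (h y) + \<kappa> * (cmod (h y))\<^sup>2)"
    unfolding cmod_power2 by (simp add: f_def y_def power2_eq_square algebra_simps)
  moreover have "2 * Re (h y) + \<kappa> * (cmod (h y))\<^sup>2 < 0"
  proof -
    have "(cmod (h y))\<^sup>2 \<le> (E * norm y)\<^sup>2" using E[OF y(1)] by (intro power_mono) auto
    then have "\<kappa> * (cmod (h y))\<^sup>2 \<le> \<kappa> * (E * norm y)\<^sup>2" using \<kappa> by (intro mult_left_mono) auto
    also have "\<dots> = (\<kappa> * E\<^sup>2) * (norm y)\<^sup>2" by (simp add: power_mult_distrib)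
    also have "\<dots> < m * (norm y)\<^sup>2" using \<kappa>E y by (intro mult_strict_right_mono) auto
    finally have "\<kappa> * (cmod (h y))\<^sup>2 < m * (norm y)\<^sup>2" .
    moreover have "0 \<le> m * (norm y)\<^sup>2" using m by simp
    ultimately show ?thesis using le[OF y(1,3)] by linarith
  qed
  ultimately have "(cmod (f x))\<^sup>2 < 1" using \<kappa>(1) by (simp add: mult_pos_neg)
  then show False using x(4) one_le_power[of "cmod (f x)" 2] by linarith
qed

theorem theorem1p6:
  fixes K U :: "(complex ^ 'n) set"
    and \<phi> :: "complex ^ 'n \<Rightarrow> ereal"
    and p :: "complex ^ 'n"
  assumes "compact K"
    and "open U"
    and "U \<inter> K = {}"
    and "plurisubharmonic_on (closure U) \<phi>"
    and "p \<in> U \<inter> rational_hull K"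
  shows "\<exists>q \<in> frontier U \<inter> rational_hull K.
           (\<forall>q' \<in> frontier U \<inter> rational_hull K. \<phi> q' \<le> \<phi> q) \<and> \<phi> p \<le> \<phi> q"
proof -
  define H D L where "H = rational_hull K" and "D = frontier U \<inter> H" and "L = closure U \<inter> H"
  obtain V where V: "closure U \<subseteq> V" "psh_on_open V \<phi>"
    using assms(4) unfolding plurisubharmonic_on_def by blast
  have usc: "open {z \<in> V. \<phi> z < c}" for c using V(2) unfolding psh_on_open_def by blast
  have openV: "open V" using V(2) unfolding psh_on_open_def by blast
  have H: "compact H" unfolding H_def by (rule compact_rational_hull[OF assms(1)])
  have D: "compact D" "D \<subseteq> V" using H V(1) by (auto simp: D_def frontier_def closed_Int_compact)
  have L: "compact L" "L \<subseteq> V" using H V(1) by (auto simp: L_def closed_Int_compact)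
  have pL: "p \<in> L" using assms(5) closure_subset by (auto simp: L_def H_def)
  have DL: "D \<subseteq> L" by (auto simp: D_def L_def frontier_def)
  have max: "\<exists>q\<in>D. \<forall>z\<in>D. \<phi> z \<le> \<phi> q" if "D \<noteq> {}"
    by (rule usc_attains_sup[OF D(1) that D(2) usc])
  have "\<exists>q\<in>D. \<phi> p \<le> \<phi> q"
  proof (rule ccontr)
    assume "\<not> ?thesis"
    then have lt: "\<phi> q < \<phi> p" if "q \<in> D" for q using that by (auto simp: not_le)
    \<comment> \<open>If \<open>D\<close> is empty, any \<open>c\<close> does. That case is refuted
      along with the other one, so the maximum in the conclusion is never over an empty set.\<close>
    have "\<exists>c. (\<forall>q\<in>D. \<phi> q < ereal c) \<and> (D \<noteq> {} \<longrightarrow> ereal c < \<phi> p)"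
    proof (cases "D = {}")
      case False
      then obtain q where q: "q \<in> D" "\<forall>z\<in>D. \<phi> z \<le> \<phi> q" using max by blast
      then show ?thesis using ereal_dense2[OF lt[OF q(1)]] by (meson le_less_trans)
    qed auto
    then obtain c where c: "\<And>q. q \<in> D \<Longrightarrow> \<phi> q < ereal c" "D \<noteq> {} \<Longrightarrow> ereal c < \<phi> p" by blast
    \<comment> \<open>A compact neighbourhood of \<open>L\<close> in \<open>V\<close>, so that all
      means taken near \<open>L\<close> stay in the domain of \<open>\<phi>\<close>.\<close>
    obtain e where e: "0 < e" "(\<Union>x\<in>L. cball x e) \<subseteq> V"
      using compact_subset_open_imp_cball_epsilon_subset[OF L(1) openV L(2)] by blast
    define C where "C = (\<Union>x\<in>L. cball x e)"
    have C: "compact C" "C \<subseteq> V" using compact_minkowski_sum_cball[OF L(1)] e by (auto simp: C_def)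
    obtain g B where g: "g \<in> borel_measurable borel" "\<And>z. \<bar>g z\<bar> \<le> B"
      "\<And>z. z \<in> C \<Longrightarrow> ereal (g z) = max (\<phi> z) (ereal c)"
      "\<And>a b. (\<And>\<zeta>. cmod \<zeta> \<le> 1 \<Longrightarrow> a + \<zeta> *s b \<in> C) \<Longrightarrow>
         2 * pi * g a \<le> (\<integral>t. indicator {0..2*pi} t * g (a + cis t *s b) \<partial>lborel)"
    proof (rule psh_on_open_truncation[OF V(2) C, of c], goal_cases)
      case (1 g B)
      show thesis by (rule 1(1)[OF 1(2) 1(3) 1(4) 1(5)])
    qed
    have LC: "L \<subseteq> C"
    proof
      fix x assume "x \<in> L"
      then show "x \<in> C" unfolding C_def using e(1) by (intro UN_I[of x]) auto
    qed
    have gp: "c < g p" if "D \<noteq> {}"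
    proof -
      have "ereal c < ereal (g p)" using c(2)[OF that] pL LC by (subst g(3)) (auto simp: less_max_iff_disj)
      then show ?thesis by simp
    qed
    \<comment> \<open>Near \<open>D\<close> the truncation equals \<open>c\<close>, so on
      \<open>D\<close> the normalised mollification at scale at most \<open>d\<close> does not
      exceed \<open>c\<close>.\<close>
    have "open {z \<in> V. \<phi> z < ereal c}" "D \<subseteq> {z \<in> V. \<phi> z < ereal c}" using usc D(2) c(1) by auto
    then obtain d where d: "0 < d" "(\<Union>x\<in>D. cball x d) \<subseteq> {z \<in> V. \<phi> z < ereal c}"
      using compact_subset_open_imp_cball_epsilon_subset[OF D(1)] by blast
    \<comment> \<open>Points at distance \<open>\<delta>\<close> from \<open>L\<close>, with discs
      of radius \<open>\<delta>\<close> around them, remain within \<open>e\<close> of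
      \<open>L\<close>.\<close>
    define \<delta> where "\<delta> = min d (e / 2)"
    have del: "0 < \<delta>" "\<delta> \<le> d" "2 * \<delta> \<le> e" using d e by (auto simp: \<delta>_def)
    interpret mollifier g B \<delta> by (unfold_locales) (fact g(1) g(2) del(1))+
    have sub: "2 * pi * g w \<le> (\<integral>s. angle s * g (w + cis s *s b) \<partial>lborel)"
      if "z \<in> L" "norm (w - z) \<le> \<delta>" "norm b \<le> \<delta>" for z w b
      unfolding angle_def
    proof (rule g(4))
      fix \<zeta> :: complex assume \<zeta>: "cmod \<zeta> \<le> 1"
      have "norm (\<zeta> *s b) \<le> 1 * \<delta>"
        unfolding norm_vector_smult using \<zeta> that del by (intro mult_mono) auto
      then have "norm (w - z + \<zeta> *s b) \<le> e" using norm_triangle_ineq[of "w - z" "\<zeta> *s b"] that del by linarith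
      then have "dist z (w + \<zeta> *s b) \<le> e" by (simp add: dist_norm norm_minus_commute algebra_simps)
      then show "w + \<zeta> *s b \<in> C" using that(1) by (auto simp: C_def)
    qed
    obtain R where R: "\<And>z. z \<in> L \<Longrightarrow> norm (z - p) \<le> R"
      using compact_imp_bounded[OF L(1)] unfolding bounded_any_center[of L p] dist_norm
      by (auto simp: norm_minus_commute)
    \<comment> \<open>On \<open>L\<close> the quadratic term of \<open>\<Psi>\<close> must stay
      below the gap \<open>g p - c\<close>; for empty \<open>D\<close> there is no gap to
      respect.\<close>
    define \<epsilon> where "\<epsilon> = (if D = {} then 1 else (g p - c) / (R\<^sup>2 + 1))"
    have R1: "0 < R\<^sup>2 + 1" by (simp add: add_nonneg_pos)
    have \<epsilon>: "0 < \<epsilon>" using gp R1 by (auto simp: \<epsilon>_def)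
    define \<Psi> where "\<Psi> z = mollify z / mass + \<epsilon> * (norm (z - p))\<^sup>2" for z
    have "continuous_on L \<Psi>"
      unfolding \<Psi>_def using mass_pos
      by (intro continuous_intros continuous_on_subset[OF continuous_mollify]) auto
    then obtain z where z: "z \<in> L" "\<And>x. x \<in> L \<Longrightarrow> \<Psi> x \<le> \<Psi> z"
      using continuous_attains_sup[OF L(1), of \<Psi>] pL by blast
    \<comment> \<open>On \<open>D\<close> the function \<open>\<Psi>\<close> is below
      \<open>c + (g p - c)\<close>, whereas \<open>g p \<le> \<Psi> p\<close> because the quadratic
      term vanishes at \<open>p\<close>.\<close>
    have zD: "z \<notin> D"
    proof
      assume zD: "z \<in> D"
      have "mollify z \<le> mass * c"
      proof (rule mollify_le)
        fix w assume w: "norm (w - z) \<le> \<delta>"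
        then have "w \<in> cball z d" using del by (simp add: dist_norm norm_minus_commute)
        then have "\<phi> w < ereal c" using d(2) zD by blast
        moreover have "w \<in> C" using w del z(1) unfolding C_def
          by (intro UN_I[of z]) (auto simp: dist_norm norm_minus_commute)
        ultimately have "ereal (g w) = ereal c" using g(3)[of w] by (simp add: max_absorb2)
        then show "g w \<le> c" by simp
      qed
      then have 1: "mollify z / mass \<le> c" using mass_pos by (simp add: divide_le_eq mult.commute)
      have "\<epsilon> * (norm (z - p))\<^sup>2 \<le> \<epsilon> * R\<^sup>2"
        using R[OF z(1)] \<epsilon> by (intro mult_left_mono power_mono) auto
      also have "\<dots> < g p - c"
      proof -
        have "\<epsilon> * (R\<^sup>2 + 1) = g p - c" using zD R1 by (auto simp: \<epsilon>_def)
        then show ?thesis using \<epsilon> by (simp add: distrib_left)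
      qed
      finally have "\<Psi> z < g p" using 1 by (simp add: \<Psi>_def)
      moreover have "mass * g p \<le> mollify p"
        by (rule mollify_ge) (use sub[OF pL] del(1) in auto)
      then have "g p \<le> \<Psi> p" using mass_pos by (simp add: \<Psi>_def pos_le_divide_eq mult.commute)
      ultimately show False using z(2)[OF pL] by simp
    qed
    then have zU: "z \<in> U" using z(1) assms(2) by (auto simp: D_def L_def frontier_def interior_open)
    have zH: "z \<in> rational_hull K" using z(1) by (simp add: L_def H_def)
    obtain h E where h: "cpolynomial h" "0 \<le> E" "\<And>y. norm y \<le> 1 \<Longrightarrow> cmod (h y) \<le> E * norm y"
      "\<And>y. norm y \<le> \<delta> \<Longrightarrow> mollify z + Re (h y) - E * norm y ^ 3 \<le> mollify (z + y)"
      using mollify_polynomial_minorant[OF sub[OF z(1)]] by blast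
    \<comment> \<open>The polynomial part of \<open>\<Psi>\<close> at \<open>z\<close>. Expanding
      the square of \<open>norm (z + y - p)\<close> yields its second term and leaves
      \<open>\<epsilon> * (norm y)\<^sup>2\<close> as the gain.\<close>
    define h' where "h' y = of_real (1 / mass) * h y + of_real (2 * \<epsilon>) * cdot y (z - p)" for y
    obtain s where s: "0 < s" "cball z s \<subseteq> U" using assms(2) zU open_contains_cball by metis
    \<comment> \<open>\<open>s\<close> keeps the ball in \<open>U\<close>, 1 and
      \<open>\<delta>\<close> are the ranges of the two estimates for \<open>h\<close>, and the last
      entry makes the cubic error at most half of the gain.\<close>
    define r where "r = Min {s, 1, \<delta>, \<epsilon> / (2 * (E / mass + 1))}"
    have Em: "0 \<le> E / mass" using h(2) mass_pos by simp
    then have r: "0 < r" "r \<le> s" "r \<le> 1" "r \<le> \<delta>" "r \<le> \<epsilon> / (2 * (E / mass + 1))"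
      using s del \<epsilon> by (auto simp: r_def)
    show False
    proof (rule no_strict_local_maximum[OF assms(1) zH r(1), of h' "E / mass + 2 * \<epsilon> * norm (z - p)" "\<epsilon> / 2"])
      have "cball z r \<subseteq> U" using s(2) r(2) by auto
      then show "cball z r \<inter> K = {}" using assms(3) by blast
      show "cpolynomial h'" unfolding h'_def
        by (intro cpolynomial.add cpolynomial.mult cpolynomial.const cpolynomial_cdot h)
      show "0 < \<epsilon> / 2" using \<epsilon> by simp
      fix y :: "complex ^ 'n" assume y: "norm y \<le> r"
      have "cmod (h' y) \<le> (1 / mass) * cmod (h y) + (2 * \<epsilon>) * cmod (cdot y (z - p))"
        unfolding h'_def using mass_pos \<epsilon>
        by (intro order_trans[OF norm_triangle_ineq]) (simp add: norm_mult norm_divide)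
      also have "\<dots> \<le> (1 / mass) * (E * norm y) + (2 * \<epsilon>) * (norm y * norm (z - p))"
        using mass_pos \<epsilon> y r h(3) by (intro add_mono mult_left_mono cmod_cdot_le) auto
      finally show "cmod (h' y) \<le> (E / mass + 2 * \<epsilon> * norm (z - p)) * norm y"
        by (simp add: algebra_simps)
      assume yH: "z + y \<in> rational_hull K"
      \<comment> \<open>Hull points this close to \<open>z\<close> lie in \<open>U\<close>, hence in
        \<open>L\<close>, where \<open>z\<close> maximises \<open>\<Psi>\<close>.\<close>
      have "z + y \<in> cball z s" using y r by (simp add: dist_norm)
      then have "z + y \<in> closure U" using s(2) closure_subset by blast
      then have "z + y \<in> L" using yH by (simp add: L_def H_def)
      from z(2)[OF this] have 1: "mollify (z + y) / mass + \<epsilon> * (norm (z + y - p))\<^sup>2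
          \<le> mollify z / mass + \<epsilon> * (norm (z - p))\<^sup>2" by (simp add: \<Psi>_def)
      have 2: "(norm (z + y - p))\<^sup>2 = (norm (z - p))\<^sup>2 + 2 * Re (cdot y (z - p)) + (norm y)\<^sup>2"
        by (simp add: power2_norm_eq_inner Re_cdot inner_add_left inner_add_right inner_diff_left
            inner_diff_right inner_commute)
      have "(mollify z + Re (h y) - E * norm y ^ 3) / mass \<le> mollify (z + y) / mass"
        using h(4)[of y] y r mass_pos by (intro divide_right_mono) auto
      then have 3: "mollify z / mass + Re (h y) / mass - (E / mass) * norm y ^ 3 \<le> mollify (z + y) / mass"
        by (simp add: add_divide_distrib diff_divide_distrib)
      have "(E / mass) * norm y \<le> (E / mass + 1) * r" using y Em by (intro mult_mono) auto
      also have "\<dots> \<le> \<epsilon> / 2"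
      proof -
        have "0 < 2 * (E / mass + 1)" using Em by simp
        then have "r * (2 * (E / mass + 1)) \<le> \<epsilon>" using r(5) by (simp only: pos_le_divide_eq)
        moreover have "x * r \<le> \<epsilon> / 2" if "r * (2 * x) \<le> \<epsilon>" for x
          using that by (simp add: mult.commute)
        ultimately show ?thesis by blast
      qed
      finally have "(E / mass) * norm y * (norm y)\<^sup>2 \<le> \<epsilon> / 2 * (norm y)\<^sup>2" by (intro mult_right_mono) auto
      then have 4: "(E / mass) * norm y ^ 3 \<le> \<epsilon> / 2 * (norm y)\<^sup>2"
        by (simp add: power3_eq_cube power2_eq_square mult.assoc)
      have "Re (h' y) = Re (h y) / mass + 2 * \<epsilon> * Re (cdot y (z - p))" by (simp add: h'_def)
      then show "Re (h' y) \<le> - (\<epsilon> / 2) * (norm y)\<^sup>2"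
      proof -
        have "\<epsilon> * (norm (z + y - p))\<^sup>2 = \<epsilon> * (norm (z - p))\<^sup>2 + 2 * \<epsilon> * Re (cdot y (z - p)) + \<epsilon> * (norm y)\<^sup>2"
          unfolding 2 by (simp add: algebra_simps)
        moreover have "- (\<epsilon> / 2) * (norm y)\<^sup>2 = \<epsilon> / 2 * (norm y)\<^sup>2 - \<epsilon> * (norm y)\<^sup>2" by simp
        ultimately show ?thesis
          using 1 3 4 \<open>Re (h' y) = Re (h y) / mass + 2 * \<epsilon> * Re (cdot y (z - p))\<close> by linarith
      qed
    qed
  qed
  then obtain q0 where q0: "q0 \<in> D" "\<phi> p \<le> \<phi> q0" by blast
  then obtain q where "q \<in> D" "\<forall>z\<in>D. \<phi> z \<le> \<phi> q" using max by blast
  then show ?thesis using q0 by (intro bexI[of _ q]) (auto simp: D_def H_def intro: order_trans)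
qed

end
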